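(* Let $k$ be a non-negative integer or $\infty$, and let $\mathcal{R}^{k}_{\ge 0}(\mathbb{R}^2)$ be the space of complete Riemannian metrics of non-negative curvature on the plane $\mathbb{R}^2$, equipped with the topology of $C^k$ uniform convergence on compact sets. Let $S\subseteq \mathcal{R}^{k}_{\ge 0}(\mathbb{R}^2)$ be a weakly infinite dimensional subspace. Then the complement $\mathcal{R}^{k}_{\ge 0}(\mathbb{R}^2)\setminus S$ is continuum connected. If moreover $S$ is closed in $\mathcal{R}^{k}_{\ge 0}(\mathbb{R}^2)$, then $\mathcal{R}^{k}_{\ge 0}(\mathbb{R}^2)\setminus S$ is path connected.
   Context: Riemannian metrics are smooth ($C^\infty$); $\mathcal{R}^{k}_{\ge 0}(\mathbb{R}^2)$ is a separable metrizable space. A space $X$ is continuum connected if every two points $x,y\in X$ are contained in a compact connected subset of $X$. For disjoint closed subsets $A,B$ of a space $X$, a separator between $A$ and $B$ is a closed subset $L\subseteq X$ such that $X\setminus L$ is the disjoint union of open sets $U$ and $V$ with $A\subseteq U$ and $B\subseteq V$. A family $\{(A_i,B_i): i\in\Gamma\}$ of pairs of disjoint closed subsets of $X$ is essential if for every family $\{L_i: i\in\Gamma\}$, where $L_i$ is a separator between $A_i$ and $B_i$, one has $\bigcap_{i\in\Gamma}L_i\neq\emptyset$. A space $X$ is strongly infinite dimensional if there exists an infinite essential family of pairs of disjoint closed subsets of $X$; it is weakly infinite dimensional if it is not strongly infinite dimensional. *)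

theory Defs
  imports "HOL-Analysis.Analysis" "HOL-Library.Extended_Nat"
begin

section \<open>Iterated partial derivatives\<close>

definition partial_deriv ::
    "'n::finite \<Rightarrow> (real^'n \<Rightarrow> 'b::real_normed_vector) \<Rightarrow> real^'n \<Rightarrow> 'b" where
  "partial_deriv i f x = frechet_derivative f (at x) (axis i 1)"

primrec iter_partial ::
    "'n::finite list \<Rightarrow> (real^'n \<Rightarrow> 'b::real_normed_vector) \<Rightarrow> real^'n \<Rightarrow> 'b" where
  "iter_partial [] f = f"
| "iter_partial (i # is) f = partial_deriv i (iter_partial is f)"

text \<open>Differentiability of all iterated partial derivatives makes all of them continuous, so
  this is the usual class of infinitely differentiable functions.\<close>

definition smooth :: "(real^'n::finite \<Rightarrow> 'b::real_normed_vector) \<Rightarrow> bool" where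
  "smooth f \<longleftrightarrow> (\<forall>is x. iter_partial is f differentiable (at x))"


section \<open>Riemannian metrics on the plane\<close>

text \<open>A metric is given by its matrix of components in the standard coordinates:
  \<open>g x $ i $ j\<close> is the inner product of the i-th and j-th coordinate fields at x.\<close>

type_synonym plane = "real^2"
type_synonym plane_tensor = "plane \<Rightarrow> real^2^2"

definition riemannian_metric :: "plane_tensor \<Rightarrow> bool" where
  "riemannian_metric g \<longleftrightarrow> smooth g \<and>
     (\<forall>x. transpose (g x) = g x \<and> (\<forall>v. v \<noteq> 0 \<longrightarrow> v \<bullet> (g x *v v) > 0))"

text \<open>\<open>valid_path\<close> does not bound the derivative near the finitely many exceptional parameters,
  so the length integral may diverge; \<open>has_integral\<close> discards such paths, whereas
  \<open>integral\<close> would assign them length 0.\<close>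

definition has_riemannian_length :: "plane_tensor \<Rightarrow> (real \<Rightarrow> plane) \<Rightarrow> real \<Rightarrow> bool" where
  "has_riemannian_length g \<gamma> L \<longleftrightarrow>
     ((\<lambda>t. let v = vector_derivative \<gamma> (at t within {0..1}) in sqrt (v \<bullet> (g (\<gamma> t) *v v)))
        has_integral L) {0..1}"

definition riemannian_dist :: "plane_tensor \<Rightarrow> plane \<Rightarrow> plane \<Rightarrow> real" where
  "riemannian_dist g x y =
     Inf {L. \<exists>\<gamma>. valid_path \<gamma> \<and> pathstart \<gamma> = x \<and> pathfinish \<gamma> = y \<and>
                  has_riemannian_length g \<gamma> L}"

definition complete_riemannian :: "plane_tensor \<Rightarrow> bool" where
  "complete_riemannian g \<longleftrightarrow> Metric_space.mcomplete UNIV (riemannian_dist g)"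

definition christoffel :: "plane_tensor \<Rightarrow> 2 \<Rightarrow> 2 \<Rightarrow> 2 \<Rightarrow> plane \<Rightarrow> real" where
  "christoffel g l i j x =
     (\<Sum>m\<in>UNIV. matrix_inv (g x) $ l $ m *
        (partial_deriv i (\<lambda>y. g y $ j $ m) x + partial_deriv j (\<lambda>y. g y $ i $ m) x
          - partial_deriv m (\<lambda>y. g y $ i $ j) x)) / 2"

text \<open>The l-th component of \<open>R(\<partial>\<^sub>i, \<partial>\<^sub>j)\<partial>\<^sub>k\<close>, with the sign convention
  \<open>R(X,Y)Z = \<nabla>\<^sub>X \<nabla>\<^sub>Y Z - \<nabla>\<^sub>Y \<nabla>\<^sub>X Z - \<nabla>\<^bsub>[X,Y]\<^esub> Z\<close>.\<close>

definition riemann_tensor :: "plane_tensor \<Rightarrow> 2 \<Rightarrow> 2 \<Rightarrow> 2 \<Rightarrow> 2 \<Rightarrow> plane \<Rightarrow> real" where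
  "riemann_tensor g l i j k x =
     partial_deriv i (christoffel g l j k) x - partial_deriv j (christoffel g l i k) x
     + (\<Sum>m\<in>UNIV. christoffel g l i m x * christoffel g m j k x
                  - christoffel g l j m x * christoffel g m i k x)"

text \<open>\<open>\<langle>R(\<partial>\<^sub>1, \<partial>\<^sub>2)\<partial>\<^sub>2, \<partial>\<^sub>1\<rangle>\<close> divided by the squared area of the coordinate parallelogram.\<close>

definition gauss_curvature :: "plane_tensor \<Rightarrow> plane \<Rightarrow> real" where
  "gauss_curvature g x = (\<Sum>l\<in>UNIV. riemann_tensor g l 1 2 2 x * g x $ l $ 1) / det (g x)"

definition complete_nonneg_metrics :: "plane_tensor set" where
  "complete_nonneg_metrics =
     {g. riemannian_metric g \<and> complete_riemannian g \<and> (\<forall>x. gauss_curvature g x \<ge> 0)}"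


section \<open>The topology of uniform \<open>C\<^sup>k\<close> convergence on compact sets\<close>

definition Ck_nhd :: "plane_tensor set \<Rightarrow> plane_tensor \<Rightarrow> plane set \<Rightarrow> 2 list \<Rightarrow> real
    \<Rightarrow> plane_tensor set" where
  "Ck_nhd R g C is e = {h \<in> R. \<forall>x\<in>C. dist (iter_partial is h x) (iter_partial is g x) < e}"

definition Ck_topology :: "enat \<Rightarrow> plane_tensor set \<Rightarrow> plane_tensor topology" where
  "Ck_topology k R = topology_generated_by
     {Ck_nhd R g C is e |g C is e. g \<in> R \<and> compact C \<and> enat (length is) \<le> k \<and> e > 0}"

abbreviation complete_nonneg_topology :: "enat \<Rightarrow> plane_tensor topology" where
  "complete_nonneg_topology k \<equiv> Ck_topology k complete_nonneg_metrics"

lemma topspace_Ck_topology [simp]: "topspace (Ck_topology k R) = R"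
proof -
  let ?B = "{Ck_nhd R g C is e |g C is e. g \<in> R \<and> compact C \<and> enat (length is) \<le> k \<and> e > 0}"
  have "g \<in> \<Union>?B" if "g \<in> R" for g
  proof
    have "enat (length []) \<le> k" by (simp add: zero_enat_def[symmetric])
    then show "Ck_nhd R g {} [] 1 \<in> ?B" using that by (force intro: zero_less_one)
    show "g \<in> Ck_nhd R g {} [] 1" using that by (simp add: Ck_nhd_def)
  qed
  then show ?thesis
    unfolding Ck_topology_def topology_generated_by_topspace by (auto simp: Ck_nhd_def)
qed

lemma limitin_Ck_topology:
  assumes R: "\<And>h. h \<in> R \<Longrightarrow> smooth h"
    and ev: "eventually (\<lambda>n. \<sigma> n \<in> R) F"
  shows "limitin (Ck_topology k R) \<sigma> g F \<longleftrightarrow>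
    g \<in> R \<and> (\<forall>C is. compact C \<and> enat (length is) \<le> k \<longrightarrow>
       uniform_limit C (\<lambda>n. iter_partial is (\<sigma> n)) (iter_partial is g) F)"
    (is "?L \<longleftrightarrow> ?M")
proof
  assume L: ?L
  then have g: "g \<in> R" by (metis limitin_topspace topspace_Ck_topology)
  moreover have "uniform_limit C (\<lambda>n. iter_partial is (\<sigma> n)) (iter_partial is g) F"
    if C: "compact C" "enat (length is) \<le> k" for C "is"
    unfolding uniform_limit_iff
  proof (intro allI impI)
    fix e :: real assume e: "e > 0"
    have "openin (Ck_topology k R) (Ck_nhd R g C is e)"
      unfolding Ck_topology_def using g C e by (intro topology_generated_by_Basis) blast
    moreover have "g \<in> Ck_nhd R g C is e" using g e by (simp add: Ck_nhd_def)
    ultimately have "eventually (\<lambda>n. \<sigma> n \<in> Ck_nhd R g C is e) F"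
      using L by (auto simp: limitin_def)
    then show "\<forall>\<^sub>F n in F. \<forall>x\<in>C. dist (iter_partial is (\<sigma> n) x) (iter_partial is g x) < e"
      by eventually_elim (simp add: Ck_nhd_def)
  qed
  ultimately show ?M by blast
next
  assume M: ?M
  have "eventually (\<lambda>n. \<sigma> n \<in> U) F" if "openin (Ck_topology k R) U" "g \<in> U" for U
    using openin_topology_generated_by[OF that(1)[unfolded Ck_topology_def]] that(2)
  proof induction
    case (Int a b)
    then show ?case by (auto intro: eventually_conj)
  next
    case (UN K)
    then obtain u where u: "u \<in> K" "g \<in> u" by blast
    with UN have "eventually (\<lambda>n. \<sigma> n \<in> u) F" by blast
    then show ?case by eventually_elim (use u in blast)
  next
    case (Basis s)
    then obtain g0 C "is" e where s: "s = Ck_nhd R g0 C is e" and g0: "g0 \<in> R"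
      and C: "compact C" "enat (length is) \<le> k" and e: "e > 0" by blast
    have cont: "continuous_on C (iter_partial is h)" if "h \<in> R" for h
      using R[OF that] unfolding smooth_def
      by (meson continuous_at_imp_continuous_on differentiable_imp_continuous_within)
    define d where "d = (\<lambda>x. dist (iter_partial is g x) (iter_partial is g0 x))"
    have cd: "continuous_on C d"
      unfolding d_def using cont[of g] cont[of g0] M g0 by (intro continuous_intros) auto
    have lt: "d x < e" if "x \<in> C" for x
      using Basis s that by (simp add: Ck_nhd_def d_def)
    obtain b where b: "b < e" "\<And>x. x \<in> C \<Longrightarrow> d x \<le> b"
    proof (cases "C = {}")
      case True
      with that[of 0] e show ?thesis by simp
    next
      case False
      obtain z where "z \<in> C" "\<And>x. x \<in> C \<Longrightarrow> d x \<le> d z"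
        using continuous_attains_sup[OF C(1) False cd] by blast
      with that[of "d z"] lt show ?thesis by blast
    qed
    have "\<forall>\<^sub>F n in F. \<forall>x\<in>C. dist (iter_partial is (\<sigma> n) x) (iter_partial is g x) < e - b"
      using M C b(1) unfolding uniform_limit_iff by simp
    with ev show ?case
    proof eventually_elim
      case (elim n)
      have "dist (iter_partial is (\<sigma> n) x) (iter_partial is g0 x) < e" if "x \<in> C" for x
      proof -
        have "dist (iter_partial is (\<sigma> n) x) (iter_partial is g0 x)
            \<le> dist (iter_partial is (\<sigma> n) x) (iter_partial is g x) + d x"
          unfolding d_def by (rule dist_triangle)
        with elim that b(2)[OF that] show ?thesis by fastforce
      qed
      with elim show ?case unfolding s Ck_nhd_def by simp
    qed
  qed simp
  with M show ?L by (auto simp: limitin_def)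
qed


section \<open>Continuum connectedness and infinite dimensionality\<close>

definition continuum_connected :: "'a topology \<Rightarrow> bool" where
  "continuum_connected X \<longleftrightarrow>
     (\<forall>x\<in>topspace X. \<forall>y\<in>topspace X.
        \<exists>C. compactin X C \<and> connectedin X C \<and> x \<in> C \<and> y \<in> C)"

definition separator :: "'a topology \<Rightarrow> 'a set \<Rightarrow> 'a set \<Rightarrow> 'a set \<Rightarrow> bool" where
  "separator X A B L \<longleftrightarrow> closedin X L \<and>
     (\<exists>U V. openin X U \<and> openin X V \<and> U \<inter> V = {} \<and> topspace X - L = U \<union> V \<and>
            A \<subseteq> U \<and> B \<subseteq> V)"

definition essential_family ::
    "'a topology \<Rightarrow> 'i set \<Rightarrow> ('i \<Rightarrow> 'a set) \<Rightarrow> ('i \<Rightarrow> 'a set) \<Rightarrow> bool" where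
  "essential_family X \<Gamma> A B \<longleftrightarrow>
     (\<forall>i\<in>\<Gamma>. closedin X (A i) \<and> closedin X (B i) \<and> A i \<inter> B i = {}) \<and>
     (\<forall>L. (\<forall>i\<in>\<Gamma>. separator X (A i) (B i) (L i)) \<longrightarrow> topspace X \<inter> (\<Inter>i\<in>\<Gamma>. L i) \<noteq> {})"

text \<open>Index sets of type \<open>nat set\<close> suffice: an infinite essential family over an arbitrary index
  type has a countably infinite essential subfamily; see the lemma below.\<close>

definition strongly_infinite_dimensional :: "'a topology \<Rightarrow> bool" where
  "strongly_infinite_dimensional X \<longleftrightarrow>
     (\<exists>(\<Gamma> :: nat set) A B. infinite \<Gamma> \<and> essential_family X \<Gamma> A B)"

definition weakly_infinite_dimensional :: "'a topology \<Rightarrow> bool" where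
  "weakly_infinite_dimensional X \<longleftrightarrow> \<not> strongly_infinite_dimensional X"

lemma essential_family_imp_strongly_infinite_dimensional:
  fixes \<Gamma> :: "'i set"
  assumes inf: "infinite \<Gamma>" and ess: "essential_family X \<Gamma> A B"
  shows "strongly_infinite_dimensional X"
proof -
  obtain i0 where i0: "i0 \<in> \<Gamma>" "(\<exists>i\<in>\<Gamma>. \<forall>L. \<not> separator X (A i) (B i) L) \<Longrightarrow>
      \<forall>L. \<not> separator X (A i0) (B i0) L"
    using inf by (metis finite.emptyI equals0I)
  obtain f0 :: "nat \<Rightarrow> 'i" where f0: "inj f0" "range f0 \<subseteq> \<Gamma>"
    using infinite_countable_subset[OF inf] by blast
  define f where "f n = (case n of 0 \<Rightarrow> i0 | Suc m \<Rightarrow> f0 m)" for n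
  have f\<Gamma>: "f n \<in> \<Gamma>" for n using f0 i0 by (auto simp: f_def split: nat.split)
  define N where "N = {n. \<forall>m<n. f m \<noteq> f n}"
  have rangeN: "\<exists>n\<in>N. f n = f m" for m
  proof -
    define n where "n = (LEAST n. f n = f m)"
    have "f n = f m" unfolding n_def by (rule LeastI[of _ m]) simp
    moreover have "f j \<noteq> f n" if "j < n" for j
      using not_less_Least[of j "\<lambda>n. f n = f m"] that \<open>f n = f m\<close> by (simp add: n_def)
    ultimately have "n \<in> N" by (simp add: N_def)
    with \<open>f n = f m\<close> show ?thesis by blast
  qed
  have injN: "inj_on f N"
    by (rule inj_onI) (metis (mono_tags, lifting) N_def linorder_neqE_nat mem_Collect_eq)
  have "range f0 \<subseteq> f ` N"
  proof safe
    fix m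
    have "f (Suc m) = f0 m" by (simp add: f_def)
    with rangeN[of "Suc m"] show "f0 m \<in> f ` N" by (metis imageI)
  qed
  then have infN: "infinite N"
    using f0(1) by (meson finite_imageI finite_subset range_inj_infinite)
  have "topspace X \<inter> (\<Inter>n\<in>N. L n) \<noteq> {}"
    if L: "\<forall>n\<in>N. separator X (A (f n)) (B (f n)) (L n)" for L
  proof -
    obtain n0 where "n0 \<in> N" "f n0 = i0" using rangeN[of 0] by (auto simp: f_def)
    with L have "\<exists>L. separator X (A i0) (B i0) L" by metis
    with i0(2) have "\<forall>i\<in>\<Gamma>. \<exists>L. separator X (A i) (B i) L" by blast
    then obtain M where M: "\<And>i. i \<in> \<Gamma> \<Longrightarrow> separator X (A i) (B i) (M i)" by metis
    define L' where "L' i = (if i \<in> f ` N then L (the_inv_into N f i) else M i)" for i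
    have L'f: "L' (f n) = L n" if "n \<in> N" for n
      using that injN by (simp add: L'_def the_inv_into_f_f)
    have "separator X (A i) (B i) (L' i)" if "i \<in> \<Gamma>" for i
    proof (cases "i \<in> f ` N")
      case True
      then show ?thesis using L L'f by auto
    next
      case False
      then show ?thesis using M[OF that] by (simp add: L'_def)
    qed
    then have "topspace X \<inter> (\<Inter>i\<in>\<Gamma>. L' i) \<noteq> {}"
      using ess by (simp add: essential_family_def)
    moreover have "(\<Inter>i\<in>\<Gamma>. L' i) \<subseteq> (\<Inter>n\<in>N. L n)"
      using f\<Gamma> L'f by blast
    ultimately show ?thesis by blast
  qed
  then have "essential_family X N (A \<circ> f) (B \<circ> f)"
    using ess f\<Gamma> by (simp add: essential_family_def)
  with infN show ?thesis unfolding strongly_infinite_dimensional_def by blast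
qed

end

theory Submission
  imports Defs
begin

text \<open>If \<open>\<psi>\<close> is the homothety of factor \<open>s > 0\<close>, then \<open>(\<psi>\<^sup>* g) / s\<^sup>2\<close> has components \<open>x \<mapsto> g (s x)\<close>. Letting
  \<open>s\<close> tend to 0 joins every complete nonnegatively curved \<open>g\<close> to a flat metric, with no
  uniformization theorem, and flat metrics form a convex cone.

  To avoid \<open>S\<close>, each such path is thickened to a Hilbert cube of paths by pulling back along shears
  \<open>(x, y) \<mapsto> (x + h y, y)\<close>, where \<open>h\<close> is an exponential generating function with bounded coefficients
  and \<open>h 0 = 0\<close>. The shear leaves the (1,1)-component at the origin unchanged, so this component can
  record the time; then \<open>h\<close> is recovered from the metric as the solution of an ordinary differential
  equation. Hence the map from the cube is injective up to its ends.

  If \<open>S\<close> is weakly infinite dimensional, then the separators with empty intersection that it admits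
  between opposite faces extend over the cube. Since the faces of the Hilbert cube form an
  essential family (Kuhn's combinatorial lemma), the intersection of the extended separators contains
  a continuum that misses \<open>S\<close> and crosses the cube in the time direction. If \<open>S\<close> is closed, the
  continuum lies in an open subset of the locally path connected cube, hence a path exists.\<close>

section \<open>Separators in the Hilbert cube\<close>

text \<open>Complete metrics of nonnegative curvature do not survive small perturbations, so a
  thickening cannot simply add tensors. Pullback along a diffeomorphism, combined with a positive
  constant factor, always preserves both conditions; the price is that the deformation and the time
  must be readable from the resulting metric. The factor \<open>c\<close> serves the time: the
  contraction \<open>x \<mapsto> g (s x)\<close> leaves the value at the origin fixed, and
  \<open>c\<close> makes its (1,1)-component injective in time.

  The crossing continuum cannot be told where on a face to begin or end. A weight \<open>w\<close>
  on the free coefficients therefore vanishes at the times whose endpoint is prescribed, which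
  collapses that face to one metric. The contraction is pinned only at its start and ends in a flat
  metric with an uncontrolled shear; the link between two flat metrics is pinned at both ends and
  accepts arbitrary shears there. Times with \<open>w = 0\<close> do no harm: coordinates are
  recovered only over \<open>S\<close>, and the pinned metrics avoid \<open>S\<close>.\<close>

definition hilbert_cube :: "(nat \<Rightarrow> real) set" where
  "hilbert_cube = (\<Pi>\<^sub>E i\<in>UNIV. {0..1})"

lemma hilbert_cube_iff: "x \<in> hilbert_cube \<longleftrightarrow> (\<forall>i. 0 \<le> x i \<and> x i \<le> 1)"
  by (auto simp: hilbert_cube_def PiE_iff)

lemma top_of_set_hilbert_cube:
  "top_of_set hilbert_cube = product_topology (\<lambda>i. top_of_set {0..1}) UNIV"
  unfolding hilbert_cube_def by (simp flip: euclidean_product_topology subtopology_product_topology)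

lemma compact_hilbert_cube: "compact hilbert_cube"
proof -
  have "compactin (product_topology (\<lambda>i::nat. euclideanreal) UNIV) hilbert_cube"
    unfolding hilbert_cube_def by (simp add: compactin_PiE)
  then show ?thesis by (simp add: euclidean_product_topology)
qed

lemma locally_path_connected_hilbert_cube:
  "locally_path_connected_space (top_of_set hilbert_cube)"
proof -
  \<comment> \<open>A nonempty infinite product is locally path connected only if all but finitely
    many factors are path connected.\<close>
  have "path_connectedin euclideanreal {0..1}"
    by (simp add: path_connectedin_iff_path_connected_real convex_imp_path_connected)
  then have "path_connected_space (top_of_set {0..1::real})"
    by (simp add: path_connectedin_def)
  then show ?thesis
    unfolding top_of_set_hilbert_cube locally_path_connected_space_product_topology
    using locally_path_connected_real_interval(1) by auto
qed

lemma tendsto_fun_iff: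
  fixes f :: "'b \<Rightarrow> 'i \<Rightarrow> 'c::topological_space"
  shows "(f \<longlongrightarrow> l) F \<longleftrightarrow> (\<forall>i. ((\<lambda>n. f n i) \<longlongrightarrow> l i) F)"
  using limitin_componentwise[of "\<lambda>i. euclidean" UNIV f l F]
  by (simp add: euclidean_product_topology)

lemma openin_top_of_set_eventually:
  assumes "openin (top_of_set S) U" "(f \<longlongrightarrow> z) F" "z \<in> U" "\<And>n. f n \<in> S"
  shows "eventually (\<lambda>n. f n \<in> U) F"
proof -
  obtain O' where "open O'" "U = S \<inter> O'" using assms(1) by (auto simp: openin_open)
  moreover have "eventually (\<lambda>n. f n \<in> O') F"
    using topological_tendstoD[OF assms(2) \<open>open O'\<close>] assms(3) \<open>U = S \<inter> O'\<close> by auto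
  ultimately show ?thesis using assms(4) by simp
qed

text \<open>An infinite dimensional Poincare-Miranda theorem. Kuhn's lemma in the first
  \<open>n\<close> coordinates gives a cell of side 1/(n+1) that, for each \<open>i < n\<close>,
  meets \<open>U i\<close> and its complement. A limit point of these cells works: it is a limit of
  points of \<open>U i\<close>, hence outside \<open>V i\<close>, and a limit of points outside
  \<open>U i\<close>, hence outside \<open>U i\<close>.\<close>

theorem hilbert_cube_faces_essential:
  assumes U: "\<And>i. openin (top_of_set hilbert_cube) (U i)"
    and V: "\<And>i. openin (top_of_set hilbert_cube) (V i)"
    and disj: "\<And>i. U i \<inter> V i = {}"
    and face0: "\<And>i x. x \<in> hilbert_cube \<Longrightarrow> x i = 0 \<Longrightarrow> x \<in> U i"
    and face1: "\<And>i x. x \<in> hilbert_cube \<Longrightarrow> x i = 1 \<Longrightarrow> x \<in> V i"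
  obtains z where "z \<in> hilbert_cube" "\<And>i. z \<notin> U i" "\<And>i. z \<notin> V i"
proof -
  \<comment> \<open>A grid of mesh 1/(n+1) in the first \<open>n\<close> coordinates, zero
    elsewhere. Dimension and mesh are refined together so that every index is eventually
    covered.\<close>
  define pt where "pt n x = (\<lambda>i::nat. if i < n then real (x i) / real (Suc n) else 0)" for n and x :: "nat \<Rightarrow> nat"
  have pt_cube: "pt n x \<in> hilbert_cube" if "\<forall>i<n. x i \<le> Suc n" for n x
    using that by (auto simp: pt_def hilbert_cube_iff divide_simps simp del: of_nat_Suc)
  have "\<exists>q. (\<forall>i<n. q i < Suc n) \<and> (\<forall>i<n. \<exists>r s. (\<forall>j<n. q j \<le> r j \<and> r j \<le> q j + 1) \<and>
      (\<forall>j<n. q j \<le> s j \<and> s j \<le> q j + 1) \<and> pt n r \<in> U i \<and> pt n s \<notin> U i)" for n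
  proof -
    define label where "label x i = (if pt n x \<in> U i then 0 else 1::nat)" for x i
    have l0: "\<forall>x. (\<forall>i<n. x i \<le> Suc n) \<longrightarrow> (\<forall>i<n. x i = 0 \<longrightarrow> label x i = 0)"
      by (auto simp: label_def intro!: face0 pt_cube) (auto simp: pt_def)
    have l1: "\<forall>x. (\<forall>i<n. x i \<le> Suc n) \<longrightarrow> (\<forall>i<n. x i = Suc n \<longrightarrow> label x i = 1)"
    proof (intro allI impI)
      fix x i assume "\<forall>i<n. x i \<le> Suc n" "i < n" "x i = Suc n"
      then have "pt n x \<in> V i" by (intro face1 pt_cube) (auto simp: pt_def)
      then show "label x i = 1" using disj by (auto simp: label_def)
    qed
    obtain q where q: "\<forall>i<n. q i < Suc n"
      "\<forall>i<n. \<exists>r s. (\<forall>j<n. q j \<le> r j \<and> r j \<le> q j + 1) \<and>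
        (\<forall>j<n. q j \<le> s j \<and> s j \<le> q j + 1) \<and> label r i \<noteq> label s i"
      by (rule kuhn_lemma[of "Suc n" n label]) (use l0 l1 in \<open>simp_all add: label_def\<close>)
    have "\<exists>r s. (\<forall>j<n. q j \<le> r j \<and> r j \<le> q j + 1) \<and>
      (\<forall>j<n. q j \<le> s j \<and> s j \<le> q j + 1) \<and> pt n r \<in> U i \<and> pt n s \<notin> U i" if "i < n" for i
      using q(2)[rule_format, OF that] by (auto simp: label_def split: if_splits)
    with q(1) show ?thesis by blast
  qed
  then have "\<exists>q. \<forall>n. (\<forall>i<n. q n i < Suc n) \<and> (\<forall>i<n. \<exists>r s. (\<forall>j<n. q n j \<le> r j \<and> r j \<le> q n j + 1) \<and>
      (\<forall>j<n. q n j \<le> s j \<and> s j \<le> q n j + 1) \<and> pt n r \<in> U i \<and> pt n s \<notin> U i)"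
    by (intro choice allI)
  then obtain q where q0: "\<forall>n. (\<forall>i<n. q n i < Suc n) \<and> (\<forall>i<n. \<exists>r s. (\<forall>j<n. q n j \<le> r j \<and> r j \<le> q n j + 1) \<and>
      (\<forall>j<n. q n j \<le> s j \<and> s j \<le> q n j + 1) \<and> pt n r \<in> U i \<and> pt n s \<notin> U i)" ..
  note q = q0[THEN spec, THEN conjunct1, THEN spec, THEN mp] q0[THEN spec, THEN conjunct2, THEN spec, THEN mp]
  define near where "near n x \<longleftrightarrow> (\<forall>j<n. q n j \<le> x j \<and> x j \<le> q n j + 1)" for n x
  have "\<forall>n i. \<exists>r s. i < n \<longrightarrow> near n r \<and> near n s \<and> pt n r \<in> U i \<and> pt n s \<notin> U i"
    unfolding near_def using q(2) by blast
  then obtain r s where rs: "\<And>n i. i < n \<Longrightarrow>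
      near n (r n i) \<and> near n (s n i) \<and> pt n (r n i) \<in> U i \<and> pt n (s n i) \<notin> U i"
    by metis
  have "pt n (q n) \<in> hilbert_cube" for n
    using q(1)[of _ n] by (intro pt_cube) (auto simp: less_imp_le)
  then obtain z \<phi> where z: "z \<in> hilbert_cube" and \<phi>: "strict_mono \<phi>"
    and lim: "((\<lambda>n. pt n (q n)) \<circ> \<phi>) \<longlonglongrightarrow> z"
    using compact_imp_seq_compact[OF compact_hilbert_cube] unfolding seq_compact_def by metis
  \<comment> \<open>Any choice of points from the cells has the same limit, since two points of a
    cell differ by at most 1/(n+1) in each coordinate.\<close>
  have near_lim: "(\<lambda>n. pt (\<phi> n) (x (\<phi> n))) \<longlonglongrightarrow> z" 
    if x: "\<And>n. i < n \<Longrightarrow> near n (x n)" for x and i :: nat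
    unfolding tendsto_fun_iff
  proof
    fix j
    have 1: "(\<lambda>n. pt (\<phi> n) (q (\<phi> n)) j) \<longlonglongrightarrow> z j"
      using lim unfolding tendsto_fun_iff by (simp add: o_def)
    have 2: "(\<lambda>n. 1 / real (Suc (\<phi> n))) \<longlonglongrightarrow> 0"
      using LIMSEQ_subseq_LIMSEQ[OF LIMSEQ_Suc[OF lim_1_over_n] \<phi>] by (simp add: o_def)
    have "eventually (\<lambda>n. norm (pt (\<phi> n) (x (\<phi> n)) j - pt (\<phi> n) (q (\<phi> n)) j) \<le> 1 / real (Suc (\<phi> n))) sequentially"
      using eventually_gt_at_top[of i]
    proof eventually_elim
      case (elim n)
      then have "i < \<phi> n" using seq_suble[OF \<phi>, of n] by linarith
      from x[OF this] show ?case
        by (auto simp: near_def pt_def divide_simps simp del: of_nat_Suc)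
    qed
    then have "(\<lambda>n. pt (\<phi> n) (x (\<phi> n)) j - pt (\<phi> n) (q (\<phi> n)) j) \<longlonglongrightarrow> 0"
      by (rule Lim_null_comparison[OF _ 2])
    from tendsto_add[OF this 1] show "(\<lambda>n. pt (\<phi> n) (x (\<phi> n)) j) \<longlonglongrightarrow> z j" by simp
  qed
  have big: "eventually (\<lambda>n. i < \<phi> n) sequentially" for i
    using filterlim_subseq[OF \<phi>] eventually_gt_at_top[of i] by (simp add: filterlim_iff)
  have in_cube: "near n x \<Longrightarrow> pt n x \<in> hilbert_cube" for n x
    using q(1)[of _ n] by (intro pt_cube) (fastforce simp: near_def)
  show thesis
  proof (rule that[OF z])
    fix i
    \<comment> \<open>For \<open>n \<le> i\<close> the cell says nothing about \<open>U i\<close>;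
      the filler \<open>q n\<close> keeps \<open>near\<close> true, and only the tail
      matters.\<close>
    define x y where "x n = (if i < n then r n i else q n)" and "y n = (if i < n then s n i else q n)" for n
    have near: "near n (x n)" "near n (y n)" for n
      using rs by (auto simp: x_def y_def) (auto simp: near_def)
    show "z \<notin> U i"
    proof
      assume "z \<in> U i"
      from openin_top_of_set_eventually[OF U near_lim this] near(2) in_cube
      have "eventually (\<lambda>n. pt (\<phi> n) (y (\<phi> n)) \<in> U i) sequentially" by blast
      with big[of i] have "eventually (\<lambda>n. False) sequentially"
        by eventually_elim (use rs in \<open>auto simp: y_def\<close>)
      then show False by simp
    qed
    show "z \<notin> V i"
    proof
      assume "z \<in> V i"
      from openin_top_of_set_eventually[OF V near_lim this] near(1) in_cube
      have "eventually (\<lambda>n. pt (\<phi> n) (x (\<phi> n)) \<in> V i) sequentially" by blast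
      with big[of i] have "eventually (\<lambda>n. False) sequentially"
        by eventually_elim (use rs disj in \<open>fastforce simp: x_def\<close>)
      then show False by simp
    qed
  qed
qed

text \<open>Direction 0 has no separator. If no connected subset of the remaining set
  \<open>M\<close> joined the two faces in this direction, \<open>M\<close> would split into two
  closed parts, and the split would supply the missing separator against essentiality.\<close>

lemma hilbert_cube_crossing_continuum:
  assumes U: "\<And>i. openin (top_of_set hilbert_cube) (U i)"
    and V: "\<And>i. openin (top_of_set hilbert_cube) (V i)"
    and disj: "\<And>i. U i \<inter> V i = {}"
    and face0: "\<And>i x. x \<in> hilbert_cube \<Longrightarrow> x (Suc i) = 0 \<Longrightarrow> x \<in> U i"
    and face1: "\<And>i x. x \<in> hilbert_cube \<Longrightarrow> x (Suc i) = 1 \<Longrightarrow> x \<in> V i"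
  obtains C x y where "compact C" "connected C" "C \<subseteq> hilbert_cube - (\<Union>i. U i \<union> V i)"
    "x \<in> C" "x 0 = 0" "y \<in> C" "y 0 = 1"
proof -
  let ?Q = "top_of_set hilbert_cube"
  define M where "M = hilbert_cube - (\<Union>i. U i \<union> V i)"
  have "closedin ?Q M"
    unfolding M_def using U V by (intro closedin_diff openin_Union openin_Un) auto
  then have M: "compact M" using compact_hilbert_cube closedin_compact_eq by blast
  define F where "F a = {x \<in> hilbert_cube. x 0 = a}" for a :: real
  have F: "closed (F a)" for a
  proof -
    have "closedin ?Q {x \<in> hilbert_cube. x 0 = a}"
      by (intro continuous_closedin_preimage_constant continuous_on_subset[OF continuous_on_product_coordinates]) auto
    then show ?thesis unfolding F_def
      using closedin_closed_trans compact_hilbert_cube compact_imp_closed by blast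
  qed
  have "\<exists>C. connected C \<and> C \<subseteq> M \<and> C \<inter> F 0 \<noteq> {} \<and> C \<inter> F 1 \<noteq> {}"
  proof (rule ccontr)
    assume no: "\<not> ?thesis"
    \<comment> \<open>In a compact Hausdorff space, closed sets that no connected set joins lie in
      complementary clopen parts.\<close>
    have "separated_between (top_of_set M) (M \<inter> F 0) (M \<inter> F 1)"
    proof (rule cut_wire_fence_theorem)
      fix C assume "connectedin (top_of_set M) C"
      then show "disjnt C (M \<inter> F 0) \<or> disjnt C (M \<inter> F 1)"
        using no by (auto simp: connectedin_subtopology disjnt_def)
    qed (use M F in \<open>auto simp: compact_space_subtopology Hausdorff_space_subtopology 
          closedin_closed_Int\<close>)
    then obtain D E where DE: "closedin (top_of_set M) D" "closedin (top_of_set M) E" "D \<union> E = M"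
      "disjnt D E" "M \<inter> F 0 \<subseteq> D" "M \<inter> F 1 \<subseteq> E"
      by (auto simp: separated_between_alt)
    have "closed D" "closed E"
      using DE M by (meson closedin_closed_trans compact_imp_closed)+
    \<comment> \<open>Adding the entire faces lets normality of the ambient space produce open sets
      that contain the faces, not only their traces on \<open>M\<close>.\<close>
    moreover have "(D \<union> F 0) \<inter> (E \<union> F 1) = {}"
      using DE by (auto simp: disjnt_def F_def)
    ultimately obtain U0 V0 where UV0: "open U0" "open V0" "D \<union> F 0 \<subseteq> U0" "E \<union> F 1 \<subseteq> V0" "U0 \<inter> V0 = {}"
      using t4_space[of "D \<union> F 0" "E \<union> F 1"] F by blast
    \<comment> \<open>The new pair enters at index 0, the given ones move to
      \<open>Suc i\<close>.\<close>
    define U' V' where "U' = case_nat (hilbert_cube \<inter> U0) U" and "V' = case_nat (hilbert_cube \<inter> V0) V"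
    obtain z where z: "z \<in> hilbert_cube" "\<And>i. z \<notin> U' i" "\<And>i. z \<notin> V' i"
    proof (rule hilbert_cube_faces_essential[of U' V'])
      show "openin ?Q (U' i)" "openin ?Q (V' i)" for i
        using U V UV0 by (auto simp: U'_def V'_def openin_open_Int split: nat.split)
      show "U' i \<inter> V' i = {}" for i using disj UV0 by (auto simp: U'_def V'_def split: nat.split)
      show "x \<in> U' i" if "x \<in> hilbert_cube" "x i = 0" for i x
        using that face0 UV0 by (auto simp: U'_def F_def split: nat.split)
      show "x \<in> V' i" if "x \<in> hilbert_cube" "x i = 1" for i x
        using that face1 UV0 by (auto simp: V'_def F_def split: nat.split)
    qed (use that in blast)
    have "z \<in> M" unfolding M_def using z(1) z(2)[of "Suc _"] z(3)[of "Suc _"] by (auto simp: U'_def V'_def)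
    then have "z \<in> U0 \<union> V0" using DE UV0 by blast
    then show False using z(1) z(2)[of 0] z(3)[of 0] by (auto simp: U'_def V'_def)
  qed
  then obtain C x y where C: "connected C" "C \<subseteq> M" "x \<in> C" "x 0 = 0" "y \<in> C" "y 0 = 1"
    by (auto simp: F_def)
  have "closure C \<subseteq> M" using C M by (simp add: closure_minimal compact_imp_closed)
  moreover from this have "compact (closure C)" using M
    by (metis closed_closure compact_Int_closed inf.absorb2)
  ultimately show thesis
    using that[of "closure C" x y] C connected_imp_connected_closure[of C] closure_subset unfolding M_def by blast
qed

section \<open>Joining points outside a weakly infinite dimensional set\<close>

text \<open>Both conclusions of the final theorem travel in one relation. Each conjunct is symmetric
  and transitive, so a single chain of metrics proves both.\<close>

definition joined :: "'a topology \<Rightarrow> 'a set \<Rightarrow> 'a \<Rightarrow> 'a \<Rightarrow> bool" where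
  "joined X S u v \<longleftrightarrow>
     (\<exists>C. compactin X C \<and> connectedin X C \<and> C \<inter> S = {} \<and> u \<in> C \<and> v \<in> C) \<and>
     (closedin X S \<longrightarrow> path_component_of (subtopology X (topspace X - S)) u v)"

lemma joined_sym: "joined X S u v \<Longrightarrow> joined X S v u"
  unfolding joined_def by (metis path_component_of_sym)

lemma joined_trans: 
  assumes "joined X S u v" "joined X S v w" 
  shows "joined X S u w"
proof -
  obtain C D where *: "compactin X C" "connectedin X C" "C \<inter> S = {}" "u \<in> C" "v \<in> C"
     "compactin X D" "connectedin X D" "D \<inter> S = {}" "v \<in> D" "w \<in> D"
    using assms unfolding joined_def by blast
  then have "compactin X (C \<union> D)" "connectedin X (C \<union> D)" "(C \<union> D) \<inter> S = {}" "u \<in> C \<union> D" "w \<in> C \<union> D"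
    by (auto intro: compactin_Un connectedin_Un)
  then show ?thesis using assms unfolding joined_def by (meson path_component_of_trans)
qed

text \<open>\<open>U\<close> and \<open>V\<close> are open only relative to \<open>S\<close>, so
  their preimages need not be open in the cube. Together with the opposite faces they are still
  separated sets, and separated sets in a metrizable space have disjoint open neighbourhoods. The
  margins 1/3 and 2/3 keep each preimage away from the face added to the other one.\<close>

lemma separation_extends_over_hilbert_cube:
  assumes cont: "continuous_map (top_of_set hilbert_cube) X f"
    and U: "openin (subtopology X S) U" and V: "openin (subtopology X S) V" and "U \<inter> V = {}"
    and lo: "\<And>x. x \<in> hilbert_cube \<Longrightarrow> f x \<in> S \<Longrightarrow> x i \<le> 1/3 \<Longrightarrow> f x \<in> U"
    and hi: "\<And>x. x \<in> hilbert_cube \<Longrightarrow> f x \<in> S \<Longrightarrow> x i \<ge> 2/3 \<Longrightarrow> f x \<in> V"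
  obtains U' V' where "openin (top_of_set hilbert_cube) U'" "openin (top_of_set hilbert_cube) V'"
    "U' \<inter> V' = {}" "\<And>x. x \<in> hilbert_cube \<Longrightarrow> x i = 0 \<Longrightarrow> x \<in> U'" 
    "\<And>x. x \<in> hilbert_cube \<Longrightarrow> x i = 1 \<Longrightarrow> x \<in> V'"
    "\<And>x. x \<in> hilbert_cube \<Longrightarrow> f x \<in> U \<Longrightarrow> x \<in> U'" "\<And>x. x \<in> hilbert_cube \<Longrightarrow> f x \<in> V \<Longrightarrow> x \<in> V'"
proof -
  let ?Q = "top_of_set hilbert_cube"
  obtain OU OV where O: "openin X OU" "U = OU \<inter> S" "openin X OV" "V = OV \<inter> S"
    using U V by (auto simp: openin_subtopology)
  define W1 where "W1 = {x \<in> hilbert_cube. f x \<in> U \<or> x i = 0}"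
  define W2 where "W2 = {x \<in> hilbert_cube. f x \<in> V \<or> x i = 1}"
  have pre: "openin ?Q {x \<in> hilbert_cube. f x \<in> OU}" "openin ?Q {x \<in> hilbert_cube. f x \<in> OV}"
    using openin_continuous_map_preimage[OF cont] O by auto
  have half: "openin ?Q {x \<in> hilbert_cube. x i < a}" "openin ?Q {x \<in> hilbert_cube. x i > a}" for a
  proof -
    have "continuous_on hilbert_cube (\<lambda>x. x i)"
      by (rule continuous_on_subset[OF continuous_on_product_coordinates]) auto
    from continuous_openin_preimage_gen[OF this, of "{..<a}"] continuous_openin_preimage_gen[OF this, of "{a<..}"]
    show "openin ?Q {x \<in> hilbert_cube. x i < a}" "openin ?Q {x \<in> hilbert_cube. x i > a}"
      by (simp_all add: vimage_def Int_def)
  qed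
  \<comment> \<open>\<open>G1\<close> and \<open>G2\<close> are open sets around \<open>W1\<close>
    and \<open>W2\<close>, each missing the other one of these. An open set that misses
    \<open>W2\<close> misses its closure, which yields separatedness.\<close>
  define G1 where "G1 = {x \<in> hilbert_cube. f x \<in> OU} \<inter> {x \<in> hilbert_cube. x i < 2/3} \<union> {x \<in> hilbert_cube. x i < 1/3}"
  define G2 where "G2 = {x \<in> hilbert_cube. f x \<in> OV} \<inter> {x \<in> hilbert_cube. x i > 1/3} \<union> {x \<in> hilbert_cube. x i > 2/3}"
  have opn: "openin ?Q G1" "openin ?Q G2" unfolding G1_def G2_def by (intro openin_Un openin_Int pre half)+
  have lt: "x i < 2/3" if "x \<in> hilbert_cube" "f x \<in> U" for x
  proof (rule ccontr)
    assume "\<not> ?thesis"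
    then have "f x \<in> V" using hi[of x] that O(2) by simp
    with that \<open>U \<inter> V = {}\<close> show False by blast
  qed
  have gt: "x i > 1/3" if "x \<in> hilbert_cube" "f x \<in> V" for x
  proof (rule ccontr)
    assume "\<not> ?thesis"
    then have "f x \<in> U" using lo[of x] that O(4) by simp
    with that \<open>U \<inter> V = {}\<close> show False by blast
  qed
  have WG: "W1 \<subseteq> G1" "W2 \<subseteq> G2" unfolding W1_def W2_def G1_def G2_def using lt gt O by auto
  have "G1 \<inter> W2 = {}" "G2 \<inter> W1 = {}"
    unfolding W1_def W2_def G1_def G2_def using lt gt O \<open>U \<inter> V = {}\<close> by fastforce+
  then have "G1 \<inter> ?Q closure_of W2 = {}" "G2 \<inter> ?Q closure_of W1 = {}"
    by (simp_all add: openin_Int_closure_of_eq_empty opn)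
  with WG have "separatedin ?Q W1 W2"
    unfolding separatedin_def by (auto simp: W1_def W2_def)
  moreover have "metrizable_space ?Q" by (simp add: metrizable_space_euclidean metrizable_space_subtopology)
  ultimately obtain U' V' where "openin ?Q U'" "openin ?Q V'" "W1 \<subseteq> U'" "W2 \<subseteq> V'" "disjnt U' V'"
    using metrizable_space_separation by metis
  then show thesis by (intro that[of U' V']) (auto simp: W1_def W2_def disjnt_def)
qed

text \<open>Recovery of the coordinates \<open>Suc i\<close> over \<open>S\<close> makes the traces
  on \<open>S\<close> of opposite slabs disjoint. The time coordinate carries no pair and stays free
  for the crossing.\<close>

theorem joined_across_hilbert_cube:
  assumes X: "Hausdorff_space X" and cont: "continuous_map (top_of_set hilbert_cube) X f"
    and S: "weakly_infinite_dimensional (subtopology X S)"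
    and inj: "\<And>x y i. x \<in> hilbert_cube \<Longrightarrow> y \<in> hilbert_cube \<Longrightarrow> f x = f y \<Longrightarrow> f x \<in> S \<Longrightarrow> x (Suc i) = y (Suc i)"
  obtains x y where "x \<in> hilbert_cube" "x 0 = 0" "y \<in> hilbert_cube" "y 0 = 1" "f x \<notin> S" "f y \<notin> S" "joined X S (f x) (f y)"
proof -
  let ?Q = "top_of_set hilbert_cube"
  \<comment> \<open>Slabs instead of faces provide the margins needed when separators are pulled
    back to the cube. Their images are closed because the cube is compact and \<open>X\<close> is
    Hausdorff.\<close>
  define A where "A i = S \<inter> f ` {x \<in> hilbert_cube. x (Suc i) \<le> 1/3}" for i
  define B where "B i = S \<inter> f ` {x \<in> hilbert_cube. x (Suc i) \<ge> 2/3}" for i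
  have img: "closedin X (f ` K)" if "closedin ?Q K" for K
  proof (rule compactin_imp_closedin[OF X image_compactin[OF _ cont]])
    show "compactin ?Q K" using that compact_hilbert_cube 
      by (simp add: closedin_compact_space compact_space_subtopology)
  qed
  have clQ: "closedin ?Q {x \<in> hilbert_cube. x i \<le> a}" "closedin ?Q {x \<in> hilbert_cube. x i \<ge> a}" for i a
  proof -
    have "continuous_on hilbert_cube (\<lambda>x. x i)"
      by (rule continuous_on_subset[OF continuous_on_product_coordinates]) auto
    from continuous_closedin_preimage[OF this, of "{..a}"] continuous_closedin_preimage[OF this, of "{a..}"]
    show "closedin ?Q {x \<in> hilbert_cube. x i \<le> a}" "closedin ?Q {x \<in> hilbert_cube. x i \<ge> a}"
      by (simp_all add: vimage_def Int_def)
  qed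
  have "closedin (subtopology X S) (A i)" "closedin (subtopology X S) (B i)" for i
    unfolding A_def B_def by (intro closedin_subtopology_Int_closed img clQ)+
  moreover have "A i \<inter> B i = {}" for i
  proof (rule ccontr)
    assume "\<not> ?thesis"
    then obtain x y where "x \<in> hilbert_cube" "y \<in> hilbert_cube" "x (Suc i) \<le> 1/3" "y (Suc i) \<ge> 2/3"
      "f x = f y" "f x \<in> S"
      unfolding A_def B_def by auto
    with inj[of x y i] show False by simp
  qed
  moreover have "\<not> essential_family (subtopology X S) (UNIV :: nat set) A B"
    using S unfolding weakly_infinite_dimensional_def strongly_infinite_dimensional_def by auto
  ultimately obtain L where L: "\<And>i. separator (subtopology X S) (A i) (B i) (L i)"
    and emp: "topspace (subtopology X S) \<inter> (\<Inter>i. L i) = {}"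
    unfolding essential_family_def by auto
  have "\<exists>U' V'. openin ?Q U' \<and> openin ?Q V' \<and> U' \<inter> V' = {} \<and>
     (\<forall>x\<in>hilbert_cube. (x (Suc i) = 0 \<longrightarrow> x \<in> U') \<and> (x (Suc i) = 1 \<longrightarrow> x \<in> V') \<and>
        (f x \<in> S - L i \<longrightarrow> x \<in> U' \<union> V'))" for i
  proof -
    obtain U V where UV: "openin (subtopology X S) U" "openin (subtopology X S) V" "U \<inter> V = {}"
      "topspace (subtopology X S) - L i = U \<union> V" "A i \<subseteq> U" "B i \<subseteq> V"
      using L[of i] unfolding separator_def by auto
    have fx: "f x \<in> topspace X" if "x \<in> hilbert_cube" for x
      using cont that by (auto simp: continuous_map_def)
    obtain U' V' where "openin ?Q U'" "openin ?Q V'" "U' \<inter> V' = {}"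
      "\<And>x. x \<in> hilbert_cube \<Longrightarrow> x (Suc i) = 0 \<Longrightarrow> x \<in> U'" 
      "\<And>x. x \<in> hilbert_cube \<Longrightarrow> x (Suc i) = 1 \<Longrightarrow> x \<in> V'"
      "\<And>x. x \<in> hilbert_cube \<Longrightarrow> f x \<in> U \<Longrightarrow> x \<in> U'" "\<And>x. x \<in> hilbert_cube \<Longrightarrow> f x \<in> V \<Longrightarrow> x \<in> V'"
      by (rule separation_extends_over_hilbert_cube[OF cont UV(1-3), of "Suc i"])
         (use UV(5,6) in \<open>auto simp: A_def B_def\<close>)
    moreover have "f x \<in> U \<union> V" if "x \<in> hilbert_cube" "f x \<in> S - L i" for x
      using UV(4) that fx by auto
    ultimately show ?thesis by (intro exI[of _ U'] exI[of _ V'] conjI ballI impI) blast+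
  qed
  then obtain U V where UV: "\<And>i. openin ?Q (U i)" "\<And>i. openin ?Q (V i)" "\<And>i. U i \<inter> V i = {}"
    "\<And>i x. x \<in> hilbert_cube \<Longrightarrow> x (Suc i) = 0 \<Longrightarrow> x \<in> U i" "\<And>i x. x \<in> hilbert_cube \<Longrightarrow> x (Suc i) = 1 \<Longrightarrow> x \<in> V i"
    "\<And>i x. x \<in> hilbert_cube \<Longrightarrow> f x \<in> S - L i \<Longrightarrow> x \<in> U i \<union> V i"
    by metis
  obtain C x y where C: "compact C" "connected C" "C \<subseteq> hilbert_cube - (\<Union>i. U i \<union> V i)"
    "x \<in> C" "x 0 = 0" "y \<in> C" "y 0 = 1"
    by (rule hilbert_cube_crossing_continuum[of U V, OF UV(1-5)])
  have CQ: "C \<subseteq> hilbert_cube" using C by auto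
  \<comment> \<open>The \<open>L i\<close> have empty intersection in \<open>S\<close>, so a point
    over \<open>S\<close> misses some \<open>L i\<close> and lies in
    \<open>U i \<union> V i\<close>, which \<open>C\<close> avoids.\<close>
  have CS: "f z \<notin> S" if "z \<in> C" for z
  proof
    assume "f z \<in> S"
    moreover have "f z \<in> topspace X" using cont CQ that by (auto simp: continuous_map_def)
    ultimately obtain i where "f z \<notin> L i" using emp by auto
    then show False using UV(6)[of z i] CQ C(3) that \<open>f z \<in> S\<close> by auto
  qed
  have "compactin ?Q C" "connectedin ?Q C"
    using C CQ by (auto simp: compactin_subtopology connectedin_subtopology)
  then have "compactin X (f ` C)" "connectedin X (f ` C)"
    using image_compactin connectedin_continuous_map_image cont by blast+
  moreover have "f ` C \<inter> S = {}" using CS by auto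
  moreover have "path_component_of (subtopology X (topspace X - S)) (f x) (f y)" if "closedin X S"
  proof -
    \<comment> \<open>For closed \<open>S\<close> this set is open in the cube, hence locally path
      connected. Its components are then path components, so a path can replace
      \<open>C\<close>.\<close>
    define W where "W = {z \<in> hilbert_cube. f z \<in> topspace X - S}"
    have "openin X (topspace X - S)" using that by blast
    then have "openin ?Q W"
      using openin_continuous_map_preimage[OF cont, of "topspace X - S"] by (simp add: W_def)
    then have lpc: "locally_path_connected_space (subtopology ?Q W)"
      by (rule locally_path_connected_space_open_subset[OF locally_path_connected_hilbert_cube])
    have "C \<subseteq> W" unfolding W_def using CS CQ cont by (auto simp: continuous_map_def)
    then have "connectedin (subtopology ?Q W) C"
      using \<open>connectedin ?Q C\<close> by (simp add: connectedin_subtopology)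
    then have "connected_component_of (subtopology ?Q W) x y"
      using C unfolding connected_component_of_def by blast
    then have "path_component_of (subtopology ?Q W) x y"
      using path_component_eq_connected_component_of[OF lpc, of x] by blast
    then obtain p where p: "pathin (subtopology ?Q W) p" "p 0 = x" "p 1 = y"
      unfolding path_component_of_def by blast
    have "continuous_map (subtopology ?Q W) (subtopology X (topspace X - S)) f"
      by (intro continuous_map_into_subtopology continuous_map_from_subtopology cont) (auto simp: W_def)
    then have "pathin (subtopology X (topspace X - S)) (f \<circ> p)"
      using p(1) pathin_compose by blast
    then show ?thesis unfolding path_component_of_def using p by (intro exI[of _ "f \<circ> p"]) auto
  qed
  ultimately have "joined X S (f x) (f y)" unfolding joined_def using C by blast
  then show thesis using that[of x y] C CQ CS by blast
qed

section \<open>Jointly smooth families of functions\<close>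

definition jcont :: "'p::topological_space set \<Rightarrow> ('p \<Rightarrow> real^'n \<Rightarrow> 'b::topological_space) \<Rightarrow> bool" where
  "jcont P u \<longleftrightarrow> continuous_on (P \<times> UNIV) (\<lambda>(\<theta>, x). u \<theta> x)"

text \<open>Derivatives are taken in \<open>x\<close> only; the parameter contributes continuity,
  but jointly with \<open>x\<close>. This is exactly what continuity of the family in the topology
  of uniform convergence on compact sets will use, for every order of derivative.\<close>

primrec jsmooth :: "nat \<Rightarrow> 'p::topological_space set \<Rightarrow> ('p \<Rightarrow> real^'n::finite \<Rightarrow> 'b::real_normed_vector) \<Rightarrow> bool" where
  "jsmooth 0 P u \<longleftrightarrow> jcont P u"
| "jsmooth (Suc n) P u \<longleftrightarrow> jcont P u \<and> (\<forall>\<theta>\<in>P. \<forall>x. u \<theta> differentiable at x) \<and>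
     (\<forall>i. jsmooth n P (\<lambda>\<theta>. partial_deriv i (u \<theta>)))"

lemma partial_derivI: "(f has_derivative f') (at x) \<Longrightarrow> partial_deriv i f x = f' (axis i 1)"
  unfolding partial_deriv_def by (simp flip: frechet_derivative_at)

lemma jcont_cong: "(\<And>\<theta>. \<theta> \<in> P \<Longrightarrow> u \<theta> = v \<theta>) \<Longrightarrow> jcont P u = jcont P v"
  unfolding jcont_def by (intro continuous_on_cong) auto

text \<open>Differentiability is known only for parameters in \<open>P\<close>, so formulas for the
  derivatives may be substituted only there.\<close>

lemma jsmooth_cong: "(\<And>\<theta>. \<theta> \<in> P \<Longrightarrow> u \<theta> = v \<theta>) \<Longrightarrow> jsmooth n P u = jsmooth n P v"
proof (induction n arbitrary: u v)
  case 0
  then show ?case using jcont_cong[of P u v] by simp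
next
  case (Suc n)
  have "jsmooth n P (\<lambda>\<theta>. partial_deriv i (u \<theta>)) = jsmooth n P (\<lambda>\<theta>. partial_deriv i (v \<theta>))" for i
    by (rule Suc.IH) (simp add: Suc.prems)
  with Suc.prems jcont_cong[of P u v] show ?case by simp
qed

lemma jsmooth_jcont: "jsmooth n P u \<Longrightarrow> jcont P u"
  by (cases n) auto

lemma jsmooth_Suc_imp: "jsmooth (Suc n) P u \<Longrightarrow> jsmooth n P u"
  by (induction n arbitrary: u) auto

lemma jsmooth_const:
  fixes c :: "'p::topological_space \<Rightarrow> 'b::real_normed_vector"
  shows "continuous_on P c \<Longrightarrow> jsmooth n P (\<lambda>\<theta> x::real^'n::finite. c \<theta>)"
proof (induction n arbitrary: c)
  case 0
  then show ?case unfolding jsmooth.simps jcont_def split_def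
    by (intro continuous_on_compose2[OF 0 continuous_on_fst]) auto
next
  case (Suc n)
  have "jcont P (\<lambda>\<theta> x::real^'n. c \<theta>)" unfolding jcont_def split_def
    by (intro continuous_on_compose2[OF Suc.prems continuous_on_fst]) (auto intro: continuous_intros)
  moreover have "partial_deriv i (\<lambda>x::real^'n. c \<theta>) = (\<lambda>x. 0)" for i \<theta>
    by (rule ext, subst partial_derivI[OF has_derivative_const]) simp
  ultimately show ?case using Suc.IH[of "\<lambda>_. 0"] by simp
qed

lemma jsmooth_linear:
  assumes L: "bounded_linear L"
  shows "jsmooth n P u \<Longrightarrow> jsmooth n P (\<lambda>\<theta> x. L (u \<theta> x))"
proof (induction n arbitrary: u)
  case 0
  then show ?case unfolding jsmooth.simps jcont_def split_def
    by (intro bounded_linear.continuous_on[OF L])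
next
  case (Suc n)
  have "jcont P (\<lambda>\<theta> x. L (u \<theta> x))"
    using Suc.prems unfolding jsmooth.simps jcont_def split_def by (intro bounded_linear.continuous_on[OF L]) simp
  moreover have d: "((\<lambda>x. L (u \<theta> x)) has_derivative (\<lambda>v. L (frechet_derivative (u \<theta>) (at x) v))) (at x)" if "\<theta> \<in> P" for \<theta> x
    using Suc.prems that
    by (intro bounded_linear.has_derivative[OF L] frechet_derivative_works[THEN iffD1]) simp
  moreover have "(\<lambda>x. L (u \<theta> x)) differentiable at x"
    "partial_deriv i (\<lambda>x. L (u \<theta> x)) = (\<lambda>x. L (partial_deriv i (u \<theta>) x))" if "\<theta> \<in> P" for \<theta> x i
    using d[OF that] by (blast intro: differentiableI, intro ext, subst partial_derivI[OF d[OF that]], simp add: partial_deriv_def)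
  ultimately show ?case
    using Suc jsmooth_cong[of P "\<lambda>\<theta>. partial_deriv i (\<lambda>x. L (u \<theta> x))" "\<lambda>\<theta> x. L (partial_deriv i (u \<theta>) x)" n for i]
    by simp
qed

lemma jsmooth_add:
  "jsmooth n P u \<Longrightarrow> jsmooth n P v \<Longrightarrow> jsmooth n P (\<lambda>\<theta> x. u \<theta> x + v \<theta> x)"
proof (induction n arbitrary: u v)
  case 0
  then show ?case unfolding jsmooth.simps jcont_def split_def by (intro continuous_on_add)
next
  case (Suc n)
  have "jcont P (\<lambda>\<theta> x. u \<theta> x + v \<theta> x)"
    using Suc.prems unfolding jsmooth.simps jcont_def split_def by (intro continuous_on_add) simp_all
  moreover have d: "((\<lambda>x. u \<theta> x + v \<theta> x) has_derivative
      (\<lambda>w. frechet_derivative (u \<theta>) (at x) w + frechet_derivative (v \<theta>) (at x) w)) (at x)" if "\<theta> \<in> P" for \<theta> x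
    using Suc.prems that
    by (intro has_derivative_add frechet_derivative_works[THEN iffD1]) simp_all
  moreover have "(\<lambda>x. u \<theta> x + v \<theta> x) differentiable at x"
    "partial_deriv i (\<lambda>x. u \<theta> x + v \<theta> x) = (\<lambda>x. partial_deriv i (u \<theta>) x + partial_deriv i (v \<theta>) x)" if "\<theta> \<in> P" for \<theta> x i
    using d[OF that] by (blast intro: differentiableI, intro ext, subst partial_derivI[OF d[OF that]], simp add: partial_deriv_def)
  ultimately show ?case
    using Suc jsmooth_cong[of P "\<lambda>\<theta>. partial_deriv i (\<lambda>x. u \<theta> x + v \<theta> x)" 
        "\<lambda>\<theta> x. partial_deriv i (u \<theta>) x + partial_deriv i (v \<theta>) x" n for i]
    by simp
qed

lemma jsmooth_sum:
  assumes "\<And>j. j \<in> J \<Longrightarrow> jsmooth n P (u j)"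
  shows "jsmooth n P (\<lambda>\<theta> x. \<Sum>j\<in>J. u j \<theta> x)"
proof (cases "finite J")
  case True
  then show ?thesis using assms
    by (induction J) (simp_all add: jsmooth_const jsmooth_add)
next
  case False
  then show ?thesis by (simp add: jsmooth_const)
qed

lemma jsmooth_bilinear:
  assumes B: "bounded_bilinear B"
  shows "jsmooth n P u \<Longrightarrow> jsmooth n P v \<Longrightarrow> jsmooth n P (\<lambda>\<theta> x. B (u \<theta> x) (v \<theta> x))"
proof (induction n arbitrary: u v)
  case 0
  then show ?case unfolding jsmooth.simps jcont_def split_def by (intro bounded_bilinear.continuous_on[OF B])
next
  case (Suc n)
  have "jcont P (\<lambda>\<theta> x. B (u \<theta> x) (v \<theta> x))"
    using Suc.prems unfolding jsmooth.simps jcont_def split_def 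
    by (intro bounded_bilinear.continuous_on[OF B]) simp_all
  moreover have d: "((\<lambda>x. B (u \<theta> x) (v \<theta> x)) has_derivative
      (\<lambda>w. B (u \<theta> x) (frechet_derivative (v \<theta>) (at x) w) + B (frechet_derivative (u \<theta>) (at x) w) (v \<theta> x))) (at x)" if "\<theta> \<in> P" for \<theta> x
    using Suc.prems that
    by (intro bounded_bilinear.FDERIV[OF B] frechet_derivative_works[THEN iffD1]) simp_all
  moreover have "(\<lambda>x. B (u \<theta> x) (v \<theta> x)) differentiable at x"
    "partial_deriv i (\<lambda>x. B (u \<theta> x) (v \<theta> x)) = (\<lambda>x. B (u \<theta> x) (partial_deriv i (v \<theta>) x) + B (partial_deriv i (u \<theta>) x) (v \<theta> x))"
    if "\<theta> \<in> P" for \<theta> x i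
    using d[OF that] by (blast intro: differentiableI, intro ext, subst partial_derivI[OF d[OF that]], simp add: partial_deriv_def)
  moreover have "jsmooth n P (\<lambda>\<theta> x. B (u \<theta> x) (partial_deriv i (v \<theta>) x) + B (partial_deriv i (u \<theta>) x) (v \<theta> x))" for i
    using Suc.prems by (intro jsmooth_add Suc.IH jsmooth_Suc_imp[of n P u] jsmooth_Suc_imp[of n P v]) simp_all
  ultimately show ?case
    using jsmooth_cong[of P "\<lambda>\<theta>. partial_deriv i (\<lambda>x. B (u \<theta> x) (v \<theta> x))" 
        "\<lambda>\<theta> x. B (u \<theta> x) (partial_deriv i (v \<theta>) x) + B (partial_deriv i (u \<theta>) x) (v \<theta> x)" n for i]
    by simp
qed

lemma linear_axis_expansion:
  fixes L :: "real^'n::finite \<Rightarrow> 'b::real_vector"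
  assumes "linear L"
  shows "L v = (\<Sum>j\<in>UNIV. v $ j *\<^sub>R L (axis j 1))"
proof -
  have "L v = L (\<Sum>j\<in>UNIV. v $ j *\<^sub>R axis j 1)"
    using basis_expansion[of v] by (simp add: scalar_mult_eq_scaleR)
  then show ?thesis by (simp add: linear_sum[OF assms] linear_cmul[OF assms])
qed

lemma partial_deriv_compose:
  fixes u :: "real^'n::finite \<Rightarrow> 'b::real_normed_vector" and \<psi> :: "real^'m::finite \<Rightarrow> real^'n"
  assumes u: "u differentiable at (\<psi> x)" and \<psi>: "\<psi> differentiable at x"
  shows "(\<lambda>x. u (\<psi> x)) differentiable at x"
    and "partial_deriv i (\<lambda>x. u (\<psi> x)) x = (\<Sum>j\<in>UNIV. partial_deriv i \<psi> x $ j *\<^sub>R partial_deriv j u (\<psi> x))"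
proof -
  let ?u = "frechet_derivative u (at (\<psi> x))" and ?p = "frechet_derivative \<psi> (at x)"
  have "(u \<circ> \<psi> has_derivative ?u \<circ> ?p) (at x)"
    using u \<psi> unfolding frechet_derivative_works by (intro diff_chain_at)
  then have d: "((\<lambda>x. u (\<psi> x)) has_derivative (\<lambda>v. ?u (?p v))) (at x)" by (simp add: o_def)
  then show "(\<lambda>x. u (\<psi> x)) differentiable at x" by (auto simp: differentiable_def)
  have "linear ?u" using u by (rule linear_frechet_derivative)
  then show "partial_deriv i (\<lambda>x. u (\<psi> x)) x = (\<Sum>j\<in>UNIV. partial_deriv i \<psi> x $ j *\<^sub>R partial_deriv j u (\<psi> x))"
    unfolding partial_derivI[OF d] by (subst linear_axis_expansion) (simp_all add: partial_deriv_def)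
qed

text \<open>By the chain rule, a first derivative involves
  \<open>partial_deriv j (u \<theta>)\<close> composed with the same \<open>\<psi>\<close>. The
  induction therefore varies \<open>u\<close> and keeps \<open>\<psi>\<close>.\<close>

lemma jsmooth_compose:
  fixes u :: "'p::topological_space \<Rightarrow> real^'n::finite \<Rightarrow> 'b::real_normed_vector"
    and \<psi> :: "'p \<Rightarrow> real^'m::finite \<Rightarrow> real^'n"
  shows "jsmooth n P u \<Longrightarrow> jsmooth n P \<psi> \<Longrightarrow> jsmooth n P (\<lambda>\<theta> x. u \<theta> (\<psi> \<theta> x))"
proof (induction n arbitrary: u)
  have jc: "jcont P (\<lambda>\<theta> x. u \<theta> (\<psi> \<theta> x))" if "jcont P u" "jcont P \<psi>" for u :: "'p \<Rightarrow> real^'n \<Rightarrow> 'b"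
  proof -
    have "continuous_on (P \<times> UNIV) (\<lambda>z. (fst z, \<psi> (fst z) (snd z)))"
      using that(2) unfolding jcont_def split_def by (intro continuous_on_Pair continuous_on_fst continuous_on_id)
    from continuous_on_compose2[OF that(1)[unfolded jcont_def] this]
    show ?thesis by (simp add: jcont_def split_def image_subset_iff)
  qed
  {
    case 0
    then show ?case using jc by simp
  next
    case (Suc n)
    have *: "(\<lambda>x. u \<theta> (\<psi> \<theta> x)) differentiable at x"
      "partial_deriv i (\<lambda>x. u \<theta> (\<psi> \<theta> x)) = (\<lambda>x. \<Sum>j\<in>UNIV. partial_deriv i (\<psi> \<theta>) x $ j *\<^sub>R partial_deriv j (u \<theta>) (\<psi> \<theta> x))"
      if "\<theta> \<in> P" for \<theta> x i
    proof -
      have "u \<theta> differentiable at (\<psi> \<theta> x)" "\<psi> \<theta> differentiable at x" for x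
        using that Suc.prems by simp_all
      note pc = partial_deriv_compose[OF this]
      show "(\<lambda>x. u \<theta> (\<psi> \<theta> x)) differentiable at x" by (rule pc)
      show "partial_deriv i (\<lambda>x. u \<theta> (\<psi> \<theta> x)) = (\<lambda>x. \<Sum>j\<in>UNIV. partial_deriv i (\<psi> \<theta>) x $ j *\<^sub>R partial_deriv j (u \<theta>) (\<psi> \<theta> x))"
        by (rule ext) (rule pc)
    qed
    have "jsmooth n P (\<lambda>\<theta> x. \<Sum>j\<in>UNIV. partial_deriv i (\<psi> \<theta>) x $ j *\<^sub>R partial_deriv j (u \<theta>) (\<psi> \<theta> x))" for i
      using Suc.prems jsmooth_Suc_imp[OF Suc.prems(2)]
      by (intro jsmooth_sum jsmooth_bilinear[OF bounded_bilinear_scaleR] jsmooth_linear[OF bounded_linear_vec_nth] Suc.IH)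
        simp_all
    with * jc Suc.prems show ?case
      using jsmooth_cong[of P "\<lambda>\<theta>. partial_deriv i (\<lambda>x. u \<theta> (\<psi> \<theta> x))" 
        "\<lambda>\<theta> x. \<Sum>j\<in>UNIV. partial_deriv i (\<psi> \<theta>) x $ j *\<^sub>R partial_deriv j (u \<theta>) (\<psi> \<theta> x)" n for i]
      by simp
  }
qed

text \<open>\<open>iter_partial\<close> peels off the outermost derivative and
  \<open>jsmooth\<close> the innermost one; this translates between the two recursions.\<close>

lemma iter_partial_snoc: "iter_partial (is @ [i]) f = iter_partial is (partial_deriv i f)"
  by (induction "is") auto

lemma jsmooth_iter_partial:
  "jsmooth (length is + n) P u \<Longrightarrow> jsmooth n P (\<lambda>\<theta>. iter_partial is (u \<theta>))"
  by (induction "is" arbitrary: u rule: rev_induct) (simp_all add: iter_partial_snoc)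

lemma jsmooth_imp_smooth:
  assumes "\<And>n. jsmooth n P u" "\<theta> \<in> P"
  shows "smooth (u \<theta>)"
  unfolding smooth_def
proof (intro allI)
  fix "is" x
  have "jsmooth 1 P (\<lambda>\<theta>. iter_partial is (u \<theta>))" by (rule jsmooth_iter_partial) (rule assms)
  then show "iter_partial is (u \<theta>) differentiable at x" using assms(2) by simp
qed

lemma smooth_imp_differentiable: "smooth f \<Longrightarrow> f differentiable at x"
  unfolding smooth_def by (metis iter_partial.simps(1))

lemma smooth_partial_deriv: "smooth f \<Longrightarrow> smooth (partial_deriv i f)"
  unfolding smooth_def by (metis iter_partial_snoc)

lemma smooth_imp_continuous_on: "smooth f \<Longrightarrow> continuous_on S f"
  by (meson continuous_at_imp_continuous_on differentiable_imp_continuous_within smooth_imp_differentiable)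

lemma smooth_imp_jsmooth: "smooth f \<Longrightarrow> jsmooth n P (\<lambda>\<theta>. f)"
proof (induction n arbitrary: f)
  case 0
  then have "continuous_on UNIV f" by (simp add: smooth_imp_continuous_on)
  then show ?case unfolding jsmooth.simps jcont_def split_def
    by (rule continuous_on_compose2) (auto intro: continuous_intros)
next
  case (Suc n)
  then have "continuous_on UNIV f" by (simp add: smooth_imp_continuous_on)
  then have "jcont P (\<lambda>\<theta>. f)" unfolding jsmooth.simps jcont_def split_def
    by (rule continuous_on_compose2) (auto intro: continuous_intros)
  then show ?case using Suc by (simp add: smooth_imp_differentiable smooth_partial_deriv)
qed

lemma jsmooth_coordinate: "jsmooth n P (\<lambda>\<theta> x::real^'n::finite. x $ i)"
proof (rule smooth_imp_jsmooth)
  \<comment> \<open>The coordinate function and the constants together are closed under partial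
    derivatives.\<close>
  have "iter_partial is (\<lambda>x::real^'n. x $ i) = (\<lambda>x. x $ i) \<or> (\<exists>c. iter_partial is (\<lambda>x::real^'n. x $ i) = (\<lambda>x. c))" for "is"
  proof (induction "is")
    case (Cons j js)
    have "partial_deriv j (\<lambda>x::real^'n. x $ i) = (\<lambda>x. axis j 1 $ i)"
      by (rule ext) (rule partial_derivI, rule bounded_linear.has_derivative[OF bounded_linear_vec_nth has_derivative_ident])
    moreover have "partial_deriv j (\<lambda>x::real^'n. c) = (\<lambda>x. 0)" for c :: real
      by (rule ext, subst partial_derivI[OF has_derivative_const]) simp
    ultimately show ?case using Cons by auto
  qed simp
  then show "smooth (\<lambda>x::real^'n. x $ i)" unfolding smooth_def
    by (metis bounded_linear_imp_differentiable bounded_linear_vec_nth differentiable_const)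
qed

text \<open>A tube argument: the parameters violating a subbasic estimate over \<open>C\<close> are
  the projection of a closed subset of \<open>P \<times> C\<close> along the compact factor
  \<open>C\<close>, hence a closed set.\<close>

theorem continuous_map_Ck_topology:
  assumes P: "\<And>\<theta>. \<theta> \<in> P \<Longrightarrow> F \<theta> \<in> R" and F: "\<And>n. jsmooth n P F" and R: "\<And>g. g \<in> R \<Longrightarrow> smooth g"
  shows "continuous_map (top_of_set P) (Ck_topology k R) F"
  unfolding Ck_topology_def continuous_on_generated_topo_iff
proof (intro conjI allI impI)
  fix U assume "U \<in> {Ck_nhd R g C is e |g C is e. g \<in> R \<and> compact C \<and> enat (length is) \<le> k \<and> 0 < e}"
  then obtain g C "is" e where U: "U = Ck_nhd R g C is e" "g \<in> R" "compact C" by blast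
  have g: "continuous_on UNIV (iter_partial is g)"
    using R[OF U(2)] unfolding smooth_def by (meson continuous_at_imp_continuous_on differentiable_imp_continuous_within)
  define D where "D z = dist (iter_partial is (F (fst z)) (snd z)) (iter_partial is g (snd z))" for z
  have "jcont P (\<lambda>\<theta>. iter_partial is (F \<theta>))"
    using jsmooth_jcont[OF jsmooth_iter_partial[OF F, where n = 0]] .
  then have "continuous_on (P \<times> UNIV) D" unfolding D_def jcont_def split_def
    by (intro continuous_on_dist continuous_on_compose2[OF g continuous_on_snd]) (auto intro: continuous_intros)
  then have "continuous_on (P \<times> C) D" by (rule continuous_on_subset) auto
  then have "closedin (top_of_set (P \<times> C)) ((P \<times> C) \<inter> D -` {e..})"
    by (rule continuous_closedin_preimage) simp
  moreover have "closed_map (prod_topology (top_of_set P) (top_of_set C)) (top_of_set P) fst"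
    using U(3) by (intro Abstract_Topological_Spaces.closed_map_fst) (simp add: compact_space_subtopology)
  moreover have "prod_topology (top_of_set P) (top_of_set C) = top_of_set (P \<times> C)"
    by (simp add: subtopology_Times flip: euclidean_product_topology)
  ultimately have "closedin (top_of_set P) (fst ` ((P \<times> C) \<inter> D -` {e..}))"
    unfolding closed_map_def by simp
  moreover have "F -` U \<inter> topspace (top_of_set P) = P - fst ` ((P \<times> C) \<inter> D -` {e..})"
    using P by (force simp: U Ck_nhd_def D_def not_le)
  ultimately show "openin (top_of_set P) (F -` U \<inter> topspace (top_of_set P))"
    by (simp add: closedin_def)
next
  show "F ` topspace (top_of_set P) \<subseteq> \<Union>{Ck_nhd R g C is e |g C is e. g \<in> R \<and> compact C \<and> enat (length is) \<le> k \<and> 0 < e}"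
    using P topspace_Ck_topology[of k R] unfolding Ck_topology_def topology_generated_by_topspace by auto
qed

section \<open>Exponential generating functions\<close>

text \<open>The coefficients are the derivatives at 0. The factorials make every bounded sequence
  admissible, so a whole cube of coefficients acts, and they turn differentiation into
  \<open>shift\<close>, which preserves bounds.\<close>

definition expsum :: "(nat \<Rightarrow> real) \<Rightarrow> real \<Rightarrow> real" where
  "expsum e y = (\<Sum>n. e n / fact n * y ^ n)"

definition shift :: "(nat \<Rightarrow> real) \<Rightarrow> nat \<Rightarrow> real" where
  "shift e n = e (Suc n)"

definition bounded_coeffs :: "(nat \<Rightarrow> real) \<Rightarrow> bool" where
  "bounded_coeffs e \<longleftrightarrow> (\<exists>B. \<forall>n. \<bar>e n\<bar> \<le> B)"

lemma bounded_coeffs_shift: "bounded_coeffs e \<Longrightarrow> bounded_coeffs (shift e)"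
  unfolding bounded_coeffs_def shift_def by blast

lemma expsum_term_bound:
  assumes "\<bar>e n\<bar> \<le> B" "\<bar>y\<bar> \<le> r"
  shows "norm (e n / fact n * y ^ n) \<le> B * (r ^ n / fact n)"
proof -
  have "\<bar>e n\<bar> * \<bar>y\<bar> ^ n \<le> B * r ^ n"
    using assms by (intro mult_mono power_mono) auto
  then show ?thesis by (simp add: abs_mult power_abs divide_simps)
qed

lemma summable_pow_fact: "summable (\<lambda>n. B * (r ^ n / fact n :: real))"
  using summable_exp[of r] by (intro summable_mult) (simp add: divide_inverse mult.commute)

lemma summable_expsum:
  assumes "bounded_coeffs e"
  shows "summable (\<lambda>n. e n / fact n * y ^ n)"
proof -
  obtain B where "\<And>n. \<bar>e n\<bar> \<le> B" using assms unfolding bounded_coeffs_def by blast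
  then have "norm (e n / fact n * y ^ n) \<le> B * (\<bar>y\<bar> ^ n / fact n)" for n
    using expsum_term_bound by blast
  then show ?thesis by (intro summable_comparison_test[OF _ summable_pow_fact[of B "\<bar>y\<bar>"]] exI) auto
qed

lemma has_real_derivative_expsum:
  assumes "bounded_coeffs e"
  shows "(expsum e has_real_derivative expsum (shift e) y) (at y)"
proof -
  have "((\<lambda>y. \<Sum>n. e n / fact n * y ^ n) has_real_derivative (\<Sum>n. diffs (\<lambda>n. e n / fact n) n * y ^ n)) (at y)"
    using assms by (intro termdiffs_strong_converges_everywhere summable_expsum)
  moreover have "diffs (\<lambda>n. e n / fact n) = (\<lambda>n. shift e n / fact n)"
    by (rule ext) (simp add: diffs_def shift_def divide_simps)
  ultimately show ?thesis unfolding expsum_def[abs_def] by simp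
qed

lemma expsum_0: "expsum e 0 = e 0"
  unfolding expsum_def by (subst suminf_finite[of "{0}"]) auto

text \<open>The value at 0 is the first coefficient, and differentiation moves the next one into
  that place.\<close>

lemma expsum_inject:
  assumes "bounded_coeffs e" "bounded_coeffs e'" "expsum e = expsum e'"
  shows "e n = e' n"
  using assms
proof (induction n arbitrary: e e')
  case 0
  then show ?case using expsum_0 by metis
next
  case (Suc n)
  have "expsum (shift e) = expsum (shift e')"
  proof
    fix y
    have "(expsum e has_real_derivative expsum (shift e') y) (at y)"
      unfolding Suc.prems(3) by (rule has_real_derivative_expsum[OF Suc.prems(2)])
    then show "expsum (shift e) y = expsum (shift e') y"
      using has_real_derivative_expsum[OF Suc.prems(1)] by (rule DERIV_unique[rotated])
  qed
  then have "shift e n = shift e' n"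
    using Suc by (simp add: bounded_coeffs_shift)
  then show ?case by (simp add: shift_def)
qed

text \<open>Differentiation replaces \<open>e\<close> by its shift with the same bound
  \<open>B\<close>, which drives the induction. The Weierstrass test with majorant
  \<open>B * r^n / n!\<close> is uniform only on balls of radius \<open>r\<close>, but continuity is
  a local matter.\<close>

lemma jsmooth_expsum:
  fixes e :: "'p::t2_space \<Rightarrow> nat \<Rightarrow> real"
  assumes "\<And>n. continuous_on P (\<lambda>\<theta>. e \<theta> n)" "\<And>\<theta> n. \<theta> \<in> P \<Longrightarrow> \<bar>e \<theta> n\<bar> \<le> B"
  shows "jsmooth n P (\<lambda>\<theta> x::real^'n::finite. expsum (e \<theta>) (x $ k))"
  using assms
proof (induction n arbitrary: e)
  have jc: "jcont P (\<lambda>\<theta> x. expsum (e \<theta>) (x $ k))"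
    if c: "\<And>n. continuous_on P (\<lambda>\<theta>. e \<theta> n)" and b: "\<And>\<theta> n. \<theta> \<in> P \<Longrightarrow> \<bar>e \<theta> n\<bar> \<le> B" for e :: "'p \<Rightarrow> nat \<Rightarrow> real"
  proof -
    have loc: "continuous_on (P \<times> ball 0 r) (\<lambda>z. expsum (e (fst z)) (snd z $ k))" for r
      unfolding expsum_def
    proof (rule uniform_limit_theorem)
      show "uniform_limit (P \<times> ball 0 r) (\<lambda>N z. \<Sum>n<N. e (fst z) n / fact n * (snd z $ k) ^ n)
         (\<lambda>z. \<Sum>n. e (fst z) n / fact n * (snd z $ k) ^ n) sequentially"
      proof (rule Weierstrass_m_test)
        fix n z assume "z \<in> P \<times> ball (0::real^'n) r"
        then show "norm (e (fst z) n / fact n * (snd z $ k) ^ n) \<le> B * (r ^ n / fact n)"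
          using b component_le_norm_cart[of "snd z" k] by (intro expsum_term_bound) auto
      qed (rule summable_pow_fact)
      show "\<forall>\<^sub>F N in sequentially. continuous_on (P \<times> ball 0 r) (\<lambda>z. \<Sum>n<N. e (fst z) n / fact n * (snd z $ k) ^ n)"
        by (intro always_eventually allI continuous_intros continuous_on_compose2[OF c continuous_on_fst]) auto
    qed simp
    have "continuous (at z within P \<times> UNIV) (\<lambda>z. expsum (e (fst z)) (snd z $ k))" if z: "z \<in> P \<times> UNIV"
      for z :: "'p \<times> (real^'n)"
    proof -
      let ?r = "norm (snd z) + 1"
      have "at z within P \<times> UNIV = at z within P \<times> ball 0 ?r"
        by (rule at_within_nhd[of _ "UNIV \<times> ball 0 ?r"]) (use z in \<open>auto intro: open_Times simp: mem_Times_iff\<close>)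
      moreover have "z \<in> P \<times> ball 0 ?r" using z by (auto simp: mem_Times_iff)
      ultimately show ?thesis using bspec[OF loc[of ?r, unfolded continuous_on_eq_continuous_within]] by simp
    qed
    then show ?thesis unfolding jcont_def split_def continuous_on_eq_continuous_within by blast
  qed
  {
    case 0
    then show ?case using jc by simp
  next
    case (Suc n)
    have b: "bounded_coeffs (e \<theta>)" if "\<theta> \<in> P" for \<theta>
      using Suc.prems(2)[OF that] unfolding bounded_coeffs_def by blast
    have "((\<lambda>x::real^'n. expsum (e \<theta>) (x $ k)) has_derivative (\<lambda>v. v $ k * expsum (shift (e \<theta>)) (x $ k))) (at x)"
      if "\<theta> \<in> P" for \<theta> x
    proof -
      have "((\<lambda>x::real^'n. x $ k) has_derivative (\<lambda>v. v $ k)) (at x)"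
        by (rule bounded_linear.has_derivative[OF bounded_linear_vec_nth has_derivative_ident])
      from DERIV_compose_FDERIV[OF has_real_derivative_expsum[OF b[OF that]] this] show ?thesis .
    qed
    note d = this
    have *: "(\<lambda>x::real^'n. expsum (e \<theta>) (x $ k)) differentiable at x"
      "partial_deriv i (\<lambda>x::real^'n. expsum (e \<theta>) (x $ k)) = (\<lambda>x. axis i 1 $ k * expsum (shift (e \<theta>)) (x $ k))"
      if "\<theta> \<in> P" for \<theta> x i
    proof -
      show "(\<lambda>x::real^'n. expsum (e \<theta>) (x $ k)) differentiable at x"
        using d[OF that] by (rule differentiableI)
      show "partial_deriv i (\<lambda>x::real^'n. expsum (e \<theta>) (x $ k)) = (\<lambda>x. axis i 1 $ k * expsum (shift (e \<theta>)) (x $ k))"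
        by (rule ext) (rule partial_derivI[OF d[OF that]])
    qed
    have "jsmooth n P (\<lambda>\<theta> x::real^'n. expsum (shift (e \<theta>)) (x $ k))"
      using Suc.prems by (intro Suc.IH) (auto simp: shift_def)
    then have "jsmooth n P (\<lambda>\<theta> x::real^'n. axis i 1 $ k * expsum (shift (e \<theta>)) (x $ k))" for i
      by (rule jsmooth_linear[OF bounded_linear_mult_right])
    with * jc[OF Suc.prems] show ?case
      using jsmooth_cong[of P "\<lambda>\<theta>. partial_deriv i (\<lambda>x::real^'n. expsum (e \<theta>) (x $ k))" 
        "\<lambda>\<theta> x. axis i 1 $ k * expsum (shift (e \<theta>)) (x $ k)" n for i]
      by simp
  }
qed

section \<open>Partial derivatives\<close>

lemma has_real_derivative_along_axis:
  fixes u :: "real^'n::finite \<Rightarrow> real"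
  assumes "u differentiable at (x + a *\<^sub>R axis i 1)"
  shows "((\<lambda>a. u (x + a *\<^sub>R axis i 1)) has_real_derivative partial_deriv i u (x + a *\<^sub>R axis i 1)) (at a)"
proof -
  let ?L = "frechet_derivative u (at (x + a *\<^sub>R axis i 1))"
  have "((\<lambda>a. x + a *\<^sub>R axis i 1) has_derivative (\<lambda>v. v *\<^sub>R axis i (1::real))) (at a)"
    by (auto intro!: derivative_eq_intros)
  from diff_chain_at[OF this assms[unfolded frechet_derivative_works]]
  have "((\<lambda>a. u (x + a *\<^sub>R axis i 1)) has_derivative (\<lambda>v. ?L (v *\<^sub>R axis i 1))) (at a)"
    by (simp add: o_def)
  moreover have "(\<lambda>v. ?L (v *\<^sub>R axis i 1)) = (*) (partial_deriv i u (x + a *\<^sub>R axis i 1))"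
    using linear_cmul[OF linear_frechet_derivative[OF assms]] by (auto simp: partial_deriv_def)
  ultimately show ?thesis unfolding has_field_derivative_def by simp
qed

text \<open>The second difference is symmetric in \<open>i\<close> and \<open>j\<close>, its value
  on the right is not; using both orders will identify the mixed derivatives.\<close>

lemma second_difference_mean_value:
  fixes u :: "real^'n::finite \<Rightarrow> real"
  assumes u: "smooth u" and t: "t > 0"
  obtains p where "dist p x \<le> 2 * t"
    "u (x + t *\<^sub>R axis i 1 + t *\<^sub>R axis j 1) - u (x + t *\<^sub>R axis i 1) - u (x + t *\<^sub>R axis j 1) + u x
       = t\<^sup>2 * partial_deriv j (partial_deriv i u) p"
proof -
  let ?e = "\<lambda>k. axis k (1::real) :: real^'n"
  note d = has_real_derivative_along_axis[OF smooth_imp_differentiable]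
  obtain z where z: "0 < z" "z < t"
    "(u (x + t *\<^sub>R ?e j + t *\<^sub>R ?e i) - u (x + t *\<^sub>R ?e i)) - (u (x + t *\<^sub>R ?e j + 0 *\<^sub>R ?e i) - u (x + 0 *\<^sub>R ?e i))
      = (t - 0) * (partial_deriv i u (x + t *\<^sub>R ?e j + z *\<^sub>R ?e i) - partial_deriv i u (x + z *\<^sub>R ?e i))"
    using MVT2[OF t, of "\<lambda>a. u (x + t *\<^sub>R ?e j + a *\<^sub>R ?e i) - u (x + a *\<^sub>R ?e i)"
       "\<lambda>a. partial_deriv i u (x + t *\<^sub>R ?e j + a *\<^sub>R ?e i) - partial_deriv i u (x + a *\<^sub>R ?e i)"]
      DERIV_diff[OF d[OF u] d[OF u]] by blast
  obtain w where w: "0 < w" "w < t"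
    "partial_deriv i u (x + z *\<^sub>R ?e i + t *\<^sub>R ?e j) - partial_deriv i u (x + z *\<^sub>R ?e i + 0 *\<^sub>R ?e j)
      = (t - 0) * partial_deriv j (partial_deriv i u) (x + z *\<^sub>R ?e i + w *\<^sub>R ?e j)"
    using MVT2[OF t, of "\<lambda>a. partial_deriv i u (x + z *\<^sub>R ?e i + a *\<^sub>R ?e j)"
       "\<lambda>a. partial_deriv j (partial_deriv i u) (x + z *\<^sub>R ?e i + a *\<^sub>R ?e j)"]
      d[OF smooth_partial_deriv[OF u]] by blast
  show thesis
  proof (rule that)
    have "norm (z *\<^sub>R ?e i + w *\<^sub>R ?e j) \<le> \<bar>z\<bar> + \<bar>w\<bar>"
      using norm_triangle_ineq[of "z *\<^sub>R ?e i" "w *\<^sub>R ?e j"] by simp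
    then show "dist (x + z *\<^sub>R ?e i + w *\<^sub>R ?e j) x \<le> 2 * t"
      using z w by (simp add: dist_norm add.assoc)
    show "u (x + t *\<^sub>R axis i 1 + t *\<^sub>R axis j 1) - u (x + t *\<^sub>R axis i 1) - u (x + t *\<^sub>R axis j 1) + u x
       = t\<^sup>2 * partial_deriv j (partial_deriv i u) (x + z *\<^sub>R ?e i + w *\<^sub>R ?e j)"
      using z(3) w(3) by (simp add: algebra_simps power2_eq_square)
  qed
qed

text \<open>The two mixed derivatives take a common value at points within \<open>2 * t\<close> of
  \<open>x\<close>; their continuity gives equality at \<open>x\<close> as \<open>t\<close> tends to
  0.\<close>

lemma partial_deriv_commute:
  fixes u :: "real^'n::finite \<Rightarrow> real"
  assumes u: "smooth u"
  shows "partial_deriv i (partial_deriv j u) x = partial_deriv j (partial_deriv i u) x"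
proof -
  define t where "t n = 1 / real (Suc n)" for n
  have t: "t n > 0" for n by (simp add: t_def)
  have t0: "t \<longlonglongrightarrow> 0" unfolding t_def using LIMSEQ_Suc[OF lim_1_over_n] by simp
  have "\<exists>p q. dist p x \<le> 2 * t n \<and> dist q x \<le> 2 * t n \<and>
    partial_deriv j (partial_deriv i u) p = partial_deriv i (partial_deriv j u) q" for n
  proof -
    obtain p where p: "dist p x \<le> 2 * t n" "u (x + t n *\<^sub>R axis i 1 + t n *\<^sub>R axis j 1) - u (x + t n *\<^sub>R axis i 1) - u (x + t n *\<^sub>R axis j 1) + u x
       = (t n)\<^sup>2 * partial_deriv j (partial_deriv i u) p"
      by (rule second_difference_mean_value[OF u t])
    obtain q where q: "dist q x \<le> 2 * t n" "u (x + t n *\<^sub>R axis j 1 + t n *\<^sub>R axis i 1) - u (x + t n *\<^sub>R axis j 1) - u (x + t n *\<^sub>R axis i 1) + u x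
       = (t n)\<^sup>2 * partial_deriv i (partial_deriv j u) q"
      by (rule second_difference_mean_value[OF u t])
    have "(t n)\<^sup>2 * partial_deriv j (partial_deriv i u) p = (t n)\<^sup>2 * partial_deriv i (partial_deriv j u) q"
      using p(2) q(2) by (simp add: add_ac algebra_simps)
    then show ?thesis using p(1) q(1) t[of n] by auto
  qed
  then obtain p q where pq: "\<And>n. dist (p n) x \<le> 2 * t n" "\<And>n. dist (q n) x \<le> 2 * t n"
    "\<And>n. partial_deriv j (partial_deriv i u) (p n) = partial_deriv i (partial_deriv j u) (q n)"
    by metis
  have lim: "r \<longlonglongrightarrow> x" if "\<And>n. dist (r n) x \<le> 2 * t n" for r
  proof (rule tendsto_dist_iff[THEN iffD2], rule tendsto_sandwich[where f = "\<lambda>_. 0" and h = "\<lambda>n. 2 * t n"])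
    show "(\<lambda>n. 2 * t n) \<longlonglongrightarrow> 0" using tendsto_mult_right_zero[OF t0, of 2] by simp
  qed (use that in auto)
  have cont: "isCont (partial_deriv k (partial_deriv l u)) x" for k l
    using smooth_imp_differentiable[OF smooth_partial_deriv[OF smooth_partial_deriv[OF u]]]
    by (rule differentiable_imp_continuous_within)
  have "(\<lambda>n. partial_deriv j (partial_deriv i u) (p n)) \<longlonglongrightarrow> partial_deriv j (partial_deriv i u) x"
    by (rule isCont_tendsto_compose[OF cont lim[OF pq(1)]])
  moreover have "(\<lambda>n. partial_deriv i (partial_deriv j u) (q n)) \<longlonglongrightarrow> partial_deriv i (partial_deriv j u) x"
    by (rule isCont_tendsto_compose[OF cont lim[OF pq(2)]])
  ultimately show ?thesis using LIMSEQ_unique unfolding pq(3) by blast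
qed

context
  fixes f g :: "real^'n::finite \<Rightarrow> real" and x :: "real^'n" and i :: 'n
  assumes f: "f differentiable at x" and g: "g differentiable at x"
begin

lemma partial_deriv_add: "partial_deriv i (\<lambda>x. f x + g x) x = partial_deriv i f x + partial_deriv i g x"
  using partial_derivI[OF has_derivative_add[OF f[unfolded frechet_derivative_works] g[unfolded frechet_derivative_works]]]
  by (simp add: partial_deriv_def)

lemma partial_deriv_diff: "partial_deriv i (\<lambda>x. f x - g x) x = partial_deriv i f x - partial_deriv i g x"
  using partial_derivI[OF has_derivative_diff[OF f[unfolded frechet_derivative_works] g[unfolded frechet_derivative_works]]]
  by (simp add: partial_deriv_def)

lemma partial_deriv_mult: "partial_deriv i (\<lambda>x. f x * g x) x = f x * partial_deriv i g x + partial_deriv i f x * g x"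
  using partial_derivI[OF has_derivative_mult[OF f[unfolded frechet_derivative_works] g[unfolded frechet_derivative_works]]]
  by (simp add: partial_deriv_def)

end

lemma partial_deriv_const [simp]: "partial_deriv i (\<lambda>x. c) = (\<lambda>x. 0)"
  by (rule ext, subst partial_derivI[OF has_derivative_const]) simp

lemma partial_deriv_cmult:
  "f differentiable at x \<Longrightarrow> partial_deriv i (\<lambda>x. c * f x :: real) x = c * partial_deriv i f x"
  by (subst partial_deriv_mult) simp_all

lemma coordinate_function:
  fixes k :: "real \<Rightarrow> real"
  assumes "(k has_real_derivative k') (at (x $ j))"
  shows "(\<lambda>x::real^'n::finite. k (x $ j)) differentiable at x"
    "partial_deriv i (\<lambda>x::real^'n::finite. k (x $ j)) x = (if i = j then k' else 0)"
proof -
  have "((\<lambda>x::real^'n. x $ j) has_derivative (\<lambda>v. v $ j)) (at x)"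
    by (rule bounded_linear.has_derivative[OF bounded_linear_vec_nth has_derivative_ident])
  from DERIV_compose_FDERIV[OF assms this]
  have d: "((\<lambda>x::real^'n. k (x $ j)) has_derivative (\<lambda>v. v $ j * k')) (at x)" .
  then show "(\<lambda>x::real^'n. k (x $ j)) differentiable at x" by (rule differentiableI)
  show "partial_deriv i (\<lambda>x::real^'n::finite. k (x $ j)) x = (if i = j then k' else 0)"
    unfolding partial_derivI[OF d] by (simp add: axis_def)
qed

section \<open>The Brioschi formula\<close>

lemma matrix_inv_eqI:
  fixes A B :: "real^'n::finite^'n"
  assumes "A ** B = mat 1" "B ** A = mat 1"
  shows "matrix_inv A = B"
proof -
  have "A ** matrix_inv A = mat 1 \<and> matrix_inv A ** A = mat 1"
    unfolding matrix_inv_def by (rule someI[of _ B]) (simp add: assms)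
  then show ?thesis
    by (metis assms(1) matrix_mul_assoc matrix_mul_lid matrix_mul_rid)
qed

lemma matrix_inv_2:
  fixes A :: "real^2^2"
  assumes "det A \<noteq> 0"
  shows "matrix_inv A = vector [vector [A$2$2 / det A, - A$1$2 / det A], vector [- A$2$1 / det A, A$1$1 / det A]]"
    (is "_ = ?B")
proof (rule matrix_inv_eqI)
  show "A ** ?B = mat 1" "?B ** A = mat 1"
    using assms det_2[of A]
    by (simp_all add: vec_eq_iff forall_2 matrix_matrix_mult_def sum_2 mat_def field_simps)
qed

text \<open>Brioschi's difference of two 3 by 3 determinants, each expanded along its first row.
  \<open>A\<close> stands for the combination \<open>F_12 - G_11/2 - E_22/2\<close> of second
  derivatives. Treating derivatives as independent reals turns invariance of curvature into
  polynomial algebra.\<close>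

definition brioschi ::
    "real \<Rightarrow> real \<Rightarrow> real \<Rightarrow> real \<Rightarrow> real \<Rightarrow> real \<Rightarrow> real \<Rightarrow> real \<Rightarrow> real \<Rightarrow> real \<Rightarrow> real" where
  "brioschi E F G E1 E2 F1 F2 G1 G2 A =
     (A * (E * G - F\<^sup>2)
      - E1/2 * (G * (F2 - G1/2) - F * (G2/2)) - (F1 - E2/2) * (E * (G2/2) - F * (F2 - G1/2))
      + E2/2 * (G * (E2/2) - F * (G1/2)) + G1/2 * (E * (G1/2) - F * (E2/2))) / (E * G - F\<^sup>2)\<^sup>2"

lemma smooth_component: "smooth g \<Longrightarrow> smooth (\<lambda>x. g x $ i $ j)"
  for g :: "real^'n::finite \<Rightarrow> real^'m::finite^'k::finite"
proof -
  assume "smooth g"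
  \<comment> \<open>A constant family over an arbitrary parameter space makes the calculus of
    \<open>jsmooth\<close> available for a single smooth function.\<close>
  then have "jsmooth n (UNIV::real set) (\<lambda>_. g)" for n by (rule smooth_imp_jsmooth)
  then have "jsmooth n (UNIV::real set) (\<lambda>_ x. g x $ i $ j)" for n
    by (intro jsmooth_linear[OF bounded_linear_vec_nth] )
  then show ?thesis using jsmooth_imp_smooth[of UNIV "\<lambda>_ x. g x $ i $ j"] by blast
qed

lemma riemannian_metric_det_pos:
  assumes "riemannian_metric g"
  shows "det (g x) > 0" "g x $ 1 $ 1 > 0" "g x $ 2 $ 1 = g x $ 1 $ 2"
proof -
  show sym: "g x $ 2 $ 1 = g x $ 1 $ 2"
  proof -
    have "transpose (g x) $ 1 $ 2 = g x $ 1 $ 2" using assms unfolding riemannian_metric_def by simp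
    then show ?thesis by (simp add: transpose_def)
  qed
  have pos: "v \<bullet> (g x *v v) > 0" if "v \<noteq> 0" for v
    using assms that unfolding riemannian_metric_def by blast
  have quad: "v \<bullet> (g x *v v) = g x $1$1 * (v$1)\<^sup>2 + 2 * g x$1$2 * v$1 * v$2 + g x$2$2 * (v$2)\<^sup>2" for v :: "real^2"
    by (simp add: inner_vec_def matrix_vector_mult_def sum_2 sym power2_eq_square algebra_simps)
  have "(vector [1,0] :: real^2) \<noteq> 0" by (simp add: vec_eq_iff forall_2)
  from pos[OF this] show E: "g x $ 1 $ 1 > 0" by (simp add: quad)
  \<comment> \<open>The vector orthogonal to the first coordinate field; its squared length is
    \<open>g_11\<close> times the determinant.\<close>
  have "(vector [- g x $1$2, g x $1$1] :: real^2) \<noteq> 0" using E by (simp add: vec_eq_iff forall_2)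
  from pos[OF this] have "0 < g x $1$1 * det (g x)"
    by (simp add: quad det_2 sym power2_eq_square algebra_simps)
  with E show "det (g x) > 0" by (simp add: zero_less_mult_iff)
qed

text \<open>Lowering the upper index before differentiating avoids derivatives of the quotients in
  \<open>christoffel\<close>; the denominator \<open>D\<close> returns only through the
  undifferentiated symbols.\<close>

theorem gauss_curvature_brioschi:
  assumes g: "riemannian_metric g"
  defines "E \<equiv> \<lambda>x. g x $ 1 $ 1" and "F \<equiv> \<lambda>x. g x $ 1 $ 2" and "G \<equiv> \<lambda>x. g x $ 2 $ 2"
  shows "gauss_curvature g x = brioschi (E x) (F x) (G x)
     (partial_deriv 1 E x) (partial_deriv 2 E x) (partial_deriv 1 F x) (partial_deriv 2 F x)
     (partial_deriv 1 G x) (partial_deriv 2 G x)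
     (partial_deriv 1 (partial_deriv 2 F) x - partial_deriv 1 (partial_deriv 1 G) x / 2
        - partial_deriv 2 (partial_deriv 2 E) x / 2)"
proof -
  let ?p = "partial_deriv :: 2 \<Rightarrow> (plane \<Rightarrow> real) \<Rightarrow> plane \<Rightarrow> real"
  define D where "D = (\<lambda>x. E x * G x - F x * F x)"
  have sym: "(\<lambda>y. g y $ 2 $ 1) = F" "g y $ 2 $ 1 = F y" for y
    using riemannian_metric_det_pos(3)[OF g] by (auto simp: F_def)
  have comp: "(\<lambda>y. g y $ 1 $ 1) = E" "(\<lambda>y. g y $ 1 $ 2) = F" "(\<lambda>y. g y $ 2 $ 2) = G"
    "g y $ 1 $ 1 = E y" "g y $ 1 $ 2 = F y" "g y $ 2 $ 2 = G y" for y
    by (auto simp: E_def F_def G_def)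
  have detD: "det (g y) = D y" for y by (simp add: det_2 comp sym D_def)
  have D: "D y \<noteq> 0" for y using riemannian_metric_det_pos(1)[OF g, of y] by (simp add: detD)
  have sm: "smooth E" "smooth F" "smooth G"
    using g unfolding riemannian_metric_def E_def F_def G_def by (auto intro: smooth_component)
  note df = smooth_imp_differentiable sm smooth_partial_deriv
  have inv: "matrix_inv (g y) = vector [vector [G y / D y, - F y / D y], vector [- F y / D y, E y / D y]]" for y
    using matrix_inv_2[of "g y"] D[of y] by (simp add: detD comp sym)
  have c1: "christoffel g 1 i j = (\<lambda>y. (G y * (?p i (\<lambda>y. g y $ j $ 1) y + ?p j (\<lambda>y. g y $ i $ 1) y - ?p 1 (\<lambda>y. g y $ i $ j) y)
      - F y * (?p i (\<lambda>y. g y $ j $ 2) y + ?p j (\<lambda>y. g y $ i $ 2) y - ?p 2 (\<lambda>y. g y $ i $ j) y)) / (2 * D y))" for i j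
    by (rule ext) (use D in \<open>simp add: christoffel_def sum_2 inv field_simps\<close>)
  have c2: "christoffel g 2 i j = (\<lambda>y. (E y * (?p i (\<lambda>y. g y $ j $ 2) y + ?p j (\<lambda>y. g y $ i $ 2) y - ?p 2 (\<lambda>y. g y $ i $ j) y)
      - F y * (?p i (\<lambda>y. g y $ j $ 1) y + ?p j (\<lambda>y. g y $ i $ 1) y - ?p 1 (\<lambda>y. g y $ i $ j) y)) / (2 * D y))" for i j
    by (rule ext) (use D in \<open>simp add: christoffel_def sum_2 inv field_simps\<close>)
  have dD: "D differentiable at y" for y
    unfolding D_def by (intro differentiable_diff differentiable_mult df)
  have dfc: "(\<lambda>y. g y $ i $ j) differentiable at y" "?p k (\<lambda>y. g y $ i $ j) differentiable at y" for i j k y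
    using g unfolding riemannian_metric_def by (auto intro!: smooth_imp_differentiable smooth_partial_deriv smooth_component)
  have dc: "christoffel g 1 i j differentiable at y" "christoffel g 2 i j differentiable at y" for i j y
    unfolding c1 c2 
    by (intro differentiable_divide differentiable_diff differentiable_add differentiable_mult df dD dfc differentiable_const; use D in simp)+
  \<comment> \<open>Christoffel symbols of the first kind: contraction with the first row of the
    metric cancels the determinant.\<close>
  have lower: "E y * christoffel g 1 i j y + F y * christoffel g 2 i j y =
      (?p i (\<lambda>y. g y $ j $ 1) y + ?p j (\<lambda>y. g y $ i $ 1) y - ?p 1 (\<lambda>y. g y $ i $ j) y) / 2" for i j y
  proof -
    have "E y * ((G y * a - F y * b) / (2 * D y)) + F y * ((E y * b - F y * a) / (2 * D y)) = a / 2" for a b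
    proof -
      have "E y * ((G y * a - F y * b) / (2 * D y)) + F y * ((E y * b - F y * a) / (2 * D y)) = (D y * a) / (2 * D y)"
        unfolding D_def by (simp add: algebra_simps flip: add_divide_distrib)
      then show ?thesis using D[of y] by simp
    qed
    then show ?thesis unfolding c1 c2 by blast
  qed
  \<comment> \<open>The Leibniz rule applied to \<open>lower\<close>; its left side contains exactly
    the combination of derivatives that occurs in the curvature.\<close>
  have dlower: "E x * ?p k (christoffel g 1 i j) x + ?p k E x * christoffel g 1 i j x
      + (F x * ?p k (christoffel g 2 i j) x + ?p k F x * christoffel g 2 i j x)
      = ?p k (\<lambda>y. (?p i (\<lambda>y. g y $ j $ 1) y + ?p j (\<lambda>y. g y $ i $ 1) y - ?p 1 (\<lambda>y. g y $ i $ j) y) / 2) x" for i j k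
    unfolding lower[symmetric]
    by (simp add: partial_deriv_add partial_deriv_mult df dc)
  have half: "?p k (\<lambda>y. u y / 2) x = ?p k u x / 2" if "u differentiable at x" for k u
    using partial_deriv_cmult[OF that, of k "1/2"] by simp
  have l22: "E x * ?p 1 (christoffel g 1 2 2) x + ?p 1 E x * christoffel g 1 2 2 x
      + (F x * ?p 1 (christoffel g 2 2 2) x + ?p 1 F x * christoffel g 2 2 2 x)
      = ?p 1 (?p 2 F) x - ?p 1 (?p 1 G) x / 2"
    unfolding dlower comp sym
    by (simp add: half partial_deriv_add partial_deriv_diff partial_deriv_cmult df)
  have l12: "E x * ?p 2 (christoffel g 1 1 2) x + ?p 2 E x * christoffel g 1 1 2 x
      + (F x * ?p 2 (christoffel g 2 1 2) x + ?p 2 F x * christoffel g 2 1 2 x)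
      = ?p 2 (?p 2 E) x / 2"
    unfolding dlower comp sym
    by (simp add: half partial_deriv_add partial_deriv_diff partial_deriv_cmult df)
  have c22: "christoffel g 1 2 2 x = (G x * (?p 2 F x - ?p 1 G x / 2) - F x * (?p 2 G x / 2)) / D x"
    "christoffel g 2 2 2 x = (E x * (?p 2 G x / 2) - F x * (?p 2 F x - ?p 1 G x / 2)) / D x"
    unfolding c1 c2 comp sym using D[of x] by (simp_all add: field_simps)
  have c12: "christoffel g 1 1 2 x = (G x * (?p 2 E x / 2) - F x * (?p 1 G x / 2)) / D x"
    "christoffel g 2 1 2 x = (E x * (?p 1 G x / 2) - F x * (?p 2 E x / 2)) / D x"
    unfolding c1 c2 comp sym using D[of x] by (simp_all add: field_simps)
  have lo: "E x * christoffel g 1 1 1 x + F x * christoffel g 2 1 1 x = ?p 1 E x / 2"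
    "E x * christoffel g 1 1 2 x + F x * christoffel g 2 1 2 x = ?p 2 E x / 2"
    "E x * christoffel g 1 2 1 x + F x * christoffel g 2 2 1 x = ?p 2 E x / 2"
    "E x * christoffel g 1 2 2 x + F x * christoffel g 2 2 2 x = ?p 2 F x - ?p 1 G x / 2"
    unfolding lower comp sym by (simp_all add: field_simps)
  let ?A = "?p 1 (?p 2 F) x - ?p 1 (?p 1 G) x / 2 - ?p 2 (?p 2 E) x / 2"
  \<comment> \<open>\<open>l22\<close> and \<open>l12\<close> trade differentiated symbols for
    second derivatives minus products with undifferentiated ones; in the quadratic terms
    \<open>lo\<close> lowers one factor of each product.\<close>
  have "(\<Sum>l\<in>UNIV. riemann_tensor g l 1 2 2 x * g x $ l $ 1)
      = ?A - ?p 1 E x / 2 * christoffel g 1 2 2 x - (?p 1 F x - ?p 2 E x / 2) * christoffel g 2 2 2 x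
        + ?p 2 E x / 2 * christoffel g 1 1 2 x + ?p 1 G x / 2 * christoffel g 2 1 2 x" (is "_ = ?N")
  proof -
    let ?c = "\<lambda>l i j. christoffel g l i j x"
    have "(\<Sum>l\<in>UNIV. riemann_tensor g l 1 2 2 x * g x $ l $ 1)
      = (E x * ?p 1 (christoffel g 1 2 2) x + F x * ?p 1 (christoffel g 2 2 2) x)
        - (E x * ?p 2 (christoffel g 1 1 2) x + F x * ?p 2 (christoffel g 2 1 2) x)
        + (?c 1 2 2 * (E x * ?c 1 1 1 + F x * ?c 2 1 1) + ?c 2 2 2 * (E x * ?c 1 1 2 + F x * ?c 2 1 2)
         - ?c 1 1 2 * (E x * ?c 1 2 1 + F x * ?c 2 2 1) - ?c 2 1 2 * (E x * ?c 1 2 2 + F x * ?c 2 2 2))"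
      unfolding riemann_tensor_def sum_2 comp sym by (simp add: algebra_simps)
    also have "\<dots> = ?N" unfolding lo using l22 l12 by (simp add: algebra_simps)
    finally show ?thesis .
  qed
  then have "gauss_curvature g x = ?N / D x"
    by (simp add: gauss_curvature_def detD)
  also have "\<dots> = (?A * D x
      - ?p 1 E x / 2 * (G x * (?p 2 F x - ?p 1 G x / 2) - F x * (?p 2 G x / 2))
      - (?p 1 F x - ?p 2 E x / 2) * (E x * (?p 2 G x / 2) - F x * (?p 2 F x - ?p 1 G x / 2))
      + ?p 2 E x / 2 * (G x * (?p 2 E x / 2) - F x * (?p 1 G x / 2))
      + ?p 1 G x / 2 * (E x * (?p 1 G x / 2) - F x * (?p 2 E x / 2))) / (D x)\<^sup>2"
  proof -
    have "(a - b * (p / d) - c * (q / d) + e * (r / d) + f * (s / d)) / d = (a * d - b * p - c * q + e * r + f * s) / d\<^sup>2"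
      if "d \<noteq> 0" for a b c d e f p q r s :: real
      using that by (simp add: power2_eq_square add_divide_distrib diff_divide_distrib)
    then show ?thesis unfolding c22 c12 using D[of x] by blast
  qed
  also have "\<dots> = brioschi (E x) (F x) (G x) (?p 1 E x) (?p 2 E x) (?p 1 F x) (?p 2 F x) (?p 1 G x) (?p 2 G x) ?A"
    unfolding brioschi_def D_def by (simp add: power2_eq_square)
  finally show ?thesis .
qed

section \<open>Sheared pullbacks\<close>

definition shear_map :: "real \<Rightarrow> (real \<Rightarrow> real) \<Rightarrow> plane \<Rightarrow> plane" where
  "shear_map s h x = vector [s * (x $ 1 + h (x $ 2)), s * x $ 2]"

text \<open>For \<open>s > 0\<close> and \<open>k = h'\<close> this is \<open>c / s\<^sup>2\<close> times the pullback of \<open>g\<close> along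
  \<open>shear_map s h\<close>. Unlike that pullback it makes sense for \<open>s = 0\<close>, where it is flat.\<close>

definition shear_pullback ::
    "real \<Rightarrow> real \<Rightarrow> (real \<Rightarrow> real) \<Rightarrow> (real \<Rightarrow> real) \<Rightarrow> plane_tensor \<Rightarrow> plane_tensor" where
  "shear_pullback c s h k g x = (let p = shear_map s h x; d = k (x $ 2) in
     vector [vector [c * g p $ 1 $ 1, c * (g p $ 1 $ 2 + d * g p $ 1 $ 1)],
       vector [c * (g p $ 1 $ 2 + d * g p $ 1 $ 1), c * (g p $ 2 $ 2 + 2 * d * g p $ 1 $ 2 + d\<^sup>2 * g p $ 1 $ 1)]])"

lemma shear_pullback_nth:
  "shear_pullback c s h k g x $ 1 $ 1 = c * g (shear_map s h x) $ 1 $ 1"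
  "shear_pullback c s h k g x $ 1 $ 2 = c * (g (shear_map s h x) $ 1 $ 2 + k (x $ 2) * g (shear_map s h x) $ 1 $ 1)"
  "shear_pullback c s h k g x $ 2 $ 1 = shear_pullback c s h k g x $ 1 $ 2"
  "shear_pullback c s h k g x $ 2 $ 2 = c * (g (shear_map s h x) $ 2 $ 2
     + 2 * k (x $ 2) * g (shear_map s h x) $ 1 $ 2 + (k (x $ 2))\<^sup>2 * g (shear_map s h x) $ 1 $ 1)"
  by (simp_all add: shear_pullback_def Let_def)

lemma vector_2_axis: "(vector [a, b] :: real^2) = a *\<^sub>R axis 1 1 + b *\<^sub>R axis 2 1"
  by (simp add: vec_eq_iff forall_2 axis_def)

text \<open>When \<open>k\<close> is the derivative of \<open>h\<close>, the vector on the right is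
  the differential of the shear map applied to \<open>v\<close>, with its factor \<open>s\<close>
  removed. Positivity and the comparison of lengths both rest on this.\<close>

lemma shear_pullback_quadratic_form:
  assumes "riemannian_metric g"
  shows "v \<bullet> (shear_pullback c s h k g x *v v) =
    c * (vector [v $ 1 + k (x $ 2) * v $ 2, v $ 2] \<bullet> (g (shear_map s h x) *v vector [v $ 1 + k (x $ 2) * v $ 2, v $ 2]))"
  using riemannian_metric_det_pos(3)[OF assms]
  by (simp add: inner_vec_def matrix_vector_mult_def sum_2 shear_pullback_nth power2_eq_square algebra_simps)

lemma jsmooth_cmult: "continuous_on P c \<Longrightarrow> jsmooth n P u \<Longrightarrow> jsmooth n P (\<lambda>\<theta> x. c \<theta> * u \<theta> x :: real)"
  by (rule jsmooth_bilinear[OF bounded_bilinear_mult jsmooth_const])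

lemma jsmooth_mult: "jsmooth n P u \<Longrightarrow> jsmooth n P v \<Longrightarrow> jsmooth n P (\<lambda>\<theta> x. u \<theta> x * v \<theta> x :: real)"
  by (rule jsmooth_bilinear[OF bounded_bilinear_mult])

lemma jsmooth_scaleR_const: "jsmooth n P u \<Longrightarrow> jsmooth n P (\<lambda>\<theta> x. u \<theta> x *\<^sub>R v)"
  by (rule jsmooth_linear[OF bounded_linear_scaleR_left])

lemma jsmooth_component: "jsmooth n P u \<Longrightarrow> jsmooth n P (\<lambda>\<theta> x. u \<theta> x $ i $ j)"
  for u :: "'p::topological_space \<Rightarrow> real^'n::finite \<Rightarrow> real^'m::finite^'k::finite"
  by (intro jsmooth_linear[OF bounded_linear_vec_nth])

text \<open>Reduces smoothness of the matrix valued family to its three independent entries.\<close>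

lemma shear_pullback_expand:
  "shear_pullback c s h k g x =
     g' 1 1 *\<^sub>R vector [vector [1, 0], vector [0, 0]]
     + g' 1 2 *\<^sub>R vector [vector [0, 1], vector [1, 0]]
     + g' 2 2 *\<^sub>R vector [vector [0, 0], vector [0, 1]]"
  if "g' = (\<lambda>i j. shear_pullback c s h k g x $ i $ j)"
  using that by (simp add: vec_eq_iff forall_2 shear_pullback_nth(3))

theorem jsmooth_shear_pullback:
  fixes e :: "'p::t2_space \<Rightarrow> nat \<Rightarrow> real"
  assumes c: "continuous_on P c" and s: "continuous_on P s"
    and e: "\<And>n. continuous_on P (\<lambda>\<theta>. e \<theta> n)" "\<And>\<theta> n. \<theta> \<in> P \<Longrightarrow> \<bar>e \<theta> n\<bar> \<le> B"
    and g: "\<And>n. jsmooth n P (\<gamma> :: 'p \<Rightarrow> plane_tensor)"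
  shows "jsmooth n P (\<lambda>\<theta>. shear_pullback (c \<theta>) (s \<theta>) (expsum (e \<theta>)) (expsum (shift (e \<theta>))) (\<gamma> \<theta>))"
proof -
  have e': "continuous_on P (\<lambda>\<theta>. shift (e \<theta>) n)" "\<theta> \<in> P \<Longrightarrow> \<bar>shift (e \<theta>) n\<bar> \<le> B" for n \<theta>
    using e by (simp_all add: shift_def)
  have h: "jsmooth n P (\<lambda>\<theta> (x::plane). expsum (e \<theta>) (x $ 2))" for n
    by (rule jsmooth_expsum[OF e])
  have k: "jsmooth n P (\<lambda>\<theta> x::plane. expsum (shift (e \<theta>)) (x $ 2))" for n
    by (rule jsmooth_expsum[OF e'])
  have "jsmooth n P (\<lambda>\<theta>. shear_map (s \<theta>) (expsum (e \<theta>)))" for n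
    unfolding shear_map_def[abs_def] vector_2_axis
    by (intro jsmooth_add jsmooth_scaleR_const jsmooth_cmult s jsmooth_coordinate h)
  from jsmooth_compose[OF g this] 
  have "jsmooth n P (\<lambda>\<theta> (x::plane). \<gamma> \<theta> (shear_map (s \<theta>) (expsum (e \<theta>)) x))" for n .
  note g' = jsmooth_component[OF this]
  have "jsmooth n P (\<lambda>\<theta> (x::plane). shear_pullback (c \<theta>) (s \<theta>) (expsum (e \<theta>)) (expsum (shift (e \<theta>))) (\<gamma> \<theta>) x $ i $ j)"
    if "(i, j) \<in> {(1,1),(1,2),(2,2)}" for n i j
  proof -
    have "jsmooth n P (\<lambda>\<theta> (x::plane). c \<theta> * (\<gamma> \<theta> (shear_map (s \<theta>) (expsum (e \<theta>)) x) $ 1 $ 1))"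
     "jsmooth n P (\<lambda>\<theta> (x::plane). c \<theta> * (\<gamma> \<theta> (shear_map (s \<theta>) (expsum (e \<theta>)) x) $ 1 $ 2
         + expsum (shift (e \<theta>)) (x $ 2) * \<gamma> \<theta> (shear_map (s \<theta>) (expsum (e \<theta>)) x) $ 1 $ 1))"
     "jsmooth n P (\<lambda>\<theta> (x::plane). c \<theta> * (\<gamma> \<theta> (shear_map (s \<theta>) (expsum (e \<theta>)) x) $ 2 $ 2
         + 2 * expsum (shift (e \<theta>)) (x $ 2) * \<gamma> \<theta> (shear_map (s \<theta>) (expsum (e \<theta>)) x) $ 1 $ 2
         + (expsum (shift (e \<theta>)) (x $ 2))\<^sup>2 * \<gamma> \<theta> (shear_map (s \<theta>) (expsum (e \<theta>)) x) $ 1 $ 1))"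
      unfolding power2_eq_square
      by (intro jsmooth_cmult jsmooth_add jsmooth_mult g' k c jsmooth_const continuous_on_const)+
    then show ?thesis using that by (auto simp: shear_pullback_nth)
  qed
  then show ?thesis
    by (subst shear_pullback_expand[OF refl, abs_def]) (intro jsmooth_add jsmooth_scaleR_const; simp)
qed

lemma riemannian_metric_shear_pullback:
  assumes g: "riemannian_metric g" and c: "c > 0" and e: "bounded_coeffs e"
  shows "riemannian_metric (shear_pullback c s (expsum e) (expsum (shift e)) g)"
  unfolding riemannian_metric_def
proof (intro conjI allI impI)
  obtain B where B: "\<And>n. \<bar>e n\<bar> \<le> B" using e unfolding bounded_coeffs_def by blast
  have "smooth g" using g by (simp add: riemannian_metric_def)
  have "jsmooth n (UNIV :: real set) (\<lambda>_. shear_pullback c s (expsum e) (expsum (shift e)) g)" for n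
    by (rule jsmooth_shear_pullback[OF _ _ _ B smooth_imp_jsmooth[OF \<open>smooth g\<close>]]) simp_all
  from jsmooth_imp_smooth[OF this] show "smooth (shear_pullback c s (expsum e) (expsum (shift e)) g)" by simp
next
  fix x :: plane show "transpose (shear_pullback c s (expsum e) (expsum (shift e)) g x) = shear_pullback c s (expsum e) (expsum (shift e)) g x"
    by (simp add: vec_eq_iff forall_2 transpose_def shear_pullback_nth(3))
next
  fix x v :: plane assume "v \<noteq> 0"
  let ?w = "vector [v $ 1 + expsum (shift e) (x $ 2) * v $ 2, v $ 2] :: real^2"
  have "?w \<noteq> 0" using \<open>v \<noteq> 0\<close> by (auto simp: vec_eq_iff forall_2)
  then have "?w \<bullet> (g (shear_map s (expsum e) x) *v ?w) > 0" using g by (simp add: riemannian_metric_def)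
  then show "v \<bullet> (shear_pullback c s (expsum e) (expsum (shift e)) g x *v v) > 0"
    unfolding shear_pullback_quadratic_form[OF g] using c by simp
qed

lemma has_derivative_shear_map:
  assumes "(h has_real_derivative k) (at (x $ 2))"
  shows "(shear_map s h has_derivative (\<lambda>v. vector [s * (v $ 1 + k * v $ 2), s * v $ 2])) (at x)"
proof -
  have n: "((\<lambda>x::real^2. x $ j) has_derivative (\<lambda>v. v $ j)) (at x)" for j
    by (rule bounded_linear.has_derivative[OF bounded_linear_vec_nth has_derivative_ident])
  have h: "((\<lambda>x::real^2. h (x $ 2)) has_derivative (\<lambda>v. v $ 2 * k)) (at x)"
    by (rule DERIV_compose_FDERIV[OF assms n])
  have "((\<lambda>x. (s * (x $ 1 + h (x $ 2))) *\<^sub>R axis 1 1 + (s * x $ 2) *\<^sub>R axis 2 1) has_derivative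
    (\<lambda>v. (s * (v $ 1 + v $ 2 * k)) *\<^sub>R axis 1 1 + (s * v $ 2) *\<^sub>R axis 2 (1::real))) (at x)"
    by (intro has_derivative_add has_derivative_scaleR_left has_derivative_mult_right n h)
  then show ?thesis unfolding shear_map_def[abs_def] vector_2_axis by (simp add: mult.commute)
qed

lemma partial_deriv_shear_map:
  assumes h: "\<And>y. (h has_real_derivative k y) (at y)" and u: "smooth u"
  shows "(\<lambda>x. u (shear_map s h x)) differentiable at x"
    "partial_deriv 1 (\<lambda>x. u (shear_map s h x)) x = s * partial_deriv 1 u (shear_map s h x)"
    "partial_deriv 2 (\<lambda>x. u (shear_map s h x)) x =
       s * (k (x $ 2) * partial_deriv 1 u (shear_map s h x) + partial_deriv 2 u (shear_map s h x))"
proof -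
  note d = has_derivative_shear_map[OF h]
  note pc = partial_deriv_compose[OF smooth_imp_differentiable[OF u] differentiableI[OF d]]
  show "(\<lambda>x. u (shear_map s h x)) differentiable at x" by (rule pc)
  show "partial_deriv 1 (\<lambda>x. u (shear_map s h x)) x = s * partial_deriv 1 u (shear_map s h x)"
    unfolding pc partial_derivI[OF d] by (simp add: sum_2 axis_def)
  show "partial_deriv 2 (\<lambda>x. u (shear_map s h x)) x =
       s * (k (x $ 2) * partial_deriv 1 u (shear_map s h x) + partial_deriv 2 u (shear_map s h x))"
    unfolding pc partial_derivI[OF d] by (simp add: sum_2 axis_def algebra_simps)
qed

text \<open>The arguments on the left are what the chain rule gives for the sheared metric, with
  \<open>d\<close> and \<open>k\<close> standing for the first and second derivative of the shear
  function. The numerator scales by \<open>c^3 * s^2\<close> and the denominator by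
  \<open>c^4\<close>. Inside, \<open>?N\<close> is four times Brioschi's numerator, which clears the
  halves.\<close>

lemma brioschi_shear:
  assumes c: "c \<noteq> 0"
  shows "brioschi (c * E) (c * (F + d * E)) (c * (G + 2 * d * F + d\<^sup>2 * E))
    (c * (s * E1)) (c * (s * (d * E1 + E2))) (c * (s * F1 + d * (s * E1)))
    (c * (s * (d * F1 + F2) + (d * (s * (d * E1 + E2)) + k * E)))
    (c * (s * G1 + 2 * d * (s * F1) + d\<^sup>2 * (s * E1)))
    (c * (s * (d * G1 + G2) + (2 * d * (s * (d * F1 + F2)) + 2 * k * F) + (d\<^sup>2 * (s * (d * E1 + E2)) + 2 * d * k * E)))
    (c * (s\<^sup>2 * A + s * k * E1 / 2))
    = s\<^sup>2 / c * brioschi E F G E1 E2 F1 F2 G1 G2 A" (is "brioschi ?E ?F ?G ?E1 ?E2 ?F1 ?F2 ?G1 ?G2 ?A = _")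
proof -
  let ?N = "\<lambda>E F G E1 E2 F1 F2 G1 G2 A. 4 * A * (E * G - F\<^sup>2)
      - E1 * (G * (2 * F2 - G1) - F * G2) - (2 * F1 - E2) * (E * G2 - F * (2 * F2 - G1))
      + E2 * (G * E2 - F * G1) + G1 * (E * G1 - F * E2)"
  have br: "brioschi E F G E1 E2 F1 F2 G1 G2 A = ?N E F G E1 E2 F1 F2 G1 G2 A / (4 * (E * G - F\<^sup>2)\<^sup>2)"
    for E F G E1 E2 F1 F2 G1 G2 A
  proof -
    have "A * (E * G - F\<^sup>2)
      - E1/2 * (G * (F2 - G1/2) - F * (G2/2)) - (F1 - E2/2) * (E * (G2/2) - F * (F2 - G1/2))
      + E2/2 * (G * (E2/2) - F * (G1/2)) + G1/2 * (E * (G1/2) - F * (E2/2)) = ?N E F G E1 E2 F1 F2 G1 G2 A / 4"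
      by (simp add: field_simps)
    then show ?thesis unfolding brioschi_def by (simp only: divide_divide_eq_left)
  qed
  have D: "?E * ?G - ?F\<^sup>2 = c\<^sup>2 * (E * G - F\<^sup>2)" by algebra
  have N: "?N ?E ?F ?G ?E1 ?E2 ?F1 ?F2 ?G1 ?G2 ?A = c^3 * s\<^sup>2 * ?N E F G E1 E2 F1 F2 G1 G2 A"
    by (simp add: algebra_simps power2_eq_square power3_eq_cube)
  have "c^3 * s\<^sup>2 * X / (4 * (c\<^sup>2 * Y)\<^sup>2) = s\<^sup>2 / c * (X / (4 * Y\<^sup>2))" for X Y
    using c by (simp add: power2_eq_square power3_eq_cube ac_simps)
  then show ?thesis unfolding br unfolding N unfolding D by blast
qed

text \<open>For \<open>s \<noteq> 0\<close> the metric is \<open>c / s^2\<close> times a pullback,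
  and scaling a metric by a constant divides its curvature by that constant. The third derivative
  \<open>m\<close> of the shear function enters because the second one appears in first derivatives
  of the components, which are differentiated again.\<close>

theorem gauss_curvature_shear_pullback:
  assumes g: "riemannian_metric g" and g': "riemannian_metric (shear_pullback c s h k g)" and c: "c \<noteq> 0"
    and h: "\<And>y. (h has_real_derivative k y) (at y)"
    and k: "\<And>y. (k has_real_derivative l y) (at y)"
    and l: "\<And>y. (l has_real_derivative m y) (at y)"
  shows "gauss_curvature (shear_pullback c s h k g) x = s\<^sup>2 / c * gauss_curvature g (shear_map s h x)"
proof -
  let ?p = "partial_deriv :: 2 \<Rightarrow> (plane \<Rightarrow> real) \<Rightarrow> plane \<Rightarrow> real"
  let ?s = "shear_map s h"
  define E where "E = (\<lambda>x. g x $ 1 $ 1)"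
  define F where "F = (\<lambda>x. g x $ 1 $ 2)"
  define G where "G = (\<lambda>x. g x $ 2 $ 2)"
  have sm: "smooth E" "smooth F" "smooth G"
    using g unfolding riemannian_metric_def E_def F_def G_def by (auto intro: smooth_component)
  note pc = partial_deriv_shear_map[OF h]
  note pcs = pc(2,3)[OF sm(1)] pc(2,3)[OF sm(2)] pc(2,3)[OF sm(3)]
    pc(2,3)[OF smooth_partial_deriv[OF sm(1)]] pc(2,3)[OF smooth_partial_deriv[OF sm(2)]] pc(2,3)[OF smooth_partial_deriv[OF sm(3)]]
  note kc = coordinate_function[OF k, where j = "2::2"] coordinate_function[OF l, where j = "2::2"]
  have dk: "(\<lambda>x::plane. k (x $ 2) ^ 2) differentiable at x" "(\<lambda>x::plane. k (x $ 2) * l (x $ 2)) differentiable at x" for x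
    unfolding power2_eq_square by (intro differentiable_mult kc)+
  note df = pc(1)[OF sm(1)] pc(1)[OF sm(2)] pc(1)[OF sm(3)] pc(1)[OF smooth_partial_deriv[OF sm(1)]]
    pc(1)[OF smooth_partial_deriv[OF sm(2)]] pc(1)[OF smooth_partial_deriv[OF sm(3)]] kc(1,3) dk
  note rules = partial_deriv_cmult partial_deriv_add partial_deriv_mult df pcs kc
  have E': "(\<lambda>x. shear_pullback c s h k g x $ 1 $ 1) = (\<lambda>x. c * E (?s x))"
    and F': "(\<lambda>x. shear_pullback c s h k g x $ 1 $ 2) = (\<lambda>x. c * (F (?s x) + k (x $ 2) * E (?s x)))"
    and G': "(\<lambda>x. shear_pullback c s h k g x $ 2 $ 2) = (\<lambda>x. c * (G (?s x) + 2 * k (x $ 2) * F (?s x) + (k (x $ 2))\<^sup>2 * E (?s x)))"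
    by (simp_all add: shear_pullback_nth E_def F_def G_def)
  have E1: "?p 1 (\<lambda>x. c * E (?s x)) = (\<lambda>x. c * (s * ?p 1 E (?s x)))"
    and E2: "?p 2 (\<lambda>x. c * E (?s x)) = (\<lambda>x. c * (s * (k (x $ 2) * ?p 1 E (?s x) + ?p 2 E (?s x))))"
    by (rule ext, simp add: rules)+
  have F1: "?p 1 (\<lambda>x. c * (F (?s x) + k (x $ 2) * E (?s x))) = (\<lambda>x. c * (s * ?p 1 F (?s x) + k (x $ 2) * (s * ?p 1 E (?s x))))"
    and F2: "?p 2 (\<lambda>x. c * (F (?s x) + k (x $ 2) * E (?s x))) = (\<lambda>x. c * (s * (k (x $ 2) * ?p 1 F (?s x) + ?p 2 F (?s x))
        + (k (x $ 2) * (s * (k (x $ 2) * ?p 1 E (?s x) + ?p 2 E (?s x))) + l (x $ 2) * E (?s x))))"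
    by (rule ext, simp add: rules)+
  have G1: "?p 1 (\<lambda>x. c * (G (?s x) + 2 * k (x $ 2) * F (?s x) + (k (x $ 2))\<^sup>2 * E (?s x))) =
      (\<lambda>x. c * (s * ?p 1 G (?s x) + 2 * k (x $ 2) * (s * ?p 1 F (?s x)) + (k (x $ 2))\<^sup>2 * (s * ?p 1 E (?s x))))"
    and G2: "?p 2 (\<lambda>x. c * (G (?s x) + 2 * k (x $ 2) * F (?s x) + (k (x $ 2))\<^sup>2 * E (?s x))) =
      (\<lambda>x. c * (s * (k (x $ 2) * ?p 1 G (?s x) + ?p 2 G (?s x)) 
        + (2 * k (x $ 2) * (s * (k (x $ 2) * ?p 1 F (?s x) + ?p 2 F (?s x))) + 2 * l (x $ 2) * F (?s x))
        + ((k (x $ 2))\<^sup>2 * (s * (k (x $ 2) * ?p 1 E (?s x) + ?p 2 E (?s x))) + 2 * k (x $ 2) * l (x $ 2) * E (?s x))))"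
    by (rule ext, simp add: rules power2_eq_square algebra_simps)+
  let ?d = "k (x $ 2)"
  have E22: "?p 2 (\<lambda>x. c * (s * (k (x $ 2) * ?p 1 E (?s x) + ?p 2 E (?s x)))) x =
     c * s * (?d * s * (?d * ?p 1 (?p 1 E) (?s x) + ?p 2 (?p 1 E) (?s x)) + l (x $ 2) * ?p 1 E (?s x)
       + s * (?d * ?p 1 (?p 2 E) (?s x) + ?p 2 (?p 2 E) (?s x)))"
    by (simp add: rules algebra_simps)
  have F12: "?p 1 (\<lambda>x. c * (s * (k (x $ 2) * ?p 1 F (?s x) + ?p 2 F (?s x))
        + (k (x $ 2) * (s * (k (x $ 2) * ?p 1 E (?s x) + ?p 2 E (?s x))) + l (x $ 2) * E (?s x)))) x =
     c * (s * s * (?d * ?p 1 (?p 1 F) (?s x) + ?p 1 (?p 2 F) (?s x)) + ?d * s * s * (?d * ?p 1 (?p 1 E) (?s x) + ?p 1 (?p 2 E) (?s x))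
       + l (x $ 2) * s * ?p 1 E (?s x))"
    by (simp add: rules algebra_simps)
  have G11: "?p 1 (\<lambda>x. c * (s * ?p 1 G (?s x) + 2 * k (x $ 2) * (s * ?p 1 F (?s x)) + (k (x $ 2))\<^sup>2 * (s * ?p 1 E (?s x)))) x =
     c * s * s * (?p 1 (?p 1 G) (?s x) + 2 * ?d * ?p 1 (?p 1 F) (?s x) + ?d\<^sup>2 * ?p 1 (?p 1 E) (?s x))"
    by (simp add: rules power2_eq_square algebra_simps)
  \<comment> \<open>The second derivatives carrying powers of \<open>?d\<close> cancel, the mixed
    ones of \<open>E\<close> by symmetry. Of the terms with \<open>l\<close>, half survives.\<close>
  have A: "?p 1 (?p 2 (\<lambda>x. c * (F (?s x) + k (x $ 2) * E (?s x)))) x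
      - ?p 1 (?p 1 (\<lambda>x. c * (G (?s x) + 2 * k (x $ 2) * F (?s x) + (k (x $ 2))\<^sup>2 * E (?s x)))) x / 2
      - ?p 2 (?p 2 (\<lambda>x. c * E (?s x))) x / 2
    = c * (s\<^sup>2 * (?p 1 (?p 2 F) (?s x) - ?p 1 (?p 1 G) (?s x) / 2 - ?p 2 (?p 2 E) (?s x) / 2) + s * l (x $ 2) * ?p 1 E (?s x) / 2)"
    unfolding F2 G1 E2 F12 G11 E22 partial_deriv_commute[OF sm(1), of 2 1]
    by (simp add: power2_eq_square field_simps)
  show ?thesis
    unfolding gauss_curvature_brioschi[OF g'] gauss_curvature_brioschi[OF g] E' F' G' A
    unfolding E1 E2 F1 F2 G1 G2 shear_pullback_nth
    unfolding E_def[symmetric] F_def[symmetric] G_def[symmetric]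
    using brioschi_shear[OF c] by (simp add: E_def F_def G_def)
qed

section \<open>Lengths of paths\<close>

definition speed :: "plane_tensor \<Rightarrow> (real \<Rightarrow> plane) \<Rightarrow> real \<Rightarrow> real" where
  "speed g \<gamma> t = (let v = vector_derivative \<gamma> (at t within {0..1}) in sqrt (v \<bullet> (g (\<gamma> t) *v v)))"

lemma has_riemannian_length_speed: "has_riemannian_length g \<gamma> L \<longleftrightarrow> (speed g \<gamma> has_integral L) {0..1}"
  unfolding has_riemannian_length_def speed_def[abs_def] ..

lemma quadratic_form_scaleR: "(r *\<^sub>R v) \<bullet> (A *v (r *\<^sub>R v)) = r\<^sup>2 * (v \<bullet> (A *v v))" for A :: "real^'n::finite^'n"
  by (simp add: linear_cmul[OF matrix_vector_mul_linear] power2_eq_square)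

lemma riemannian_metric_nonneg: "riemannian_metric g \<Longrightarrow> v \<bullet> (g x *v v) \<ge> 0"
  unfolding riemannian_metric_def by (cases "v = 0") (auto simp: less_imp_le)

lemma speed_nonneg: "riemannian_metric g \<Longrightarrow> speed g \<gamma> t \<ge> 0"
  by (simp add: speed_def Let_def riemannian_metric_nonneg)

lemma vector_derivative_within_01:
  assumes "t \<in> {0<..<1}" "(\<gamma> has_vector_derivative v) (at t)"
  shows "vector_derivative \<gamma> (at t within {0..1}) = v"
  using vector_derivative_within_cbox[of 0 1 t \<gamma> v] assms has_vector_derivative_at_within by auto

lemma speed_eqI:
  assumes "t \<in> {0<..<1}" "(\<gamma> has_vector_derivative v) (at t)"
  shows "speed g \<gamma> t = sqrt (v \<bullet> (g (\<gamma> t) *v v))"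
  using vector_derivative_within_01[OF assms] by (simp add: speed_def)

text \<open>Off a finite set, the derivative within \<open>{0..1}\<close> used for lengths is the
  ordinary two-sided one, to which the chain rules at a point apply.\<close>

lemma valid_path_has_vector_derivative:
  assumes "valid_path \<gamma>"
  obtains S where "finite S"
    "\<And>t. t \<in> {0<..<1} - S \<Longrightarrow> (\<gamma> has_vector_derivative vector_derivative \<gamma> (at t within {0..1})) (at t)"
proof -
  obtain S where S: "finite S" "\<gamma> C1_differentiable_on {0..1} - S"
    using assms by (auto simp: valid_path_def piecewise_C1_differentiable_on_def)
  show thesis
  proof (rule that[OF S(1)])
    fix t :: real assume t: "t \<in> {0<..<1} - S"
    then have "\<gamma> differentiable at t" using S(2) by (auto simp: C1_differentiable_on_eq)
    then have d: "(\<gamma> has_vector_derivative vector_derivative \<gamma> (at t)) (at t)"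
      by (simp add: vector_derivative_works)
    then show "(\<gamma> has_vector_derivative vector_derivative \<gamma> (at t within {0..1})) (at t)"
      using vector_derivative_within_01[OF _ d] t by simp
  qed
qed

text \<open>Joint continuity of \<open>D\<close> keeps the image path piecewise continuously
  differentiable, as \<open>valid_path\<close> demands. The speeds are proportional away from
  finitely many parameters, which the integral ignores.\<close>

lemma has_riemannian_length_map:
  assumes \<gamma>: "valid_path \<gamma>" and L: "has_riemannian_length g' \<gamma> L"
    and \<Psi>: "\<And>x. (\<Psi> has_derivative D x) (at x)" and D: "continuous_on UNIV (\<lambda>(x, v). D x v)"
    and iso: "\<And>x v. D x v \<bullet> (g (\<Psi> x) *v D x v) = \<kappa>\<^sup>2 * (v \<bullet> (g' x *v v))" and "\<kappa> > 0"
  shows "valid_path (\<Psi> \<circ> \<gamma>)" "has_riemannian_length g (\<Psi> \<circ> \<gamma>) (\<kappa> * L)"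
proof -
  have chain: "((\<Psi> \<circ> \<gamma>) has_vector_derivative D (\<gamma> t) v) (at t)" if "(\<gamma> has_vector_derivative v) (at t)" for t v
    using vector_derivative_diff_chain_within[OF that has_derivative_at_withinI[OF \<Psi>]] .
  obtain S where S: "finite S" "\<gamma> C1_differentiable_on {0..1} - S" and cont: "continuous_on {0..1} \<gamma>"
    using \<gamma> by (auto simp: valid_path_def piecewise_C1_differentiable_on_def)
  then obtain \<gamma>' where \<gamma>': "\<And>t. t \<in> {0..1} - S \<Longrightarrow> (\<gamma> has_vector_derivative \<gamma>' t) (at t)"
    "continuous_on ({0..1} - S) \<gamma>'"
    unfolding C1_differentiable_on_def by blast
  have "continuous_on ({0..1} - S) (\<lambda>t. (\<gamma> t, \<gamma>' t))"
    by (intro continuous_on_Pair \<gamma>'(2) continuous_on_subset[OF cont]) auto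
  from continuous_on_compose2[OF D this] have "continuous_on ({0..1} - S) (\<lambda>t. D (\<gamma> t) (\<gamma>' t))" by simp
  then have "(\<Psi> \<circ> \<gamma>) C1_differentiable_on {0..1} - S"
    unfolding C1_differentiable_on_def
    by (intro exI[of _ "\<lambda>t. D (\<gamma> t) (\<gamma>' t)"] conjI ballI chain \<gamma>'(1))
  moreover have "continuous_on {0..1} (\<Psi> \<circ> \<gamma>)"
  proof (rule continuous_on_compose[OF cont])
    show "continuous_on (\<gamma> ` {0..1}) \<Psi>"
      by (intro continuous_at_imp_continuous_on ballI has_derivative_continuous[OF \<Psi>])
  qed
  ultimately show "valid_path (\<Psi> \<circ> \<gamma>)"
    unfolding valid_path_def piecewise_C1_differentiable_on_def using S(1) by blast
  have sp: "speed g (\<Psi> \<circ> \<gamma>) t = \<kappa> * speed g' \<gamma> t" if "t \<in> {0..1} - (S \<union> {0, 1})" for t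
  proof -
    have d: "(\<gamma> has_vector_derivative \<gamma>' t) (at t)" and t: "t \<in> {0<..<1}" using that \<gamma>'(1)[of t] by auto
    show ?thesis unfolding speed_eqI[OF t d] speed_eqI[OF t chain[OF d]]
      using \<open>\<kappa> > 0\<close> by (simp add: iso real_sqrt_mult)
  qed
  show "has_riemannian_length g (\<Psi> \<circ> \<gamma>) (\<kappa> * L)"
    unfolding has_riemannian_length_speed
  proof (rule has_integral_spike_finite[of "S \<union> {0, 1}"])
    show "((\<lambda>t. \<kappa> * speed g' \<gamma> t) has_integral \<kappa> * L) {0..1}"
      using L by (intro has_integral_mult_right) (simp add: has_riemannian_length_speed)
  qed (use S(1) sp in auto)
qed

text \<open>Lower bounds for distances without geodesics: a function whose differential is dominated
  by the norm of \<open>g\<close> changes along a path by at most the length.\<close>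

lemma calibration_le_length:
  assumes \<gamma>: "valid_path \<gamma>" and L: "has_riemannian_length g \<gamma> L"
    and \<rho>: "\<And>x. (\<rho> has_derivative D x) (at x)"
    and le: "\<And>x v. \<bar>D x v\<bar> \<le> sqrt (v \<bullet> (g x *v v))"
  shows "\<bar>\<rho> (pathfinish \<gamma>) - \<rho> (pathstart \<gamma>)\<bar> \<le> L"
proof -
  obtain S where S: "finite S" 
    "\<And>t. t \<in> {0<..<1} - S \<Longrightarrow> (\<gamma> has_vector_derivative vector_derivative \<gamma> (at t within {0..1})) (at t)"
    using valid_path_has_vector_derivative[OF \<gamma>] by blast
  let ?f = "\<lambda>t. D (\<gamma> t) (vector_derivative \<gamma> (at t within {0..1}))"
  have "continuous_on {0..1} (\<rho> \<circ> \<gamma>)"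
  proof (rule continuous_on_compose)
    show "continuous_on {0..1} \<gamma>" using \<gamma> by (simp add: valid_path_def piecewise_C1_differentiable_on_def)
    show "continuous_on (\<gamma> ` {0..1}) \<rho>"
      by (intro continuous_at_imp_continuous_on ballI has_derivative_continuous[OF \<rho>])
  qed
  \<comment> \<open>The gauge integral makes this derivative integrable outright, despite the
    finitely many exceptional parameters and without any bound near them.\<close>
  then have I: "(?f has_integral ((\<rho> \<circ> \<gamma>) 1 - (\<rho> \<circ> \<gamma>) 0)) {0..1}"
    by (intro fundamental_theorem_of_calculus_interior_strong[OF S(1)]
         vector_derivative_diff_chain_within[OF S(2) has_derivative_at_withinI[OF \<rho>]]) auto
  have L': "(speed g \<gamma> has_integral L) {0..1}" using L by (simp add: has_riemannian_length_speed)
  have *: "\<bar>?f t\<bar> \<le> speed g \<gamma> t" for t using le by (simp add: speed_def Let_def)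
  have "(\<rho> \<circ> \<gamma>) 1 - (\<rho> \<circ> \<gamma>) 0 \<le> L"
    using * by (intro has_integral_le[OF I L']) (meson abs_le_D1)
  moreover have "- ((\<rho> \<circ> \<gamma>) 1 - (\<rho> \<circ> \<gamma>) 0) \<le> L"
    using * by (intro has_integral_le[OF has_integral_neg[OF I] L']) (meson abs_le_D2)
  ultimately show ?thesis by (simp add: pathfinish_def pathstart_def)
qed

lemma has_riemannian_length_join:
  assumes \<gamma>: "valid_path \<gamma>1" "valid_path \<gamma>2"
    and L: "has_riemannian_length g \<gamma>1 L1" "has_riemannian_length g \<gamma>2 L2"
  shows "has_riemannian_length g (\<gamma>1 +++ \<gamma>2) (L1 + L2)"
proof -
  obtain S1 where S1: "finite S1" 
    "\<And>t. t \<in> {0<..<1} - S1 \<Longrightarrow> (\<gamma>1 has_vector_derivative vector_derivative \<gamma>1 (at t within {0..1})) (at t)"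
    using valid_path_has_vector_derivative[OF \<gamma>(1)] by blast
  obtain S2 where S2: "finite S2" 
    "\<And>t. t \<in> {0<..<1} - S2 \<Longrightarrow> (\<gamma>2 has_vector_derivative vector_derivative \<gamma>2 (at t within {0..1})) (at t)"
    using valid_path_has_vector_derivative[OF \<gamma>(2)] by blast
  have 1: "((\<lambda>t. 2 * speed g \<gamma>1 (2 * t)) has_integral L1) {0..1/2}"
    using has_integral_mult_right[OF has_integral_affinity'[of "speed g \<gamma>1" L1 0 1 2 0], of 2] L(1)
    by (simp add: has_riemannian_length_speed)
  have 2: "((\<lambda>t. 2 * speed g \<gamma>2 (2 * t - 1)) has_integral L2) {1/2..1}"
    using has_integral_mult_right[OF has_integral_affinity'[of "speed g \<gamma>2" L2 0 1 2 "-1"], of 2] L(2)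
    by (simp add: has_riemannian_length_speed)
  have aff: "((\<lambda>t. 2 * t + c) has_vector_derivative (2::real)) (at t)" for c t
    by (auto intro!: derivative_eq_intros simp: has_vector_derivative_def)
  have e1: "speed g (\<gamma>1 +++ \<gamma>2) t = 2 * speed g \<gamma>1 (2 * t)" if "t \<in> {0..1/2} - ((\<lambda>t. t/2) ` S1 \<union> {0, 1/2})" for t
  proof -
    have "2 * t \<notin> S1"
    proof
      assume "2 * t \<in> S1"
      then have "2 * t / 2 \<in> (\<lambda>t. t / 2) ` S1" by blast
      with that show False by simp
    qed
    then have t: "2 * t \<in> {0<..<1} - S1" "t \<in> {0<..<1}" "t < 1/2" using that by auto
    let ?v = "vector_derivative \<gamma>1 (at (2 * t) within {0..1})"
    have "((\<gamma>1 \<circ> (\<lambda>t. 2 * t + 0)) has_vector_derivative 2 *\<^sub>R ?v) (at t)"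
      using S1(2)[OF t(1)] by (intro vector_diff_chain_at[OF aff]) simp
    then have "((\<gamma>1 +++ \<gamma>2) has_vector_derivative 2 *\<^sub>R ?v) (at t)"
      by (rule has_vector_derivative_transform_within_open[of _ _ _ "{..<1/2}"]) (use t in \<open>auto simp: joinpaths_def\<close>)
    then have "speed g (\<gamma>1 +++ \<gamma>2) t = sqrt ((2 *\<^sub>R ?v) \<bullet> (g ((\<gamma>1 +++ \<gamma>2) t) *v (2 *\<^sub>R ?v)))"
      by (rule speed_eqI[OF t(2)])
    then show ?thesis using t unfolding quadratic_form_scaleR
      by (simp add: speed_def Let_def real_sqrt_mult joinpaths_def)
  qed
  have e2: "speed g (\<gamma>1 +++ \<gamma>2) t = 2 * speed g \<gamma>2 (2 * t - 1)" if "t \<in> {1/2..1} - ((\<lambda>t. (t + 1)/2) ` S2 \<union> {1/2, 1})" for t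
  proof -
    have "2 * t - 1 \<notin> S2"
    proof
      assume "2 * t - 1 \<in> S2"
      then have "((2 * t - 1) + 1)/2 \<in> (\<lambda>t. (t + 1)/2) ` S2" by blast
      with that show False by simp
    qed
    then have t: "2 * t - 1 \<in> {0<..<1} - S2" "t \<in> {0<..<1}" "t > 1/2" using that by auto
    let ?v = "vector_derivative \<gamma>2 (at (2 * t - 1) within {0..1})"
    have "((\<gamma>2 \<circ> (\<lambda>t. 2 * t + -1)) has_vector_derivative 2 *\<^sub>R ?v) (at t)"
      using S2(2)[OF t(1)] by (intro vector_diff_chain_at[OF aff]) simp
    then have "((\<gamma>1 +++ \<gamma>2) has_vector_derivative 2 *\<^sub>R ?v) (at t)"
      by (rule has_vector_derivative_transform_within_open[of _ _ _ "{1/2<..}"]) (use t in \<open>auto simp: joinpaths_def\<close>)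
    then have "speed g (\<gamma>1 +++ \<gamma>2) t = sqrt ((2 *\<^sub>R ?v) \<bullet> (g ((\<gamma>1 +++ \<gamma>2) t) *v (2 *\<^sub>R ?v)))"
      by (rule speed_eqI[OF t(2)])
    then show ?thesis using t unfolding quadratic_form_scaleR
      by (simp add: speed_def Let_def real_sqrt_mult joinpaths_def)
  qed
  show ?thesis unfolding has_riemannian_length_speed
  proof (rule has_integral_combine[of 0 "1/2" 1])
    show "(speed g (\<gamma>1 +++ \<gamma>2) has_integral L1) {0..1/2}"
      by (rule has_integral_spike_finite[of "(\<lambda>t. t/2) ` S1 \<union> {0, 1/2}", OF _ _ 1]) (simp add: S1(1), erule e1)
    show "(speed g (\<gamma>1 +++ \<gamma>2) has_integral L2) {1/2..1}"
      by (rule has_integral_spike_finite[of "(\<lambda>t. (t + 1)/2) ` S2 \<union> {1/2, 1}", OF _ _ 2]) (simp add: S2(1), erule e2)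
  qed auto
qed

lemma has_riemannian_length_reverse:
  assumes \<gamma>: "valid_path \<gamma>" and L: "has_riemannian_length g \<gamma> L"
  shows "has_riemannian_length g (reversepath \<gamma>) L"
proof -
  obtain S where S: "finite S" 
    "\<And>t. t \<in> {0<..<1} - S \<Longrightarrow> (\<gamma> has_vector_derivative vector_derivative \<gamma> (at t within {0..1})) (at t)"
    using valid_path_has_vector_derivative[OF \<gamma>] by blast
  have "(\<lambda>x. 1 - x) ` {0..1} = {0..1::real}"
    by (auto intro: image_eqI[of _ _ "1 - _"])
  then have I: "((\<lambda>t. speed g \<gamma> (1 - t)) has_integral L) {0..1}"
    using has_integral_affinity[of "speed g \<gamma>" L 0 1 "-1" 1] L by (simp add: has_riemannian_length_speed)
  have e: "speed g (reversepath \<gamma>) t = speed g \<gamma> (1 - t)" if "t \<in> {0..1} - ((\<lambda>t. 1 - t) ` S \<union> {0, 1})" for t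
  proof -
    have "1 - t \<notin> S"
    proof
      assume "1 - t \<in> S"
      then have "1 - (1 - t) \<in> (\<lambda>t. 1 - t) ` S" by blast
      with that show False by simp
    qed
    then have t: "1 - t \<in> {0<..<1} - S" "t \<in> {0<..<1}" using that by auto
    let ?v = "vector_derivative \<gamma> (at (1 - t) within {0..1})"
    have "((\<lambda>t. 1 - t) has_vector_derivative (-1::real)) (at t)"
      by (auto intro!: derivative_eq_intros simp: has_vector_derivative_def)
    from vector_diff_chain_at[OF this S(2)[OF t(1)]]
    have "((reversepath \<gamma>) has_vector_derivative (-1) *\<^sub>R ?v) (at t)"
      by (simp add: reversepath_def o_def)
    from speed_eqI[OF t(2) this, of g] show ?thesis
      unfolding quadratic_form_scaleR by (simp add: speed_def Let_def reversepath_def)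
  qed
  show ?thesis unfolding has_riemannian_length_speed
    by (rule has_integral_spike_finite[of "(\<lambda>t. 1 - t) ` S \<union> {0, 1}", OF _ _ I]) (simp add: S(1), erule e)
qed

text \<open>Segments have continuous speed, hence a length; so the infimum defining the distance is
  over a nonempty set.\<close>

lemma has_riemannian_length_linepath:
  assumes "riemannian_metric g"
  obtains L where "has_riemannian_length g (linepath x y) L"
proof -
  have sp: "speed g (linepath x y) t = sqrt ((y - x) \<bullet> (g (linepath x y t) *v (y - x)))" if "t \<in> {0..1}" for t
    using that by (simp add: speed_def Let_def vector_derivative_linepath_within)
  have "continuous_on UNIV g" using assms by (simp add: riemannian_metric_def smooth_imp_continuous_on)
  moreover have "continuous_on {0..1} (linepath x y)" by (simp add: continuous_on_linepath)
  ultimately have "continuous_on {0..1} (\<lambda>t. g (linepath x y t))"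
    by (rule continuous_on_compose2) auto
  then have "continuous_on {0..1} (\<lambda>t. g (linepath x y t) *v (y - x))"
    unfolding matrix_vector_mult_def by (intro continuous_intros)
  then have "continuous_on {0..1} (\<lambda>t. sqrt ((y - x) \<bullet> (g (linepath x y t) *v (y - x))))"
    by (intro continuous_intros)
  then obtain L where "((\<lambda>t. sqrt ((y - x) \<bullet> (g (linepath x y t) *v (y - x)))) has_integral L) {0..1}"
    using integrable_continuous_real integrable_on_def by blast
  then have "(speed g (linepath x y) has_integral L) {0..1}"
    by (rule has_integral_eq[rotated]) (simp add: sp)
  then show thesis using that by (simp add: has_riemannian_length_speed)
qed

section \<open>The Riemannian distance\<close>

definition lengths :: "plane_tensor \<Rightarrow> plane \<Rightarrow> plane \<Rightarrow> real set" where
  "lengths g x y = {L. \<exists>\<gamma>. valid_path \<gamma> \<and> pathstart \<gamma> = x \<and> pathfinish \<gamma> = y \<and> has_riemannian_length g \<gamma> L}"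

lemma riemannian_dist_lengths: "riemannian_dist g x y = Inf (lengths g x y)"
  by (simp add: riemannian_dist_def lengths_def)

context
  fixes g :: plane_tensor
  assumes g: "riemannian_metric g"
begin

lemma lengths_nonempty: "lengths g x y \<noteq> {}"
proof -
  obtain L where "has_riemannian_length g (linepath x y) L" using has_riemannian_length_linepath[OF g] .
  then show ?thesis unfolding lengths_def by (auto intro!: exI[of _ L] exI[of _ "linepath x y"])
qed

lemma lengths_nonneg: "L \<in> lengths g x y \<Longrightarrow> L \<ge> 0"
  unfolding lengths_def has_riemannian_length_speed by (auto intro: has_integral_nonneg speed_nonneg[OF g])

lemma bdd_below_lengths: "bdd_below (lengths g x y)"
  using lengths_nonneg by (intro bdd_belowI)

lemma riemannian_dist_le: "L \<in> lengths g x y \<Longrightarrow> riemannian_dist g x y \<le> L"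
  unfolding riemannian_dist_lengths by (rule cInf_lower[OF _ bdd_below_lengths])

lemma riemannian_dist_ge: "(\<And>L. L \<in> lengths g x y \<Longrightarrow> l \<le> L) \<Longrightarrow> l \<le> riemannian_dist g x y"
  unfolding riemannian_dist_lengths by (rule cInf_greatest[OF lengths_nonempty])

lemma riemannian_dist_approx:
  assumes "e > 0" obtains L where "L \<in> lengths g x y" "L < riemannian_dist g x y + e"
  using cInf_lessD[OF lengths_nonempty, of x y "riemannian_dist g x y + e"] assms
  unfolding riemannian_dist_lengths by auto

lemma calibration_le_riemannian_dist:
  assumes "\<And>x. (\<rho> has_derivative D x) (at x)" "\<And>x v. \<bar>D x v\<bar> \<le> sqrt (v \<bullet> (g x *v v))"
  shows "\<bar>\<rho> y - \<rho> x\<bar> \<le> riemannian_dist g x y"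
proof (rule riemannian_dist_ge)
  fix L assume "L \<in> lengths g x y"
  then obtain \<gamma> where \<gamma>: "valid_path \<gamma>" "pathstart \<gamma> = x" "pathfinish \<gamma> = y" "has_riemannian_length g \<gamma> L"
    unfolding lengths_def by blast
  show "\<bar>\<rho> y - \<rho> x\<bar> \<le> L"
    using calibration_le_length[OF \<gamma>(1,4) assms] \<gamma>(2,3) by simp
qed

text \<open>The form attains a positive minimum over \<open>K\<close> times the unit sphere;
  homogeneity extends the bound to all \<open>v\<close>.\<close>

lemma quadratic_form_lower_bound:
  assumes K: "compact K" "K \<noteq> {}"
  obtains m where "m > 0" "\<And>x v. x \<in> K \<Longrightarrow> m * norm v \<le> sqrt (v \<bullet> (g x *v v))"
proof -
  let ?f = "\<lambda>(x, v). v \<bullet> (g x *v v)"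
  have cg: "continuous_on UNIV g" using g by (simp add: riemannian_metric_def smooth_imp_continuous_on)
  have "continuous_on UNIV ?f"
    unfolding split_def matrix_vector_mult_def inner_vec_def
    by (intro continuous_intros continuous_on_compose2[OF cg continuous_on_fst]) auto
  then have "continuous_on (K \<times> sphere 0 1) ?f" by (rule continuous_on_subset) simp
  moreover have "compact (K \<times> sphere (0::plane) 1)" using K by (intro compact_Times) auto
  moreover have "axis 1 1 \<in> sphere (0::plane) 1" by simp
  then have "K \<times> sphere (0::plane) 1 \<noteq> {}" using K by blast
  ultimately obtain z where z: "z \<in> K \<times> sphere 0 1" "\<And>w. w \<in> K \<times> sphere 0 1 \<Longrightarrow> ?f z \<le> ?f w"
    using continuous_attains_inf[of "K \<times> sphere 0 1" ?f] by blast
  have "snd z \<noteq> 0" using z(1) by auto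
  then have pos: "?f z > 0" using g unfolding riemannian_metric_def split_def by blast
  show thesis
  proof (rule that[of "sqrt (?f z)"])
    fix x v assume "x \<in> K"
    show "sqrt (?f z) * norm v \<le> sqrt (v \<bullet> (g x *v v))"
    proof (cases "v = 0")
      case False
      let ?u = "v /\<^sub>R norm v"
      have "?f z \<le> ?f (x, ?u)" using False \<open>x \<in> K\<close> by (intro z(2)) auto
      then have "(norm v)\<^sup>2 * ?f z \<le> (norm v)\<^sup>2 * (?u \<bullet> (g x *v ?u))" by (intro mult_left_mono) auto
      also have "\<dots> = v \<bullet> (g x *v v)" unfolding quadratic_form_scaleR using False by (simp add: field_simps)
      finally have "sqrt ((norm v)\<^sup>2 * ?f z) \<le> sqrt (v \<bullet> (g x *v v))" by (rule real_sqrt_le_mono)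
      then show ?thesis by (simp add: real_sqrt_mult mult.commute)
    qed simp
  qed (use pos in simp)
qed

end

text \<open>Squaring the positive part removes its corner at 0, which gives a differentiable cutoff
  for calibrations.\<close>

lemma has_real_derivative_max0_square:
  "((\<lambda>u. (max 0 u)\<^sup>2) has_real_derivative 2 * max 0 u) (at u)" for u :: real
proof -
  consider "u > 0" | "u < 0" | "u = 0" by linarith
  then show ?thesis
  proof cases
    case 1
    have "((\<lambda>u. u\<^sup>2) has_real_derivative 2 * u) (at u)" by (auto intro!: derivative_eq_intros)
    then have "((\<lambda>u. (max 0 u)\<^sup>2) has_real_derivative 2 * u) (at u)"
      by (rule DERIV_cong_ev[THEN iffD1, rotated -1, OF _ refl _ refl])
        (use 1 eventually_nhds_in_open[of "{0<..}" u] in \<open>auto elim!: eventually_mono\<close>)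
    then show ?thesis using 1 by simp
  next
    case 2
    have "((\<lambda>u. 0) has_real_derivative 0) (at u)" by simp
    then have "((\<lambda>u. (max 0 u)\<^sup>2) has_real_derivative 0) (at u)"
      by (rule DERIV_cong_ev[THEN iffD1, rotated -1, OF _ refl _ refl])
        (use 2 eventually_nhds_in_open[of "{..<0}" u] in \<open>auto elim!: eventually_mono\<close>)
    then show ?thesis using 2 by simp
  next
    case 3
    have "((\<lambda>h::real. ((max 0 h)\<^sup>2) / h) \<longlongrightarrow> 0) (at 0)"
    proof (rule Lim_null_comparison)
      show "\<forall>\<^sub>F h in at 0. norm ((max 0 h)\<^sup>2 / h) \<le> \<bar>h\<bar>" for h :: real
        by (auto intro!: always_eventually simp: power2_eq_square max_def)
      show "((\<lambda>h::real. \<bar>h\<bar>) \<longlongrightarrow> 0) (at 0)" by (rule tendsto_rabs_zero[OF tendsto_ident_at])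
    qed
    then show ?thesis using 3 by (simp add: DERIV_def)
  qed
qed

text \<open>The calibration is a bump that vanishes outside the Euclidean ball around
  \<open>x\<close> with \<open>y\<close> on its boundary. The metric need only be bounded below on
  that compact ball.\<close>

lemma riemannian_dist_pos:
  assumes g: "riemannian_metric g" and "x \<noteq> y"
  shows "riemannian_dist g x y > 0"
proof -
  define r where "r = dist x y"
  have r: "r > 0" using assms(2) by (simp add: r_def)
  obtain m where m: "m > 0" "\<And>z v. z \<in> cball x r \<Longrightarrow> m * norm v \<le> sqrt (v \<bullet> (g z *v v))"
    using quadratic_form_lower_bound[OF g, of "cball x r"] r by auto
  \<comment> \<open>The differential of the squared bump is at most
    \<open>2 * r^2 * 2 * r * norm v\<close>, so this factor brings it down to
    \<open>m * norm v\<close>.\<close>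
  define a where "a = m / (4 * r^3)"
  have a: "a > 0" using m r by (simp add: a_def)
  define u where "u z = r\<^sup>2 - (z - x) \<bullet> (z - x)" for z
  define D where "D z v = a * (2 * max 0 (u z) * (- 2 * ((z - x) \<bullet> v)))" for z v
  have "(u has_derivative (\<lambda>v. - 2 * ((z - x) \<bullet> v))) (at z)" for z
    unfolding u_def by (auto intro!: derivative_eq_intros simp: inner_commute)
  from DERIV_compose_FDERIV[OF has_real_derivative_max0_square this]
  have der: "((\<lambda>z. a * (max 0 (u z))\<^sup>2) has_derivative D z) (at z)" for z
    unfolding D_def by (intro has_derivative_mult_right) (simp add: mult.commute)
  have le: "\<bar>D z v\<bar> \<le> sqrt (v \<bullet> (g z *v v))" for z v
  proof (cases "z \<in> cball x r")
    case True
    then have n: "norm (z - x) \<le> r" by (simp add: dist_norm norm_minus_commute)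
    have "\<bar>max 0 (u z)\<bar> \<le> r\<^sup>2" unfolding u_def by (simp add: max_def)
    moreover have "\<bar>(z - x) \<bullet> v\<bar> \<le> r * norm v"
      using Cauchy_Schwarz_ineq2[of "z - x" v] n mult_right_mono[OF n, of "norm v"] by simp
    ultimately have "\<bar>max 0 (u z)\<bar> * \<bar>(z - x) \<bullet> v\<bar> \<le> r\<^sup>2 * (r * norm v)"
      by (intro mult_mono) auto
    then have "\<bar>D z v\<bar> \<le> a * (4 * (r\<^sup>2 * (r * norm v)))"
      unfolding D_def using a by (simp add: abs_mult)
    also have "\<dots> = m * norm v" unfolding a_def using r by (simp add: power2_eq_square power3_eq_cube)
    also have "\<dots> \<le> sqrt (v \<bullet> (g z *v v))" by (rule m(2)[OF True])
    finally show ?thesis .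
  next
    case False
    then have "r \<le> norm (z - x)" by (simp add: dist_norm norm_minus_commute)
    then have "u z \<le> 0" using r unfolding u_def by (simp flip: power2_norm_eq_inner) 
    then show ?thesis by (simp add: D_def max_def riemannian_metric_nonneg[OF g])
  qed
  have "\<bar>a * (max 0 (u y))\<^sup>2 - a * (max 0 (u x))\<^sup>2\<bar> \<le> riemannian_dist g x y"
    by (rule calibration_le_riemannian_dist[OF g der le])
  moreover have "u y = 0" unfolding u_def r_def by (simp add: dist_norm norm_minus_commute flip: power2_norm_eq_inner)
  moreover have "u x = r\<^sup>2" by (simp add: u_def)
  ultimately show ?thesis using a r by (simp add: abs_mult) (smt (verit) zero_less_power mult_pos_pos)
qed

theorem Metric_space_riemannian_dist:
  assumes g: "riemannian_metric g"
  shows "Metric_space UNIV (riemannian_dist g)"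
proof
  fix x y z :: plane
  show nn: "0 \<le> riemannian_dist g x y" for x y using riemannian_dist_ge[OF g] lengths_nonneg[OF g] by blast
  have "lengths g y x \<subseteq> lengths g x y" for x y
  proof
    fix L assume "L \<in> lengths g y x"
    then obtain \<gamma> where "valid_path \<gamma>" "pathstart \<gamma> = y" "pathfinish \<gamma> = x" "has_riemannian_length g \<gamma> L"
      unfolding lengths_def by blast
    then show "L \<in> lengths g x y" unfolding lengths_def
      by (auto intro!: exI[of _ "reversepath \<gamma>"] has_riemannian_length_reverse)
  qed
  then show "riemannian_dist g x y = riemannian_dist g y x"
    unfolding riemannian_dist_lengths by (metis subset_antisym)
  show "riemannian_dist g x y = 0 \<longleftrightarrow> x = y"
  proof
    assume "x = y"
    have "speed g (linepath x x) t = 0" if "t \<in> {0..1}" for t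
      using that by (simp add: speed_def Let_def vector_derivative_linepath_within)
    then have "(speed g (linepath x x) has_integral 0) {0..1}" by (rule has_integral_is_0)
    then have "0 \<in> lengths g x y" unfolding lengths_def has_riemannian_length_speed \<open>x = y\<close>
      by (auto intro!: exI[of _ "linepath y y"])
    then show "riemannian_dist g x y = 0" using nn[of x y] riemannian_dist_le[OF g] by fastforce
  next
    assume "riemannian_dist g x y = 0"
    then show "x = y" using riemannian_dist_pos[OF g, of x y] by auto
  qed
  show "riemannian_dist g x z \<le> riemannian_dist g x y + riemannian_dist g y z"
  proof (rule field_le_epsilon)
    fix e :: real assume "e > 0"
    obtain L1 where L1: "L1 \<in> lengths g x y" "L1 < riemannian_dist g x y + e/2"
      using riemannian_dist_approx[OF g, of "e/2"] \<open>e > 0\<close> by auto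
    obtain L2 where L2: "L2 \<in> lengths g y z" "L2 < riemannian_dist g y z + e/2"
      using riemannian_dist_approx[OF g, of "e/2"] \<open>e > 0\<close> by auto
    obtain \<gamma>1 \<gamma>2 where "valid_path \<gamma>1" "pathstart \<gamma>1 = x" "pathfinish \<gamma>1 = y" "has_riemannian_length g \<gamma>1 L1"
       "valid_path \<gamma>2" "pathstart \<gamma>2 = y" "pathfinish \<gamma>2 = z" "has_riemannian_length g \<gamma>2 L2"
      using L1(1) L2(1) unfolding lengths_def by blast
    then have "L1 + L2 \<in> lengths g x z" unfolding lengths_def
      by (auto intro!: exI[of _ "\<gamma>1 +++ \<gamma>2"] has_riemannian_length_join valid_path_join)
    then show "riemannian_dist g x z \<le> riemannian_dist g x y + riemannian_dist g y z + e"
      using riemannian_dist_le[OF g, of "L1 + L2" x z] L1(2) L2(2) by simp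
  qed
qed

section \<open>Completeness\<close>

text \<open>Cauchy sequences are carried over by \<open>\<Psi>\<close>, their limits carried back by
  \<open>\<Phi>\<close>.\<close>

lemma mcomplete_rescale:
  assumes d: "Metric_space UNIV d" and d': "Metric_space UNIV d'" and "\<kappa> > 0"
    and eq: "\<And>x y. d (\<Psi> x) (\<Psi> y) = \<kappa> * d' x y" and inv: "\<And>x. \<Psi> (\<Phi> x) = x"
    and compl: "Metric_space.mcomplete UNIV d"
  shows "Metric_space.mcomplete UNIV d'"
  unfolding Metric_space.mcomplete_def[OF d']
proof (intro allI impI)
  fix \<sigma> assume "Metric_space.MCauchy UNIV d' \<sigma>"
  then have C: "\<exists>N. \<forall>n n'. N \<le> n \<longrightarrow> N \<le> n' \<longrightarrow> d' (\<sigma> n) (\<sigma> n') < e" if "e > 0" for e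
    using that unfolding Metric_space.MCauchy_def[OF d'] by blast
  have "Metric_space.MCauchy UNIV d (\<Psi> \<circ> \<sigma>)"
    unfolding Metric_space.MCauchy_def[OF d]
  proof (intro conjI allI impI)
    fix e :: real assume "e > 0"
    then obtain N where "\<forall>n n'. N \<le> n \<longrightarrow> N \<le> n' \<longrightarrow> d' (\<sigma> n) (\<sigma> n') < e / \<kappa>"
      using C[of "e / \<kappa>"] \<open>\<kappa> > 0\<close> by auto
    then show "\<exists>N. \<forall>n n'. N \<le> n \<longrightarrow> N \<le> n' \<longrightarrow> d ((\<Psi> \<circ> \<sigma>) n) ((\<Psi> \<circ> \<sigma>) n') < e"
      using \<open>\<kappa> > 0\<close> by (auto simp: eq field_simps)
  qed simp
  then obtain l where "limitin (Metric_space.mtopology UNIV d) (\<Psi> \<circ> \<sigma>) l sequentially"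
    using compl unfolding Metric_space.mcomplete_def[OF d] by blast
  then have l: "\<exists>N. \<forall>n\<ge>N. d (\<Psi> (\<sigma> n)) l < e" if "e > 0" for e
    using that unfolding Metric_space.limit_metric_sequentially[OF d] by auto
  have "limitin (Metric_space.mtopology UNIV d') \<sigma> (\<Phi> l) sequentially"
    unfolding Metric_space.limit_metric_sequentially[OF d']
  proof (intro conjI allI impI)
    fix e :: real assume "e > 0"
    then obtain N where N: "\<forall>n\<ge>N. d (\<Psi> (\<sigma> n)) (\<Psi> (\<Phi> l)) < \<kappa> * e"
      using l[of "\<kappa> * e"] \<open>\<kappa> > 0\<close> by (auto simp: inv)
    show "\<exists>N. \<forall>n\<ge>N. \<sigma> n \<in> UNIV \<and> d' (\<sigma> n) (\<Phi> l) < e"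
      using N \<open>\<kappa> > 0\<close> by (auto simp: eq)
  qed simp
  then show "\<exists>x. limitin (Metric_space.mtopology UNIV d') \<sigma> x sequentially" by blast
qed

lemma lengths_map:
  assumes "\<And>x. (\<Psi> has_derivative D x) (at x)" "continuous_on UNIV (\<lambda>(x, v). D x v)"
    "\<And>x v. D x v \<bullet> (g (\<Psi> x) *v D x v) = \<kappa>\<^sup>2 * (v \<bullet> (g' x *v v))" "\<kappa> > 0"
    and "L \<in> lengths g' x y"
  shows "\<kappa> * L \<in> lengths g (\<Psi> x) (\<Psi> y)"
proof -
  obtain \<gamma> where \<gamma>: "valid_path \<gamma>" "pathstart \<gamma> = x" "pathfinish \<gamma> = y" "has_riemannian_length g' \<gamma> L"
    using assms(5) unfolding lengths_def by blast
  note m = has_riemannian_length_map[OF \<gamma>(1,4) assms(1-4)]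
  have "pathstart (\<Psi> \<circ> \<gamma>) = \<Psi> x" "pathfinish (\<Psi> \<circ> \<gamma>) = \<Psi> y"
    using \<gamma>(2,3) by (simp_all add: pathstart_def pathfinish_def)
  with m show ?thesis unfolding lengths_def by blast
qed

lemma shear_map_inverse:
  assumes "s \<noteq> 0"
  shows "shear_map s h (shear_map (1/s) (\<lambda>y. - s * h (y / s)) x) = x"
    "shear_map (1/s) (\<lambda>y. - s * h (y / s)) (shear_map s h x) = x"
  using assms by (simp_all add: shear_map_def vec_eq_iff forall_2 field_simps)

text \<open>The inverse of a shear map is again one, with factor \<open>1/s\<close> and a rescaled
  shear function. Transport of lengths in both directions therefore gives equality of the scaled
  distances.\<close>

lemma riemannian_dist_shear_pullback:
  assumes g: "riemannian_metric g" and g': "riemannian_metric (shear_pullback c s h k g)"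
    and c: "c > 0" and s: "s > 0"
    and h: "\<And>y. (h has_real_derivative k y) (at y)" and k: "continuous_on UNIV k"
  shows "riemannian_dist g (shear_map s h x) (shear_map s h y) = s / sqrt c * riemannian_dist (shear_pullback c s h k g) x y"
proof -
  let ?g = "shear_pullback c s h k g" and ?\<Psi> = "shear_map s h" and ?\<Phi> = "shear_map (1/s) (\<lambda>y. - s * h (y / s))"
  define D where "D r k x v = (vector [r * (v $ 1 + k (x $ 2) * v $ 2), r * v $ 2] :: plane)" for r and k :: "real \<Rightarrow> real" and x v :: plane
  have contD: "continuous_on UNIV (\<lambda>(x, v). D r k x v)" if "continuous_on UNIV k" for r k
    unfolding D_def vector_2_axis split_def
    by (intro continuous_intros continuous_on_compose2[OF that]) auto
  have kpos: "s / sqrt c > 0" "sqrt c / s > 0" using c s by auto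
  have f: "s / sqrt c * L \<in> lengths g (?\<Psi> x) (?\<Psi> y)" if "L \<in> lengths ?g x y" for L x y
  proof (rule lengths_map[OF _ contD[OF k, of s] _ kpos(1) that])
    show "(?\<Psi> has_derivative D s k x) (at x)" for x
      unfolding D_def by (rule has_derivative_shear_map[OF h])
    show "D s k x v \<bullet> (g (?\<Psi> x) *v D s k x v) = (s / sqrt c)\<^sup>2 * (v \<bullet> (?g x *v v))" for x v
    proof -
      \<comment> \<open>With the factor \<open>s\<close> taken out, the remaining vector is the one
        in \<open>shear_pullback_quadratic_form\<close>.\<close>
      have "D s k x v = s *\<^sub>R vector [v $ 1 + k (x $ 2) * v $ 2, v $ 2]"
        by (simp add: D_def vec_eq_iff forall_2)
      then show ?thesis
        using c by (simp only: quadratic_form_scaleR shear_pullback_quadratic_form[OF g]) (simp add: power_divide)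
    qed
  qed
  have b: "sqrt c / s * L \<in> lengths ?g (?\<Phi> x) (?\<Phi> y)" if "L \<in> lengths g x y" for L x y
  proof (rule lengths_map[OF _ contD[of "\<lambda>y. - k (y / s)" "1/s"] _ kpos(2) that])
    show "continuous_on UNIV (\<lambda>y. - k (y / s))"
      using s by (intro continuous_intros continuous_on_compose2[OF k]) auto
    show "(?\<Phi> has_derivative D (1/s) (\<lambda>y. - k (y / s)) x) (at x)" for x
      unfolding D_def
    proof (rule has_derivative_shear_map)
      have "((\<lambda>y. h (y / s)) has_real_derivative k (x $ 2 / s) * (1 / s)) (at (x $ 2))"
        by (rule DERIV_chain2[OF h]) (use s in \<open>auto intro!: derivative_eq_intros\<close>)
      from DERIV_cmult[OF this, of "- s"]
      show "((\<lambda>y. - s * h (y / s)) has_real_derivative - k (x $ 2 / s)) (at (x $ 2))" using s by simp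
    qed
    show "D (1/s) (\<lambda>y. - k (y / s)) x v \<bullet> (?g (?\<Phi> x) *v D (1/s) (\<lambda>y. - k (y / s)) x v) = (sqrt c / s)\<^sup>2 * (v \<bullet> (g x *v v))" for x v
    proof -
      let ?w = "D (1/s) (\<lambda>y. - k (y / s)) x v"
      \<comment> \<open>The second coordinate of \<open>?\<Phi> x\<close> is
        \<open>x $ 2 / s\<close>, so the two shear terms cancel.\<close>
      have "(vector [?w $ 1 + k (?\<Phi> x $ 2) * ?w $ 2, ?w $ 2] :: plane) = (1/s) *\<^sub>R v"
        using s by (simp add: D_def shear_map_def vec_eq_iff forall_2 field_simps)
      moreover have "?\<Psi> (?\<Phi> x) = x" using s by (intro shear_map_inverse) simp
      ultimately show ?thesis using c s
        by (simp only: quadratic_form_scaleR shear_pullback_quadratic_form[OF g]) (simp add: power_divide)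
    qed
  qed
  define \<kappa> where "\<kappa> = s / sqrt c"
  have \<kappa>: "\<kappa> > 0" using kpos by (simp add: \<kappa>_def)
  show ?thesis unfolding \<kappa>_def[symmetric]
  proof (rule antisym)
    have "riemannian_dist g (?\<Psi> x) (?\<Psi> y) / \<kappa> \<le> riemannian_dist ?g x y"
    proof (rule riemannian_dist_ge[OF g'])
      fix L assume "L \<in> lengths ?g x y"
      from riemannian_dist_le[OF g f[OF this]] show "riemannian_dist g (?\<Psi> x) (?\<Psi> y) / \<kappa> \<le> L"
        using \<kappa> by (simp only: pos_divide_le_eq mult.commute \<kappa>_def[symmetric])
    qed
    then show "riemannian_dist g (?\<Psi> x) (?\<Psi> y) \<le> \<kappa> * riemannian_dist ?g x y"
      using \<kappa> by (simp only: pos_divide_le_eq mult.commute)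
    show "\<kappa> * riemannian_dist ?g x y \<le> riemannian_dist g (?\<Psi> x) (?\<Psi> y)"
    proof (rule riemannian_dist_ge[OF g])
      fix L assume "L \<in> lengths g (?\<Psi> x) (?\<Psi> y)"
      from riemannian_dist_le[OF g' b[OF this]] have "riemannian_dist ?g x y \<le> L / \<kappa>"
        using s shear_map_inverse(2)[of s h] by (simp add: \<kappa>_def mult.commute)
      then show "\<kappa> * riemannian_dist ?g x y \<le> L" using \<kappa> by (simp only: pos_le_divide_eq mult.commute)
    qed
  qed
qed

lemma smooth_const: "smooth (\<lambda>x::real^'n::finite. A)"
proof -
  have "jsmooth n (UNIV :: real set) (\<lambda>_ x::real^'n. A)" for n by (rule jsmooth_const) simp
  from jsmooth_imp_smooth[OF this] show ?thesis by simp
qed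

lemma riemannian_metric_const: "riemannian_metric g \<Longrightarrow> riemannian_metric (\<lambda>_. g x)"
  by (simp add: riemannian_metric_def smooth_const)

text \<open>The lower bound comes from a linear calibration, the upper one from the straight
  segment. Together they reduce completeness to that of the Euclidean plane.\<close>

lemma riemannian_dist_const:
  assumes A: "riemannian_metric (\<lambda>_. A)"
  obtains m where "m > 0" "\<And>x y. m * dist x y \<le> riemannian_dist (\<lambda>_. A) x y"
    "\<And>x y. riemannian_dist (\<lambda>_. A) x y \<le> sqrt ((y - x) \<bullet> (A *v (y - x)))"
proof -
  obtain m where m0: "m > 0" "\<And>(x::plane) v. x \<in> {0} \<Longrightarrow> m * norm v \<le> sqrt (v \<bullet> (A *v v))"
    by (rule quadratic_form_lower_bound[OF A, of "{0}", OF compact_sing insert_not_empty], rule that)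
  then have m: "m > 0" "\<And>v. m * norm v \<le> sqrt (v \<bullet> (A *v v))" by auto
  show thesis
  proof (rule that[OF m(1)])
    fix x y :: plane
    show "riemannian_dist (\<lambda>_. A) x y \<le> sqrt ((y - x) \<bullet> (A *v (y - x)))"
    proof (rule riemannian_dist_le[OF A])
      have "((\<lambda>_. sqrt ((y - x) \<bullet> (A *v (y - x)))) has_integral sqrt ((y - x) \<bullet> (A *v (y - x)))) {0..1::real}"
        using has_integral_const_real[of "sqrt ((y - x) \<bullet> (A *v (y - x)))" 0 1] by simp
      then have "(speed (\<lambda>_. A) (linepath x y) has_integral sqrt ((y - x) \<bullet> (A *v (y - x)))) {0..1}"
        by (rule has_integral_eq[rotated]) (simp add: speed_def Let_def vector_derivative_linepath_within)
      then show "sqrt ((y - x) \<bullet> (A *v (y - x))) \<in> lengths (\<lambda>_. A) x y"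
        unfolding lengths_def has_riemannian_length_speed by (auto intro!: exI[of _ "linepath x y"])
    qed
    \<comment> \<open>The unit vector from \<open>x\<close> to \<open>y\<close>, or 0 if they
      coincide; the linear function in this direction measures their Euclidean distance.\<close>
    define u where "u = sgn (y - x)"
    have "norm u \<le> 1" by (simp add: u_def norm_sgn)
    have "\<bar>m * (u \<bullet> y) - m * (u \<bullet> x)\<bar> \<le> riemannian_dist (\<lambda>_. A) x y"
    proof (rule calibration_le_riemannian_dist[OF A])
      show "((\<lambda>z. m * (u \<bullet> z)) has_derivative (\<lambda>v. m * (u \<bullet> v))) (at z)" for z
        by (intro has_derivative_mult_right has_derivative_inner_right has_derivative_ident)
      show "\<bar>m * (u \<bullet> v)\<bar> \<le> sqrt (v \<bullet> (A *v v))" for v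
      proof -
        have "\<bar>u \<bullet> v\<bar> \<le> norm u * norm v" by (rule Cauchy_Schwarz_ineq2)
        also have "\<dots> \<le> norm v" using \<open>norm u \<le> 1\<close> mult_right_mono[of "norm u" 1 "norm v"] by simp
        finally have "m * \<bar>u \<bullet> v\<bar> \<le> m * norm v" using m(1) by (intro mult_left_mono) auto
        also have "\<dots> \<le> sqrt (v \<bullet> (A *v v))" by (rule m(2))
        finally show ?thesis using m(1) by (simp add: abs_mult)
      qed
    qed
    moreover have "u \<bullet> y - u \<bullet> x = dist x y"
    proof -
      have "u \<bullet> y - u \<bullet> x = u \<bullet> (y - x)" by (simp add: inner_diff_right)
      also have "\<dots> = norm (y - x)"
        by (cases "y = x") (simp_all add: u_def sgn_div_norm power2_eq_square flip: power2_norm_eq_inner)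
      finally show ?thesis by (simp add: dist_norm norm_minus_commute)
    qed
    ultimately show "m * dist x y \<le> riemannian_dist (\<lambda>_. A) x y"
      using m(1) by (simp flip: right_diff_distrib)
  qed
qed

lemma complete_riemannian_const:
  assumes A: "riemannian_metric (\<lambda>_. A)"
  shows "complete_riemannian (\<lambda>_. A)"
proof -
  let ?d = "riemannian_dist (\<lambda>_. A)"
  have d: "Metric_space UNIV ?d" by (rule Metric_space_riemannian_dist[OF A])
  obtain m where m: "m > 0" "\<And>x y. m * dist x y \<le> ?d x y" "\<And>x y. ?d x y \<le> sqrt ((y - x) \<bullet> (A *v (y - x)))"
    using riemannian_dist_const[OF A] by blast
  show ?thesis unfolding complete_riemannian_def Metric_space.mcomplete_def[OF d]
  proof (intro allI impI)
    fix \<sigma> assume "Metric_space.MCauchy UNIV ?d \<sigma>"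
    then have C: "\<exists>N. \<forall>n n'. N \<le> n \<longrightarrow> N \<le> n' \<longrightarrow> ?d (\<sigma> n) (\<sigma> n') < e" if "e > 0" for e
      using that unfolding Metric_space.MCauchy_def[OF d] by blast
    have "Cauchy \<sigma>"
    proof (rule metric_CauchyI)
      fix e :: real assume "e > 0"
      then obtain N where N: "\<forall>n n'. N \<le> n \<longrightarrow> N \<le> n' \<longrightarrow> ?d (\<sigma> n) (\<sigma> n') < m * e"
        using C[of "m * e"] m(1) by auto
      have "dist (\<sigma> i) (\<sigma> j) < e" if "i \<ge> N" "j \<ge> N" for i j
      proof -
        have "m * dist (\<sigma> i) (\<sigma> j) < m * e" using N that m(2) le_less_trans by blast
        then show ?thesis using m(1) by simp
      qed
      then show "\<exists>N. \<forall>i\<ge>N. \<forall>j\<ge>N. dist (\<sigma> i) (\<sigma> j) < e" by blast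
    qed
    then obtain l where l: "\<sigma> \<longlonglongrightarrow> l" using Cauchy_convergent convergent_def by blast
    have "(\<lambda>n. sqrt ((l - \<sigma> n) \<bullet> (A *v (l - \<sigma> n)))) \<longlonglongrightarrow> sqrt ((l - l) \<bullet> (A *v (l - l)))"
      by (intro tendsto_intros l bounded_linear.tendsto[OF matrix_vector_mul_bounded_linear])
    then have lim: "(\<lambda>n. sqrt ((l - \<sigma> n) \<bullet> (A *v (l - \<sigma> n)))) \<longlonglongrightarrow> 0" by simp
    have "limitin (Metric_space.mtopology UNIV ?d) \<sigma> l sequentially"
      unfolding Metric_space.limit_metric_sequentially[OF d]
    proof (intro conjI allI impI)
      fix e :: real assume "e > 0"
      then obtain N where N: "\<forall>n\<ge>N. sqrt ((l - \<sigma> n) \<bullet> (A *v (l - \<sigma> n))) < e"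
        using order_tendstoD(2)[OF lim, of e] unfolding eventually_sequentially by blast
      have "?d (\<sigma> n) l < e" if "n \<ge> N" for n
        using N that m(3)[of "\<sigma> n" l] le_less_trans by blast
      then show "\<exists>N. \<forall>n\<ge>N. \<sigma> n \<in> UNIV \<and> ?d (\<sigma> n) l < e" by blast
    qed simp
    then show "\<exists>x. limitin (Metric_space.mtopology UNIV ?d) \<sigma> x sequentially" by blast
  qed
qed

lemma const_in_complete_nonneg_metrics:
  assumes A: "riemannian_metric (\<lambda>_. A)"
  shows "(\<lambda>_. A) \<in> complete_nonneg_metrics"
proof -
  have "gauss_curvature (\<lambda>_. A) x = 0" for x
    unfolding gauss_curvature_brioschi[OF A] by (simp add: brioschi_def)
  then show ?thesis using A complete_riemannian_const[OF A] by (simp add: complete_nonneg_metrics_def)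
qed

lemma continuous_on_expsum: "bounded_coeffs e \<Longrightarrow> continuous_on UNIV (expsum e)"
  by (intro continuous_at_imp_continuous_on ballI DERIV_isCont[OF has_real_derivative_expsum])

theorem shear_pullback_in_complete_nonneg_metrics:
  assumes g: "g \<in> complete_nonneg_metrics" and c: "c > 0" and s: "s \<ge> 0" and e: "bounded_coeffs e"
  shows "shear_pullback c s (expsum e) (expsum (shift e)) g \<in> complete_nonneg_metrics"
proof -
  note der = has_real_derivative_expsum[OF e] has_real_derivative_expsum[OF bounded_coeffs_shift[OF e]]
    has_real_derivative_expsum[OF bounded_coeffs_shift[OF bounded_coeffs_shift[OF e]]]
  have main: "shear_pullback c s (expsum e) (expsum (shift e)) g \<in> complete_nonneg_metrics"
    if g: "g \<in> complete_nonneg_metrics" and s: "s > 0" for g s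
  proof -
    have rg: "riemannian_metric g" and K: "gauss_curvature g x \<ge> 0" for x
      using g by (auto simp: complete_nonneg_metrics_def)
    let ?g = "shear_pullback c s (expsum e) (expsum (shift e)) g"
    have rg': "riemannian_metric ?g" by (rule riemannian_metric_shear_pullback[OF rg c e])
    have "gauss_curvature ?g x \<ge> 0" for x
      using gauss_curvature_shear_pullback[OF rg rg' _ der] K c by simp
    moreover have "complete_riemannian ?g"
      unfolding complete_riemannian_def
    proof (rule mcomplete_rescale[OF Metric_space_riemannian_dist[OF rg] Metric_space_riemannian_dist[OF rg']])
      show "s / sqrt c > 0" using c s by simp
      show "riemannian_dist g (shear_map s (expsum e) x) (shear_map s (expsum e) y) = s / sqrt c * riemannian_dist ?g x y" for x y
        by (rule riemannian_dist_shear_pullback[OF rg rg' c s der(1) continuous_on_expsum[OF bounded_coeffs_shift[OF e]]])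
      show "shear_map s (expsum e) (shear_map (1/s) (\<lambda>y. - s * expsum e (y / s)) x) = x" for x
        using s by (intro shear_map_inverse) simp
      show "Metric_space.mcomplete UNIV (riemannian_dist g)"
        using g by (simp add: complete_nonneg_metrics_def complete_riemannian_def)
    qed
    ultimately show ?thesis using rg' by (simp add: complete_nonneg_metrics_def)
  qed
  show ?thesis
  proof (cases "s = 0")
    case True
    \<comment> \<open>For \<open>s = 0\<close> every point is sent to the origin, so only
      \<open>g 0\<close> is seen. The result is a pullback of that constant metric with factor 1, to
      which \<open>main\<close> applies.\<close>
    have "riemannian_metric (\<lambda>_. g 0)" using g riemannian_metric_const by (simp add: complete_nonneg_metrics_def)
    from main[OF const_in_complete_nonneg_metrics[OF this], of 1]
    have "shear_pullback c 1 (expsum e) (expsum (shift e)) (\<lambda>_. g 0) \<in> complete_nonneg_metrics" by simp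
    moreover have "shear_map 0 (expsum e) x = 0" for x by (simp add: shear_map_def vec_eq_iff forall_2)
    then have "shear_pullback c 1 (expsum e) (expsum (shift e)) (\<lambda>_. g 0) = shear_pullback c s (expsum e) (expsum (shift e)) g"
      unfolding True shear_pullback_def[abs_def] by simp
    ultimately show ?thesis by simp
  next
    case False
    then show ?thesis using main g s by simp
  qed
qed

section \<open>Recovering the shear from the sheared metric\<close>

text \<open>Gronwall's argument: \<open>(d y)^2 * exp (- 2 * K * y)\<close> does not increase and
  starts at 0. Squaring removes the absolute values.\<close>

lemma linear_differential_inequality_nonneg:
  fixes d :: "real \<Rightarrow> real"
  assumes der: "\<And>y. (d has_real_derivative d' y) (at y)"
    and le: "\<And>y. 0 \<le> y \<Longrightarrow> y \<le> Y \<Longrightarrow> \<bar>d' y\<bar> \<le> K * \<bar>d y\<bar>" and "d 0 = 0" "0 \<le> y" "y \<le> Y"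
  shows "d y = 0"
proof -
  have "(d y)\<^sup>2 * exp (- 2 * K * y) \<le> (d 0)\<^sup>2 * exp (- 2 * K * 0)"
  proof (rule DERIV_nonpos_imp_nonincreasing[OF \<open>0 \<le> y\<close>])
    fix z assume z: "0 \<le> z" "z \<le> y"
    have "((\<lambda>y. (d y)\<^sup>2 * exp (- 2 * K * y)) has_real_derivative
      2 * (d z * d' z - K * (d z)\<^sup>2) * exp (- 2 * K * z)) (at z)"
      by (auto intro!: derivative_eq_intros der simp: power2_eq_square algebra_simps)
    moreover have "d z * d' z \<le> K * (d z)\<^sup>2"
    proof -
      have "d z * d' z \<le> \<bar>d z\<bar> * \<bar>d' z\<bar>" by (simp flip: abs_mult)
      also have "\<dots> \<le> \<bar>d z\<bar> * (K * \<bar>d z\<bar>)" using le[of z] z \<open>y \<le> Y\<close> by (intro mult_left_mono) auto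
      finally show ?thesis by (simp add: power2_eq_square mult.left_commute)
    qed
    ultimately show "\<exists>w. ((\<lambda>y. (d y)\<^sup>2 * exp (- 2 * K * y)) has_real_derivative w) (at z) \<and> w \<le> 0"
      by (intro exI conjI) (auto simp: mult_nonpos_nonneg)
  qed
  then show ?thesis using \<open>d 0 = 0\<close> by (simp add: mult_le_0_iff)
qed

lemma linear_differential_inequality:
  fixes d :: "real \<Rightarrow> real"
  assumes der: "\<And>y. (d has_real_derivative d' y) (at y)"
    and le: "\<And>y. \<bar>y\<bar> \<le> Y \<Longrightarrow> \<bar>d' y\<bar> \<le> K * \<bar>d y\<bar>" and "d 0 = 0" "\<bar>y\<bar> \<le> Y"
  shows "d y = 0"
proof (cases "y \<ge> 0")
  case True
  then show ?thesis using linear_differential_inequality_nonneg[of d d' Y K y] assms by auto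
next
  case False
  have "((\<lambda>y. d (- y)) has_real_derivative - d' (- y)) (at y)" for y
    using DERIV_chain2[OF der DERIV_minus[OF DERIV_ident], of y] by simp
  from linear_differential_inequality_nonneg[OF this, of Y K "- y"] show ?thesis
    using le \<open>d 0 = 0\<close> \<open>\<bar>y\<bar> \<le> Y\<close> False by simp
qed

lemma partial_deriv_lipschitz:
  fixes u :: "real^'n::finite \<Rightarrow> real"
  assumes u: "smooth u"
  obtains B where "B \<ge> 0" "\<And>x a. norm x \<le> r \<Longrightarrow> \<bar>a\<bar> \<le> r \<Longrightarrow> \<bar>u (x + a *\<^sub>R axis i 1) - u x\<bar> \<le> B * \<bar>a\<bar>"
proof -
  \<comment> \<open>The radius doubles because base point and displacement may each have size
    \<open>r\<close>.\<close>
  have "compact (partial_deriv i u ` cball 0 (2 * r))"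
    by (intro compact_continuous_image smooth_imp_continuous_on smooth_partial_deriv u compact_cball)
  then obtain B0 where B0: "\<And>x. x \<in> cball 0 (2 * r) \<Longrightarrow> \<bar>partial_deriv i u x\<bar> \<le> B0"
    using compact_imp_bounded bounded_real by (metis imageI real_norm_def bounded_iff)
  \<comment> \<open>For negative \<open>r\<close> the ball is empty and \<open>B0\<close> could be
    negative.\<close>
  define B where "B = max 0 B0"
  show thesis
  proof (rule that[of B])
    fix x a assume xa: "norm (x::real^'n) \<le> r" "\<bar>a\<bar> \<le> r"
    have "norm (u (x + a *\<^sub>R axis i 1) - u (x + 0 *\<^sub>R axis i 1)) \<le> B * norm (a - 0)"
    proof (rule field_differentiable_bound[of "{-\<bar>a\<bar>..\<bar>a\<bar>}" "\<lambda>a. u (x + a *\<^sub>R axis i 1)"])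
      fix b assume b: "b \<in> {-\<bar>a\<bar>..\<bar>a\<bar>}"
      show "((\<lambda>a. u (x + a *\<^sub>R axis i 1)) has_field_derivative partial_deriv i u (x + b *\<^sub>R axis i 1)) (at b within {-\<bar>a\<bar>..\<bar>a\<bar>})"
        by (rule has_field_derivative_at_within[OF has_real_derivative_along_axis[OF smooth_imp_differentiable[OF u]]])
      have "norm (x + b *\<^sub>R axis i 1) \<le> norm x + \<bar>b\<bar>"
        using norm_triangle_ineq[of x "b *\<^sub>R axis i 1"] by simp
      then have "x + b *\<^sub>R axis i 1 \<in> cball 0 (2 * r)" using xa b by auto
      from B0[OF this] show "norm (partial_deriv i u (x + b *\<^sub>R axis i 1)) \<le> B" by (simp add: B_def)
    qed auto
    then show "\<bar>u (x + a *\<^sub>R axis i 1) - u x\<bar> \<le> B * \<bar>a\<bar>" by simp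
  qed (simp add: B_def)
qed

text \<open>The difference of the two shears solves a differential equation with Lipschitz right-hand
  side and initial value 0.\<close>

theorem shear_pullback_inject:
  assumes g: "riemannian_metric g" and c: "c > 0"
    and e: "bounded_coeffs e" "e 0 = 0" and e': "bounded_coeffs e'" "e' 0 = 0"
    and eq: "shear_pullback c s (expsum e) (expsum (shift e)) g = shear_pullback c s (expsum e') (expsum (shift e')) g"
  shows "e = e'"
proof -
  define E where "E = (\<lambda>x. g x $ 1 $ 1)"
  define F where "F = (\<lambda>x. g x $ 1 $ 2)"
  define d where "d y = expsum e' y - expsum e y" for y
  define d' where "d' y = expsum (shift e') y - expsum (shift e) y" for y
  have der: "(d has_real_derivative d' y) (at y)" for y
    unfolding d_def[abs_def] d'_def by (intro DERIV_diff has_real_derivative_expsum e e')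
  have sm: "smooth E" "smooth F" 
    using g unfolding riemannian_metric_def E_def F_def by (auto intro: smooth_component)
  define p where "p y = (vector [0, s * y] :: plane)" for y
  have ode: "d' y * E (p y) = F (p y) - F (p y + (s * d y) *\<^sub>R axis 1 1)" for y
  proof -
    \<comment> \<open>The first shear sends \<open>x\<close> to the vertical axis, the second one to
      the point displaced by \<open>s * d y\<close>. Equality of the (1,1)-entries replaces
      \<open>E\<close> at the displaced point by \<open>E (p y)\<close>, and the (1,2)-entries then
      give the equation for \<open>d'\<close>.\<close>
    define x where "x = (vector [- expsum e y, y] :: plane)"
    have x: "shear_map s (expsum e) x = p y" "shear_map s (expsum e') x = p y + (s * d y) *\<^sub>R axis 1 1" "x $ 2 = y"
      by (simp_all add: shear_map_def x_def p_def d_def vec_eq_iff forall_2 axis_def algebra_simps)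
    have "shear_pullback c s (expsum e) (expsum (shift e)) g x $ 1 $ j = shear_pullback c s (expsum e') (expsum (shift e')) g x $ 1 $ j" for j
      by (simp add: eq)
    note this[of 1] this[of 2]
    then have "E (p y) = E (p y + (s * d y) *\<^sub>R axis 1 1)"
      "F (p y) + expsum (shift e) y * E (p y)
        = F (p y + (s * d y) *\<^sub>R axis 1 1) + expsum (shift e') y * E (p y + (s * d y) *\<^sub>R axis 1 1)"
      using c unfolding shear_pullback_nth x E_def F_def by auto
    then show ?thesis by (simp add: d'_def algebra_simps)
  qed
  have "d y0 = 0" for y0
  proof -
    define Y where "Y = \<bar>y0\<bar>"
    have "continuous_on {-Y..Y} d" by (rule DERIV_continuous_on[OF has_field_derivative_at_within[OF der]])
    then have "bounded (d ` {-Y..Y})" by (intro compact_imp_bounded compact_continuous_image) auto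
    then obtain M where M: "\<And>y. y \<in> {-Y..Y} \<Longrightarrow> \<bar>d y\<bar> \<le> M" unfolding bounded_iff real_norm_def by blast
    \<comment> \<open>Large enough for both the norm \<open>\<bar>s * y\<bar>\<close> of the base
      point \<open>p y\<close> and the displacement \<open>s * d y\<close>.\<close>
    define r where "r = \<bar>s\<bar> * (Y + \<bar>M\<bar>)"
    obtain B where B: "B \<ge> 0" "\<And>x a. norm x \<le> r \<Longrightarrow> \<bar>a\<bar> \<le> r \<Longrightarrow> \<bar>F (x + a *\<^sub>R axis 1 1) - F x\<bar> \<le> B * \<bar>a\<bar>"
      by (rule partial_deriv_lipschitz[OF sm(2), of r 1], rule that)
    have contp: "continuous_on {-Y..Y} p" unfolding p_def vector_2_axis by (intro continuous_intros)
    have "continuous_on {-Y..Y} (\<lambda>y. E (p y))"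
      using continuous_on_compose2[OF smooth_imp_continuous_on[OF sm(1), of UNIV] contp] by simp
    moreover have "{-Y..Y} \<noteq> {}" by (simp add: Y_def)
    \<comment> \<open>The positive minimum of \<open>E\<close> along the segment permits division,
      with constant \<open>B * \<bar>s\<bar> / E (p y1)\<close>.\<close>
    ultimately obtain y1 where y1: "\<And>y. y \<in> {-Y..Y} \<Longrightarrow> E (p y1) \<le> E (p y)"
      using continuous_attains_inf[OF compact_Icc, of "-Y" Y "\<lambda>y. E (p y)"] by blast
    have E: "E x > 0" for x using riemannian_metric_det_pos(2)[OF g] by (simp add: E_def)
    have normp: "norm (p y) = \<bar>s\<bar> * \<bar>y\<bar>" for y
      unfolding p_def vector_2_axis by (simp add: abs_mult)
    show ?thesis
    proof (rule linear_differential_inequality[OF der])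
      fix y assume y: "\<bar>y\<bar> \<le> Y"
      then have "y \<in> {-Y..Y}" by auto
      have "\<bar>y\<bar> \<le> Y + \<bar>M\<bar>" "\<bar>d y\<bar> \<le> Y + \<bar>M\<bar>"
        using y M[OF \<open>y \<in> {-Y..Y}\<close>] by linarith+
      then have "\<bar>s * y\<bar> \<le> r" "\<bar>s * d y\<bar> \<le> r"
        unfolding r_def abs_mult by (simp_all add: mult_left_mono)
      then have "\<bar>F (p y + (s * d y) *\<^sub>R axis 1 1) - F (p y)\<bar> \<le> B * \<bar>s * d y\<bar>"
        by (intro B(2)) (simp_all add: normp abs_mult)
      then have "\<bar>d' y\<bar> * E (p y) \<le> B * \<bar>s * d y\<bar>"
      proof -
        have "\<bar>d' y\<bar> * E (p y) = \<bar>d' y * E (p y)\<bar>" using E[of "p y"] by (simp add: abs_mult)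
        also have "\<dots> = \<bar>F (p y + (s * d y) *\<^sub>R axis 1 1) - F (p y)\<bar>" unfolding ode by (rule abs_minus_commute)
        finally show ?thesis
          using \<open>\<bar>F (p y + (s * d y) *\<^sub>R axis 1 1) - F (p y)\<bar> \<le> B * \<bar>s * d y\<bar>\<close> by simp
      qed
      moreover have "\<bar>d' y\<bar> * E (p y1) \<le> \<bar>d' y\<bar> * E (p y)"
        by (intro mult_left_mono y1 \<open>y \<in> {-Y..Y}\<close>) auto
      ultimately have "\<bar>d' y\<bar> * E (p y1) \<le> B * \<bar>s\<bar> * \<bar>d y\<bar>" by (simp add: abs_mult)
      then show "\<bar>d' y\<bar> \<le> B * \<bar>s\<bar> / E (p y1) * \<bar>d y\<bar>"
        using E[of "p y1"] by (simp add: pos_le_divide_eq)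
    qed (use e e' in \<open>auto simp: d_def expsum_0 Y_def\<close>)
  qed
  then have "expsum e = expsum e'" unfolding d_def by (intro ext) simp
  then show ?thesis by (intro ext) (rule expsum_inject[OF e(1) e'(1)])
qed

section \<open>Families of sheared metrics\<close>

text \<open>Values at a single point already separate metrics: the compact set \<open>{x}\<close>
  with no derivatives is admissible for every \<open>k\<close>.\<close>

lemma Hausdorff_space_Ck_topology: "Hausdorff_space (Ck_topology k R)"
  unfolding Hausdorff_space_def
proof (intro allI impI)
  fix g h assume "g \<in> topspace (Ck_topology k R) \<and> h \<in> topspace (Ck_topology k R) \<and> g \<noteq> h"
  then have gh: "g \<in> R" "h \<in> R" "g \<noteq> h" by auto
  then obtain x where x: "g x \<noteq> h x" by blast
  define e where "e = dist (g x) (h x) / 2"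
  have e: "e > 0" using x by (simp add: e_def)
  have op: "openin (Ck_topology k R) (Ck_nhd R f {x} [] e)" if "f \<in> R" for f
    unfolding Ck_topology_def
  proof (rule topology_generated_by_Basis)
    have "enat (length []) \<le> k" by (simp add: zero_enat_def[symmetric])
    then show "Ck_nhd R f {x} [] e \<in> {Ck_nhd R g C is e |g C is e. g \<in> R \<and> compact C \<and> enat (length is) \<le> k \<and> e > 0}"
      using that e by (intro CollectI exI[of _ f] exI[of _ "{x}"] exI[of _ "[]"] exI[of _ e]) simp
  qed
  have "dist (g x) (h x) < 2 * e" if "dist (f x) (g x) < e" "dist (f x) (h x) < e" for f
    using dist_triangle3[of "g x" "h x" "f x"] that by simp
  then have "disjnt (Ck_nhd R g {x} [] e) (Ck_nhd R h {x} [] e)"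
    by (auto simp: disjnt_iff Ck_nhd_def e_def)
  then show "\<exists>U V. openin (Ck_topology k R) U \<and> openin (Ck_topology k R) V \<and> g \<in> U \<and> h \<in> V \<and> disjnt U V"
    using op gh e by (intro exI[of _ "Ck_nhd R g {x} [] e"] exI[of _ "Ck_nhd R h {x} [] e"]) (auto simp: Ck_nhd_def)
qed

lemma jsmooth_reparam:
  assumes \<phi>: "continuous_on P \<phi>" "\<phi> ` P \<subseteq> T"
  shows "jsmooth n T u \<Longrightarrow> jsmooth n P (\<lambda>\<theta>. u (\<phi> \<theta>))"
proof (induction n arbitrary: u)
  have jc: "jcont T u \<Longrightarrow> jcont P (\<lambda>\<theta>. u (\<phi> \<theta>))" for u :: "'b \<Rightarrow> real^'c \<Rightarrow> 'd"
  proof -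
    assume u: "jcont T u"
    have "continuous_on (P \<times> UNIV) (\<lambda>z. (\<phi> (fst z), snd z :: real^'c))"
      by (intro continuous_on_Pair continuous_on_compose2[OF \<phi>(1) continuous_on_fst] continuous_on_snd continuous_on_id) auto
    from continuous_on_compose2[OF u[unfolded jcont_def] this] show "jcont P (\<lambda>\<theta>. u (\<phi> \<theta>))"
      using \<phi>(2) by (simp add: jcont_def split_def image_subset_iff)
  qed
  {
    case 0
    then show ?case using jc by simp
  next
    case (Suc n)
    have "jsmooth n P (\<lambda>\<theta>. partial_deriv i (u (\<phi> \<theta>)))" for i
      using Suc.prems by (intro Suc.IH[of "\<lambda>\<theta>. partial_deriv i (u \<theta>)"]) simp
    then show ?case using jc[of u] Suc.prems \<phi>(2) by auto
  }
qed

text \<open>Coordinate 0 of the cube is the time, the others are coefficients of the shear.\<close>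

definition blend :: "(nat \<Rightarrow> real) \<Rightarrow> (nat \<Rightarrow> real) \<Rightarrow> (real \<Rightarrow> real) \<Rightarrow> (nat \<Rightarrow> real) \<Rightarrow> nat \<Rightarrow> real" where
  "blend a b w \<theta> n = (if n = 0 then 0 else (1 - \<theta> 0) * a n + \<theta> 0 * b n + w (\<theta> 0) * \<theta> n)"

definition coeff_shear :: "real \<Rightarrow> real \<Rightarrow> (nat \<Rightarrow> real) \<Rightarrow> plane_tensor \<Rightarrow> plane_tensor" where
  "coeff_shear c s e = shear_pullback c s (expsum e) (expsum (shift e))"

text \<open>Where \<open>w\<close> vanishes, all shears coincide and the cube collapses; there
  \<open>ends\<close> keeps the metric off \<open>S\<close>. Elsewhere the time is read from the
  (1,1)-component at the origin, the shear from the metric at this time, and the cube coordinates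
  from the shear after division by \<open>w\<close>.\<close>

theorem joined_through_shears:
  fixes k :: enat and a b :: "nat \<Rightarrow> real"
  assumes S: "S \<subseteq> complete_nonneg_metrics"
      "weakly_infinite_dimensional (subtopology (complete_nonneg_topology k) S)"
    and c: "continuous_on {0..1} c" "\<And>t. t \<in> {0..1} \<Longrightarrow> c t > 0"
    and s: "continuous_on {0..1} s" "\<And>t. t \<in> {0..1} \<Longrightarrow> s t \<ge> 0"
    and w: "continuous_on {0..1} w" "\<And>t. t \<in> {0..1} \<Longrightarrow> 0 \<le> w t \<and> w t \<le> 1"
    and \<gamma>: "\<And>t. t \<in> {0..1} \<Longrightarrow> \<gamma> t \<in> complete_nonneg_metrics" "\<And>n. jsmooth n {0..1} \<gamma>"
    and inj: "inj_on (\<lambda>t. c t * \<gamma> t 0 $ 1 $ 1) {0..1}"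
    and a: "bounded_coeffs a" and b: "bounded_coeffs b"
  defines "F \<equiv> \<lambda>\<theta>. coeff_shear (c (\<theta> 0)) (s (\<theta> 0)) (blend a b w \<theta>) (\<gamma> (\<theta> 0))"
  assumes ends: "\<And>\<theta>. \<theta> \<in> hilbert_cube \<Longrightarrow> w (\<theta> 0) = 0 \<Longrightarrow> F \<theta> \<notin> S"
  obtains x y where "x \<in> hilbert_cube" "x 0 = 0" "y \<in> hilbert_cube" "y 0 = 1" "F x \<notin> S" "F y \<notin> S"
    "joined (complete_nonneg_topology k) S (F x) (F y)"
proof -
  obtain A B where AB: "\<And>n. \<bar>a n\<bar> \<le> A" "\<And>n. \<bar>b n\<bar> \<le> B" using a b unfolding bounded_coeffs_def by blast
  have t01: "\<theta> n \<in> {0..1}" if "\<theta> \<in> hilbert_cube" for \<theta> n using that by (simp add: hilbert_cube_iff)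
  have bb: "\<bar>blend a b w \<theta> n\<bar> \<le> A + B + 1" if "\<theta> \<in> hilbert_cube" for \<theta> n
  proof -
    have "\<bar>(1 - \<theta> 0) * a n\<bar> \<le> 1 * A" "\<bar>\<theta> 0 * b n\<bar> \<le> 1 * B" "\<bar>w (\<theta> 0) * \<theta> n\<bar> \<le> 1 * 1"
      unfolding abs_mult using t01[OF that] w(2)[OF t01[OF that]] AB by (intro mult_mono; auto)+
    moreover have "A \<ge> 0" "B \<ge> 0" using AB[of 0] by linarith+
    ultimately show ?thesis unfolding blend_def by auto
  qed
  have bc: "bounded_coeffs (blend a b w \<theta>)" if "\<theta> \<in> hilbert_cube" for \<theta>
    using bb[OF that] unfolding bounded_coeffs_def by blast
  have proj: "continuous_on hilbert_cube (\<lambda>\<theta>. \<theta> n)" for n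
    by (rule continuous_on_subset[OF continuous_on_product_coordinates]) auto
  have along: "continuous_on hilbert_cube (\<lambda>\<theta>. f (\<theta> 0))" if "continuous_on {0..1} f" for f :: "real \<Rightarrow> real"
    by (rule continuous_on_compose2[OF that proj]) (use t01 in auto)
  have contb: "continuous_on hilbert_cube (\<lambda>\<theta>. blend a b w \<theta> n)" for n
    unfolding blend_def by (cases "n = 0") (auto intro!: continuous_intros proj along w)
  have FR: "F \<theta> \<in> complete_nonneg_metrics" if "\<theta> \<in> hilbert_cube" for \<theta>
    unfolding F_def coeff_shear_def
    by (intro shear_pullback_in_complete_nonneg_metrics \<gamma> c s bc that t01)
  have "jsmooth n hilbert_cube (\<lambda>\<theta>. \<gamma> (\<theta> 0))" for n
    by (rule jsmooth_reparam[OF proj _ \<gamma>(2)]) (use t01 in auto)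
  then have "jsmooth n hilbert_cube F" for n
    unfolding F_def coeff_shear_def by (intro jsmooth_shear_pullback[where B = "A + B + 1"] along c(1) s(1) contb bb)
  then have cont: "continuous_map (top_of_set hilbert_cube) (complete_nonneg_topology k) F"
    using FR by (intro continuous_map_Ck_topology) (auto simp: complete_nonneg_metrics_def riemannian_metric_def)
  \<comment> \<open>\<open>blend\<close> has zero constant term, so the shear fixes the origin;
    moreover the first coordinate field is not tilted by a shear.\<close>
  have F11: "F \<theta> 0 $ 1 $ 1 = c (\<theta> 0) * \<gamma> (\<theta> 0) 0 $ 1 $ 1" for \<theta>
  proof -
    have "shear_map (s (\<theta> 0)) (expsum (blend a b w \<theta>)) 0 = 0"
      by (simp add: shear_map_def vec_eq_iff forall_2 expsum_0 blend_def)
    then show ?thesis by (simp add: F_def coeff_shear_def shear_pullback_nth)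
  qed
  have rec: "x (Suc i) = y (Suc i)" if x: "x \<in> hilbert_cube" and y: "y \<in> hilbert_cube" and eq: "F x = F y" and xS: "F x \<in> S" for x y i
  proof -
    have t: "x 0 = y 0"
      using F11[of x] F11[of y] inj_onD[OF inj _ t01[OF x] t01[OF y]] eq by simp
    have "riemannian_metric (\<gamma> (x 0))" using \<gamma>(1)[OF t01[OF x]] by (simp add: complete_nonneg_metrics_def)
    note inj' = shear_pullback_inject[OF this c(2)[OF t01[OF x, of 0]] bc[OF x] _ bc[OF y], of "s (x 0)"]
    have "blend a b w x = blend a b w y"
      by (rule inj') (use eq t in \<open>simp_all add: F_def coeff_shear_def blend_def\<close>)
    then have "blend a b w x (Suc i) = blend a b w y (Suc i)" by simp
    then have "w (x 0) * x (Suc i) = w (x 0) * y (Suc i)" by (simp add: blend_def t)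
    \<comment> \<open>A point over \<open>S\<close> cannot sit at a pinned time.\<close>
    moreover have "w (x 0) \<noteq> 0" using ends[OF x] xS by blast
    ultimately show ?thesis by simp
  qed
  note thesisI = that
  show thesis
  proof (rule joined_across_hilbert_cube[OF Hausdorff_space_Ck_topology cont S(2)])
    show "x (Suc i) = y (Suc i)" if "x \<in> hilbert_cube" "y \<in> hilbert_cube" "F x = F y" "F x \<in> S" for x y i
      by (rule rec[OF that])
    show thesis if "x \<in> hilbert_cube" "x 0 = 0" "y \<in> hilbert_cube" "y 0 = 1" "F x \<notin> S" "F y \<notin> S"
      "joined (complete_nonneg_topology k) S (F x) (F y)" for x y
      by (rule thesisI[OF that])
  qed
qed

lemma coeff_shear_0:
  assumes "riemannian_metric g"
  shows "coeff_shear 1 1 (\<lambda>_. 0) g = g"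
proof
  fix x
  have "expsum (\<lambda>_. 0) = (\<lambda>_. 0)" "expsum (shift (\<lambda>_. 0)) = (\<lambda>_. 0)"
    by (auto simp: expsum_def shift_def)
  moreover have "shear_map 1 (\<lambda>_. 0) x = x" by (simp add: shear_map_def vec_eq_iff forall_2)
  ultimately have "coeff_shear 1 1 (\<lambda>_. 0) g x $ i $ j = g x $ i $ j" for i j
    using exhaust_2[of i] exhaust_2[of j] riemannian_metric_det_pos(3)[OF assms]
    by (auto simp: coeff_shear_def shear_pullback_nth)
  then show "coeff_shear 1 1 (\<lambda>_. 0) g x = g x" by (simp add: vec_eq_iff)
qed

text \<open>Puts the end of the contraction into the normal form that the linking of flat metrics
  starts from.\<close>

lemma coeff_shear_flat: "coeff_shear c 0 e g = coeff_shear 1 1 e (\<lambda>_. c *\<^sub>R g 0)"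
proof
  fix x
  have "shear_map 0 (expsum e) x = 0" by (simp add: shear_map_def vec_eq_iff forall_2)
  then have "coeff_shear c 0 e g x $ i $ j = coeff_shear 1 1 e (\<lambda>_. c *\<^sub>R g 0) x $ i $ j" for i j
    using exhaust_2[of i] exhaust_2[of j]
    by (auto simp: coeff_shear_def shear_pullback_nth algebra_simps)
  then show "coeff_shear c 0 e g x = coeff_shear 1 1 e (\<lambda>_. c *\<^sub>R g 0) x" by (simp add: vec_eq_iff)
qed

lemma riemannian_metric_const_iff:
  "riemannian_metric (\<lambda>_. A) \<longleftrightarrow> transpose A = A \<and> (\<forall>v. v \<noteq> 0 \<longrightarrow> v \<bullet> (A *v v) > 0)"
  by (simp add: riemannian_metric_def smooth_const)

lemma riemannian_metric_const_scaleR_add: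
  assumes A: "riemannian_metric (\<lambda>_. A)" and B: "riemannian_metric (\<lambda>_. B)" and "p \<ge> 0" "q \<ge> 0" "p + q > 0"
  shows "riemannian_metric (\<lambda>_. p *\<^sub>R A + q *\<^sub>R B)"
  unfolding riemannian_metric_const_iff
proof (intro conjI allI impI)
  have "A $ 2 $ 1 = A $ 1 $ 2" "B $ 2 $ 1 = B $ 1 $ 2"
    using riemannian_metric_det_pos(3)[OF A] riemannian_metric_det_pos(3)[OF B] by auto
  then show "transpose (p *\<^sub>R A + q *\<^sub>R B) = p *\<^sub>R A + q *\<^sub>R B"
    by (simp add: vec_eq_iff forall_2 transpose_def)
  fix v :: plane assume "v \<noteq> 0"
  then have pos: "v \<bullet> (A *v v) > 0" "v \<bullet> (B *v v) > 0"
    using A B by (auto simp: riemannian_metric_const_iff)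
  have "v \<bullet> ((p *\<^sub>R A + q *\<^sub>R B) *v v) = p * (v \<bullet> (A *v v)) + q * (v \<bullet> (B *v v))"
    by (simp add: inner_vec_def matrix_vector_mult_def sum_2 algebra_simps)
  moreover have "\<dots> > 0"
  proof (cases "p > 0")
    case True
    then show ?thesis using pos \<open>q \<ge> 0\<close> by (intro add_pos_nonneg mult_pos_pos mult_nonneg_nonneg) auto
  next
    case False
    then have "p = 0" "q > 0" using \<open>p \<ge> 0\<close> \<open>p + q > 0\<close> by auto
    then show ?thesis using pos by simp
  qed
  ultimately show "v \<bullet> ((p *\<^sub>R A + q *\<^sub>R B) *v v) > 0" by simp
qed

context
  fixes k :: enat and S :: "plane_tensor set"
  assumes S: "S \<subseteq> complete_nonneg_metrics"
      "weakly_infinite_dimensional (subtopology (complete_nonneg_topology k) S)"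
begin

text \<open>The weight \<open>t\<close> pins the start at \<open>g\<close> and leaves the far face
  open, so the final shear \<open>e\<close> is whatever the crossing continuum finds. The factor
  \<open>1 + r * t\<close> makes the component at the origin strictly increasing, and
  \<open>r\<close> remains free for later adjustment.\<close>

lemma joined_to_flat:
  assumes g: "g \<in> complete_nonneg_metrics" "g \<notin> S" and r: "r > 0"
  obtains e where "bounded_coeffs e" "e 0 = 0" "coeff_shear 1 1 e (\<lambda>_. (1 + r) *\<^sub>R g 0) \<notin> S"
    "joined (complete_nonneg_topology k) S g (coeff_shear 1 1 e (\<lambda>_. (1 + r) *\<^sub>R g 0))"
proof -
  have rg: "riemannian_metric g" using g by (simp add: complete_nonneg_metrics_def)
  define F where "F \<theta> = coeff_shear (1 + r * \<theta> 0) (1 - \<theta> 0) (blend (\<lambda>_. 0) (\<lambda>_. 0) (\<lambda>t. t) \<theta>) g" for \<theta> :: "nat \<Rightarrow> real"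
  have F0: "F \<theta> = g" if "\<theta> 0 = 0" for \<theta>
  proof -
    have "blend (\<lambda>_. 0) (\<lambda>_. 0) (\<lambda>t. t) \<theta> = (\<lambda>_. 0)" by (rule ext) (simp add: blend_def that)
    then show ?thesis using coeff_shear_0[OF rg] by (simp add: F_def that)
  qed
  obtain x y where xy: "x \<in> hilbert_cube" "x 0 = 0" "y \<in> hilbert_cube" "y 0 = 1" "F x \<notin> S" "F y \<notin> S"
    "joined (complete_nonneg_topology k) S (F x) (F y)"
  proof (rule joined_through_shears[OF S, where c = "\<lambda>t. 1 + r * t" and s = "\<lambda>t. 1 - t" and w = "\<lambda>t. t"
        and \<gamma> = "\<lambda>_. g" and a = "\<lambda>_. 0" and b = "\<lambda>_. 0", folded F_def])
    show "inj_on (\<lambda>t. (1 + r * t) * g 0 $ 1 $ 1) {0..1}"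
      using r riemannian_metric_det_pos(2)[OF rg, of 0] by (auto intro!: inj_onI)
    show "jsmooth n {0..1} (\<lambda>_. g)" for n
      using rg by (intro smooth_imp_jsmooth) (simp add: riemannian_metric_def)
  qed (use r g F0 in \<open>auto intro!: continuous_intros add_pos_nonneg simp: bounded_coeffs_def\<close>)
  let ?e = "blend (\<lambda>_. 0) (\<lambda>_. 0) (\<lambda>t. t) y"
  have Fy: "F y = coeff_shear 1 1 ?e (\<lambda>_. (1 + r) *\<^sub>R g 0)"
    unfolding F_def by (simp add: xy(4) coeff_shear_flat)
  have "bounded_coeffs ?e" unfolding bounded_coeffs_def blend_def
    using xy(3) by (intro exI[of _ 1]) (auto simp: hilbert_cube_iff xy(4))
  moreover have "?e 0 = 0" by (simp add: blend_def)
  ultimately show thesis using that[of ?e] xy F0[of x] Fy by simp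
qed

text \<open>The weight \<open>t * (1 - t)\<close> pins both ends, while coefficients and matrices
  are interpolated linearly. Distinct (1,1)-entries make that component a nonconstant affine
  function of time, hence injective.\<close>

lemma joined_flat:
  assumes A: "riemannian_metric (\<lambda>_. A)" "bounded_coeffs a" "a 0 = 0" "coeff_shear 1 1 a (\<lambda>_. A) \<notin> S"
    and B: "riemannian_metric (\<lambda>_. B)" "bounded_coeffs b" "b 0 = 0" "coeff_shear 1 1 b (\<lambda>_. B) \<notin> S"
    and ne: "A $ 1 $ 1 \<noteq> B $ 1 $ 1"
  shows "joined (complete_nonneg_topology k) S (coeff_shear 1 1 a (\<lambda>_. A)) (coeff_shear 1 1 b (\<lambda>_. B))"
proof -
  define w where "w t = t * (1 - t)" for t :: real
  define F where "F \<theta> = coeff_shear 1 1 (blend a b w \<theta>) (\<lambda>_. (1 - \<theta> 0) *\<^sub>R A + \<theta> 0 *\<^sub>R B)" for \<theta> :: "nat \<Rightarrow> real"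
  have F0: "F \<theta> = coeff_shear 1 1 a (\<lambda>_. A)" if "\<theta> 0 = 0" for \<theta>
  proof -
    have "blend a b w \<theta> = a" by (rule ext) (simp add: blend_def that w_def A(3))
    then show ?thesis by (simp add: F_def that)
  qed
  have F1: "F \<theta> = coeff_shear 1 1 b (\<lambda>_. B)" if "\<theta> 0 = 1" for \<theta>
  proof -
    have "blend a b w \<theta> = b" by (rule ext) (simp add: blend_def that w_def B(3))
    then show ?thesis by (simp add: F_def that)
  qed
  obtain x y where xy: "x \<in> hilbert_cube" "x 0 = 0" "y \<in> hilbert_cube" "y 0 = 1" "F x \<notin> S" "F y \<notin> S"
    "joined (complete_nonneg_topology k) S (F x) (F y)"
  proof (rule joined_through_shears[OF S, where c = "\<lambda>t. 1" and s = "\<lambda>t. 1" and w = w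
        and \<gamma> = "\<lambda>t _. (1 - t) *\<^sub>R A + t *\<^sub>R B" and a = a and b = b, folded F_def])
    show "inj_on (\<lambda>t. 1 * ((1 - t) *\<^sub>R A + t *\<^sub>R B) $ 1 $ 1) {0..1}"
    proof (rule inj_onI)
      fix t u assume "1 * ((1 - t) *\<^sub>R A + t *\<^sub>R B) $ 1 $ 1 = 1 * ((1 - u) *\<^sub>R A + u *\<^sub>R B) $ 1 $ 1"
      then have "(t - u) * (B $ 1 $ 1 - A $ 1 $ 1) = 0" by (simp add: algebra_simps)
      with ne show "t = u" by simp
    qed
    show "jsmooth n {0..1} (\<lambda>t _. (1 - t) *\<^sub>R A + t *\<^sub>R B)" for n
      by (intro jsmooth_const continuous_intros)
    show "(\<lambda>_. (1 - t) *\<^sub>R A + t *\<^sub>R B) \<in> complete_nonneg_metrics" if "t \<in> {0..1}" for t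
      using that by (intro const_in_complete_nonneg_metrics riemannian_metric_const_scaleR_add A B) auto
    show "0 \<le> w t \<and> w t \<le> 1" if "t \<in> {0..1}" for t
      using that by (auto simp: w_def intro: mult_le_one)
    show "continuous_on {0..1} w" unfolding w_def by (intro continuous_intros)
    show "F \<theta> \<notin> S" if "w (\<theta> 0) = 0" for \<theta>
      using that F0[of \<theta>] F1[of \<theta>] A(4) B(4) by (auto simp: w_def)
  qed (use A B in auto)
  then show ?thesis using F0 F1 by simp
qed

theorem joined_complement:
  assumes g: "g \<in> complete_nonneg_metrics - S" and h: "h \<in> complete_nonneg_metrics - S"
  shows "joined (complete_nonneg_topology k) S g h"
proof -
  \<comment> \<open>Ensures \<open>(1 + r) * g_11 \<noteq> 2 * h_11\<close> at the origin: equal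
    components are scaled by 3 and 2, unequal ones both by 2.\<close>
  define r :: real where "r = (if g 0 $ 1 $ 1 = h 0 $ 1 $ 1 then 2 else 1)"
  have rm: "riemannian_metric g" "riemannian_metric h" using g h by (auto simp: complete_nonneg_metrics_def)
  have r: "r > 0" by (simp add: r_def)
  obtain a where a: "bounded_coeffs a" "a 0 = 0" "coeff_shear 1 1 a (\<lambda>_. (1 + r) *\<^sub>R g 0) \<notin> S"
    "joined (complete_nonneg_topology k) S g (coeff_shear 1 1 a (\<lambda>_. (1 + r) *\<^sub>R g 0))"
    using joined_to_flat[of g r] g r by blast
  obtain b where b: "bounded_coeffs b" "b 0 = 0" "coeff_shear 1 1 b (\<lambda>_. (1 + 1) *\<^sub>R h 0) \<notin> S"
    "joined (complete_nonneg_topology k) S h (coeff_shear 1 1 b (\<lambda>_. (1 + 1) *\<^sub>R h 0))"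
    using joined_to_flat[of h 1] h zero_less_one by blast
  have flat: "riemannian_metric (\<lambda>_. (1 + q) *\<^sub>R f 0)" if "riemannian_metric f" "q > 0" for q :: real and f
    using riemannian_metric_const_scaleR_add[OF riemannian_metric_const[OF that(1)] riemannian_metric_const[OF that(1)], of 1 q 0 0] that(2)
    by (simp add: scaleR_left_distrib)
  have "((1 + r) *\<^sub>R g 0) $ 1 $ 1 \<noteq> ((1 + 1) *\<^sub>R h 0) $ 1 $ 1"
    using riemannian_metric_det_pos(2)[OF rm(1), of 0] by (auto simp: r_def)
  from joined_flat[OF flat[OF rm(1)] a(1-3) flat[OF rm(2)] b(1-3) this]
  have "joined (complete_nonneg_topology k) S (coeff_shear 1 1 a (\<lambda>_. (1 + r) *\<^sub>R g 0)) (coeff_shear 1 1 b (\<lambda>_. (1 + 1) *\<^sub>R h 0))"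
    by (simp add: r_def)
  with a(4) b(4) show ?thesis by (meson joined_sym joined_trans)
qed

end

theorem theorem10:
  fixes k :: enat and S :: "plane_tensor set"
  assumes "S \<subseteq> complete_nonneg_metrics"
    and "weakly_infinite_dimensional (subtopology (complete_nonneg_topology k) S)"
  shows "continuum_connected
           (subtopology (complete_nonneg_topology k) (complete_nonneg_metrics - S)) \<and>
         (closedin (complete_nonneg_topology k) S \<longrightarrow>
          path_connectedin (complete_nonneg_topology k) (complete_nonneg_metrics - S))"
proof (intro conjI impI)
  note joined = joined_complement[OF assms]
  let ?X = "complete_nonneg_topology k" and ?C = "complete_nonneg_metrics - S"
  show "continuum_connected (subtopology ?X ?C)"
    unfolding continuum_connected_def
  proof (intro ballI)
    fix g h assume "g \<in> topspace (subtopology ?X ?C)" "h \<in> topspace (subtopology ?X ?C)"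
    then have "joined ?X S g h" by (intro joined) auto
    then obtain K where "compactin ?X K" "connectedin ?X K" "K \<inter> S = {}" "g \<in> K" "h \<in> K"
      unfolding joined_def by blast
    moreover have "K \<subseteq> ?C" using compactin_subset_topspace[OF \<open>compactin ?X K\<close>] \<open>K \<inter> S = {}\<close> by auto
    ultimately show "\<exists>K. compactin (subtopology ?X ?C) K \<and> connectedin (subtopology ?X ?C) K \<and> g \<in> K \<and> h \<in> K"
      by (auto simp: compactin_subtopology connectedin_subtopology)
  qed
  assume "closedin ?X S"
  then have "path_component_of (subtopology ?X ?C) g h" if "g \<in> ?C" "h \<in> ?C" for g h
    using joined[OF that] unfolding joined_def by simp
  then show "path_connectedin ?X ?C"
    unfolding path_connectedin_def path_connected_space_iff_path_component by auto
qed

end
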